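(* Let $\Theta=\tilde p/p$ be a rational inner function on $\mathbb{D}^2$ of degree $(m,n)$, and let $\mathcal{K}_\Theta=\mathcal{S}_1\oplus\mathcal{S}_2$ be an orthogonal decomposition into closed subspaces with $\mathcal{S}_1$ invariant under $M_{z_1}$ and $\mathcal{S}_2$ invariant under $M_{z_2}$. Let $K_1,K_2$ be the reproducing kernels with $\mathcal{H}(K_1)=\mathcal{S}_1\ominus z_1\mathcal{S}_1$ and $\mathcal{H}(K_2)=\mathcal{S}_2\ominus z_2\mathcal{S}_2$. Let $E_\Theta=\{\tau\in\mathbb{T}:\exists\,\tau_1\in\mathbb{T}\text{ with }p(\tau_1,\tau)=0\}$. Then for every $\tau\in\mathbb{T}\setminus E_\Theta$, the slice function $\Theta_\tau:=\Theta(\cdot,\tau)$ is a Blaschke product of degree $m$, and the restriction map $\mathcal{J}_\tau:\mathcal{H}(K_2)\to\mathcal{K}_{\Theta_\tau}$, $\mathcal{J}_\tau f=f(\cdot,\tau)$, is well defined and unitary. Furthermore $\dim\mathcal{H}(K_2)=m$. The analogous statements hold for $\mathcal{H}(K_1)$: with $E'_\Theta=\{\tau\in\mathbb{T}:\exists\,\tau_2\in\mathbb{T}\text{ with }p(\tau,\tau_2)=0\}$, for every $\tau\in\mathbb{T}\setminus E'_\Theta$ the function $\Theta(\tau,\cdot)$ is a Blaschke product of degree $n$, the map $g\mapsto g(\tau,\cdot)$ is a unitary from $\mathcal{H}(K_1)$ onto the one-variable model space of $\Theta(\tau,\cdot)$, and $\dim\mathcal{H}(K_1)=n$.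
   Context: $\mathbb{D}$ is the open unit disk, $\mathbb{T}$ the unit circle, $H^2(\mathbb{D}^2)$ the Hardy space of the bidisk. A rational inner function on $\mathbb{D}^2$ is a rational function holomorphic on $\mathbb{D}^2$ with $|\Theta|=1$ a.e. on $\mathbb{T}^2$. Its degree $(m,n)$ is defined by writing $\Theta=q/p$ in lowest terms: $m$ (resp. $n$) is the highest power of $z_1$ (resp. $z_2$) appearing in $p$ or $q$. Such $\Theta$ can be written $\Theta=\tilde p/p$ with $p$ a polynomial with no zeros on $\mathbb{D}^2$, $\tilde p(z)=z_1^mz_2^n\overline{p(1/\bar z_1,1/\bar z_2)}$, and $p,\tilde p$ without common factors. The two-variable model space is $\mathcal{K}_\Theta=H^2(\mathbb{D}^2)\ominus\Theta H^2(\mathbb{D}^2)$; for a one-variable inner (Blaschke) function $B$, $\mathcal{K}_B=H^2(\mathbb{D})\ominus BH^2(\mathbb{D})$. $\mathcal{H}(K)$ denotes the reproducing kernel Hilbert space with kernel $K$. Elements of $\mathcal{H}(K_2)$ are rational functions of the form $q/p$ with $q$ a polynomial, so $f(\cdot,\tau)$ makes sense for $\tau\in\mathbb{T}\setminus E_\Theta$. *)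

theory Defs
  imports "HOL-Analysis.Analysis" "HOL-Computational_Algebra.Polynomial_Factorial"
begin

text \<open>A polynomial p in (z1,z2) is represented as an element of complex poly poly:
  the outer variable is z2, the inner (coefficient) variable is z1.\<close>

definition eval2 :: "complex poly poly \<Rightarrow> complex \<Rightarrow> complex \<Rightarrow> complex" where
  "eval2 p z1 z2 = poly (map_poly (\<lambda>q. poly q z1) p) z2"

definition coef2 :: "complex poly poly \<Rightarrow> nat \<Rightarrow> nat \<Rightarrow> complex" where
  "coef2 p j k = coeff (coeff p k) j"

definition deg1 :: "complex poly poly \<Rightarrow> nat" where
  "deg1 p = Max ((\<lambda>k. degree (coeff p k)) ` {..degree p})"

definition deg2 :: "complex poly poly \<Rightarrow> nat" where
  "deg2 p = degree p"

text \<open>reflection: refl2 m n p (z) = z1^m z2^n conj(p(1/conj z1, 1/conj z2))\<close>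
definition refl2 :: "nat \<Rightarrow> nat \<Rightarrow> complex poly poly \<Rightarrow> complex poly poly" where
  "refl2 m n p = Poly (map (\<lambda>k. Poly (map (\<lambda>j. cnj (coef2 p (m - j) (n - k))) [0..<Suc m])) [0..<Suc n])"

abbreviation disc :: "complex set" where "disc \<equiv> ball 0 1"
abbreviation circle :: "complex set" where "circle \<equiv> sphere 0 1"

text \<open>Elements of H^2(D^2) are represented as functions that vanish off the bidisk.\<close>

definition H2_2_coeffs :: "(nat \<times> nat \<Rightarrow> complex) \<Rightarrow> (complex \<Rightarrow> complex \<Rightarrow> complex) \<Rightarrow> bool" where
  "H2_2_coeffs a f \<longleftrightarrow>
     (\<lambda>jk. (cmod (a jk))\<^sup>2) summable_on UNIV \<and>
     (\<forall>z1\<in>disc. \<forall>z2\<in>disc. ((\<lambda>(j,k). a (j,k) * z1 ^ j * z2 ^ k) has_sum f z1 z2) UNIV) \<and>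
     (\<forall>z1 z2. \<not> (z1 \<in> disc \<and> z2 \<in> disc) \<longrightarrow> f z1 z2 = 0)"

definition H2_2 :: "(complex \<Rightarrow> complex \<Rightarrow> complex) set" where
  "H2_2 = {f. \<exists>a. H2_2_coeffs a f}"

definition h2coef2 :: "(complex \<Rightarrow> complex \<Rightarrow> complex) \<Rightarrow> nat \<times> nat \<Rightarrow> complex" where
  "h2coef2 f = (SOME a. H2_2_coeffs a f)"

definition inner2 :: "(complex \<Rightarrow> complex \<Rightarrow> complex) \<Rightarrow> (complex \<Rightarrow> complex \<Rightarrow> complex) \<Rightarrow> complex" where
  "inner2 f g = (\<Sum>\<^sub>\<infinity>jk. h2coef2 f jk * cnj (h2coef2 g jk))"

definition norm2 :: "(complex \<Rightarrow> complex \<Rightarrow> complex) \<Rightarrow> real" where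
  "norm2 f = sqrt (Re (inner2 f f))"

definition closed_subspace2 :: "(complex \<Rightarrow> complex \<Rightarrow> complex) set \<Rightarrow> bool" where
  "closed_subspace2 S \<longleftrightarrow> S \<subseteq> H2_2 \<and> (\<lambda>_ _. 0) \<in> S \<and>
     (\<forall>f\<in>S. \<forall>g\<in>S. (\<lambda>z1 z2. f z1 z2 + g z1 z2) \<in> S) \<and>
     (\<forall>c. \<forall>f\<in>S. (\<lambda>z1 z2. c * f z1 z2) \<in> S) \<and>
     (\<forall>u f. (\<forall>i. u i \<in> S) \<longrightarrow> f \<in> H2_2 \<longrightarrow>
        (\<lambda>i. norm2 (\<lambda>z1 z2. u i z1 z2 - f z1 z2)) \<longlonglongrightarrow> 0 \<longrightarrow> f \<in> S)"

definition Mz1 :: "(complex \<Rightarrow> complex \<Rightarrow> complex) \<Rightarrow> (complex \<Rightarrow> complex \<Rightarrow> complex)" where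
  "Mz1 f = (\<lambda>z1 z2. z1 * f z1 z2)"

definition Mz2 :: "(complex \<Rightarrow> complex \<Rightarrow> complex) \<Rightarrow> (complex \<Rightarrow> complex \<Rightarrow> complex)" where
  "Mz2 f = (\<lambda>z1 z2. z2 * f z1 z2)"

definition Mult2 :: "(complex \<Rightarrow> complex \<Rightarrow> complex) \<Rightarrow> (complex \<Rightarrow> complex \<Rightarrow> complex) \<Rightarrow> (complex \<Rightarrow> complex \<Rightarrow> complex)" where
  "Mult2 \<Theta> f = (\<lambda>z1 z2. if z1 \<in> disc \<and> z2 \<in> disc then \<Theta> z1 z2 * f z1 z2 else 0)"

definition RIF :: "nat \<Rightarrow> nat \<Rightarrow> complex poly poly \<Rightarrow> complex \<Rightarrow> complex \<Rightarrow> complex" where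
  "RIF m n p z1 z2 = eval2 (refl2 m n p) z1 z2 / eval2 p z1 z2"

definition model2 :: "(complex \<Rightarrow> complex \<Rightarrow> complex) \<Rightarrow> (complex \<Rightarrow> complex \<Rightarrow> complex) set" where
  "model2 \<Theta> = {f \<in> H2_2. \<forall>g\<in>H2_2. inner2 f (Mult2 \<Theta> g) = 0}"

definition wander :: "((complex \<Rightarrow> complex \<Rightarrow> complex) \<Rightarrow> (complex \<Rightarrow> complex \<Rightarrow> complex))
   \<Rightarrow> (complex \<Rightarrow> complex \<Rightarrow> complex) set \<Rightarrow> (complex \<Rightarrow> complex \<Rightarrow> complex) set" where
  "wander M S = {f \<in> S. \<forall>g\<in>S. inner2 f (M g) = 0}"

definition has_dim2 :: "(complex \<Rightarrow> complex \<Rightarrow> complex) set \<Rightarrow> nat \<Rightarrow> bool" where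
  "has_dim2 S d \<longleftrightarrow> (\<exists>b :: nat \<Rightarrow> complex \<Rightarrow> complex \<Rightarrow> complex.
      (\<forall>i<d. b i \<in> S) \<and>
      (\<forall>c. (\<lambda>z1 z2. \<Sum>i<d. c i * b i z1 z2) = (\<lambda>_ _. 0) \<longrightarrow> (\<forall>i<d. c i = 0)) \<and>
      (\<forall>f\<in>S. \<exists>c. f = (\<lambda>z1 z2. \<Sum>i<d. c i * b i z1 z2)))"

definition H2_1_coeffs :: "(nat \<Rightarrow> complex) \<Rightarrow> (complex \<Rightarrow> complex) \<Rightarrow> bool" where
  "H2_1_coeffs a f \<longleftrightarrow>
     summable (\<lambda>j. (cmod (a j))\<^sup>2) \<and>
     (\<forall>z\<in>disc. (\<lambda>j. a j * z ^ j) sums f z) \<and>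
     (\<forall>z. z \<notin> disc \<longrightarrow> f z = 0)"

definition H2_1 :: "(complex \<Rightarrow> complex) set" where
  "H2_1 = {f. \<exists>a. H2_1_coeffs a f}"

definition h2coef1 :: "(complex \<Rightarrow> complex) \<Rightarrow> nat \<Rightarrow> complex" where
  "h2coef1 f = (SOME a. H2_1_coeffs a f)"

definition inner1 :: "(complex \<Rightarrow> complex) \<Rightarrow> (complex \<Rightarrow> complex) \<Rightarrow> complex" where
  "inner1 f g = (\<Sum>j. h2coef1 f j * cnj (h2coef1 g j))"

definition Mult1 :: "(complex \<Rightarrow> complex) \<Rightarrow> (complex \<Rightarrow> complex) \<Rightarrow> (complex \<Rightarrow> complex)" where
  "Mult1 B f = (\<lambda>z. if z \<in> disc then B z * f z else 0)"

definition model1 :: "(complex \<Rightarrow> complex) \<Rightarrow> (complex \<Rightarrow> complex) set" where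
  "model1 B = {f \<in> H2_1. \<forall>g\<in>H2_1. inner1 f (Mult1 B g) = 0}"

definition blaschke_deg :: "(complex \<Rightarrow> complex) \<Rightarrow> nat \<Rightarrow> bool" where
  "blaschke_deg B d \<longleftrightarrow> (\<exists>c a. cmod c = 1 \<and> (\<forall>i<d. a i \<in> disc) \<and>
      (\<forall>z\<in>disc. B z = c * (\<Prod>i<d. (z - a i) / (1 - cnj (a i) * z))))"

definition slice_second :: "(complex \<Rightarrow> complex \<Rightarrow> complex) \<Rightarrow> complex \<Rightarrow> (complex \<Rightarrow> complex)" where
  "slice_second f \<tau> = (\<lambda>z. if z \<in> disc then Lim (at_left 1) (\<lambda>r::real. f z (of_real r * \<tau>)) else 0)"

definition slice_first :: "(complex \<Rightarrow> complex \<Rightarrow> complex) \<Rightarrow> complex \<Rightarrow> (complex \<Rightarrow> complex)" where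
  "slice_first f \<tau> = (\<lambda>w. if w \<in> disc then Lim (at_left 1) (\<lambda>r::real. f (of_real r * \<tau>) w) else 0)"

definition unitary_onto :: "(complex \<Rightarrow> complex \<Rightarrow> complex) set \<Rightarrow> (complex \<Rightarrow> complex) set
    \<Rightarrow> ((complex \<Rightarrow> complex \<Rightarrow> complex) \<Rightarrow> (complex \<Rightarrow> complex)) \<Rightarrow> bool" where
  "unitary_onto S K J \<longleftrightarrow> J ` S = K \<and>
     (\<forall>f\<in>S. \<forall>g\<in>S. \<forall>a b. J (\<lambda>z1 z2. a * f z1 z2 + b * g z1 z2) = (\<lambda>z. a * J f z + b * J g z)) \<and>
     (\<forall>f\<in>S. \<forall>g\<in>S. inner1 (J f) (J g) = inner2 f g)"

end

theory Submission
  imports Defs "HOL-Complex_Analysis.Complex_Analysis"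
    "HOL-Computational_Algebra.Field_as_Ring"
    "HOL-Computational_Algebra.Fundamental_Theorem_Algebra"
begin

text \<open>Multiplication by \<open>\<Theta>\<close> is a contraction of \<open>H\<^sup>2\<close>, because the rational inner functions built from
  \<open>p(r\<sqdot>)\<close>, \<open>r < 1\<close>, are isometric multipliers that converge to it coefficientwise. Its defect form
  vanishes on the multiples of \<open>p\<close> and of its reflection, hence (Bezout) on the multiples of a nonzero
  polynomial in \<open>z\<^sub>1\<close>, hence everywhere by stripping linear factors: \<open>\<Theta>\<close> is isometric.

  For \<open>f \<in> S\<^sub>2\<close>, orthogonality of all \<open>z\<^sub>2\<^sup>l f\<close> to \<open>\<Theta> p H\<^sup>2\<close> forces \<open>p f\<close> to have degree \<open>< m\<close> in
  \<open>z\<^sub>1\<close>; if moreover \<open>f \<perp> z\<^sub>2 S\<^sub>2\<close>, then the backward shift of \<open>f\<close> in \<open>z\<^sub>2\<close> lies in \<open>S\<^sub>1\<close>, so \<open>p f\<close> has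
  degree \<open>\<le> n\<close> in \<open>z\<^sub>2\<close>. Thus the wandering subspace consists of quotients \<open>q/p\<close>, and since its shifts
  are mutually orthogonal, counting dimensions of polynomials bounds its dimension by \<open>m\<close>.

  Splitting the kernel of \<open>\<K>\<^sub>\<Theta>\<close> along \<open>S\<^sub>1 \<oplus> S\<^sub>2\<close> gives the Agler decomposition
  \<open>1 - \<Theta>(z) \<Theta>(w)\<^sup>* = (1 - z\<^sub>2 w\<^sub>2\<^sup>*) K\<^sub>1(z,w) + (1 - z\<^sub>1 w\<^sub>1\<^sup>*) K\<^sub>2(z,w)\<close> (\<open>*\<close> for conjugation) with both
  kernels finite sums of such quotients. Letting \<open>z\<^sub>2 = w\<^sub>2 \<rightarrow> \<tau>\<close> radially removes the first term, so the slices of an orthonormal basis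
  of \<open>\<H>(K\<^sub>2)\<close> represent the kernel of the \<open>m\<close>-dimensional one-variable model space. As there are at most
  \<open>m\<close> of them, they form an orthonormal basis of it.\<close>

section \<open>Hardy space of the bidisk: coefficients and inner product\<close>

text \<open>Boundary values are never formed: inner products are sums over Taylor coefficients, so
  the fact that \<open>\<Theta>\<close> is unimodular on the torus has to enter algebraically. It
  does so through \<open>inner2_refl\<close>, which moves a reflected polynomial across the inner
  product as the polynomial itself, against a monomial. The obstacle is that p may vanish on the
  torus: then 1/p is unbounded, p H^2 is a proper subspace, and an identity on multiples of p does
  not extend by division. Dilation removes the zeros but yields only an inequality in the limit;
  coprimality, through the Bezout identity, recovers equality. Coprimality also provides the slices
  without zeros on which the dimension statements rest, since these mention no tau. A dimension
  bound has to come before slicing: it makes both kernels finite sums, so that limits pass through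
  them, and without it a spanning family of slices could not be recognised as orthonormal. Whatever
  is needed on the side of \<open>S1\<close> is obtained by exchanging the variables. The
  one-variable Hardy space is handled as a copy inside the two-variable one.\<close>

type_synonym bifun = "complex \<Rightarrow> complex \<Rightarrow> complex"

section \<open>Square-summable families and their pairing\<close>

definition l2 :: "('i \<Rightarrow> complex) \<Rightarrow> bool" where
  "l2 a \<longleftrightarrow> (\<lambda>i. (cmod (a i))\<^sup>2) summable_on UNIV"

definition ip :: "('i \<Rightarrow> complex) \<Rightarrow> ('i \<Rightarrow> complex) \<Rightarrow> complex" where
  "ip a b = (\<Sum>\<^sub>\<infinity>i. a i * cnj (b i))"

lemma l2_abs_summable_mult:
  assumes "l2 a" "l2 b"
  shows "(\<lambda>i. norm (a i * b i)) summable_on UNIV"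
proof (rule summable_on_comparison_test)
  show "(\<lambda>i. (cmod (a i))\<^sup>2 + (cmod (b i))\<^sup>2) summable_on UNIV"
    using assms unfolding l2_def by (rule summable_on_add)
  fix i
  have "2 * (cmod (a i) * cmod (b i)) \<le> (cmod (a i))\<^sup>2 + (cmod (b i))\<^sup>2"
    using sum_squares_bound[of "cmod (a i)" "cmod (b i)"] by (simp add: mult_ac)
  then show "norm (a i * b i) \<le> (cmod (a i))\<^sup>2 + (cmod (b i))\<^sup>2"
    by (simp add: norm_mult) (smt (verit) mult_nonneg_nonneg norm_ge_zero)
qed auto

lemma l2_cnj: "l2 a \<Longrightarrow> l2 (\<lambda>i. cnj (a i))"
  by (simp add: l2_def)

lemma l2_summable_ip: "l2 a \<Longrightarrow> l2 b \<Longrightarrow> (\<lambda>i. a i * cnj (b i)) summable_on UNIV"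
  by (rule abs_summable_summable) (rule l2_abs_summable_mult, auto intro: l2_cnj)

lemma l2_zero [simp]: "l2 (\<lambda>_. 0)"
  by (simp add: l2_def)

lemma l2_add:
  assumes "l2 a" "l2 b"
  shows "l2 (\<lambda>i. a i + b i)"
  unfolding l2_def
proof (rule summable_on_comparison_test)
  show "(\<lambda>i. 2 * ((cmod (a i))\<^sup>2 + (cmod (b i))\<^sup>2)) summable_on UNIV"
    using assms unfolding l2_def by (intro summable_on_cmult_right summable_on_add)
  fix i
  have "(cmod (a i + b i))\<^sup>2 \<le> (cmod (a i) + cmod (b i))\<^sup>2"
    by (simp add: norm_triangle_ineq power_mono)
  also have "\<dots> \<le> 2 * ((cmod (a i))\<^sup>2 + (cmod (b i))\<^sup>2)"
    using sum_squares_bound[of "cmod (a i)" "cmod (b i)"] by (simp add: power2_sum)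
  finally show "(cmod (a i + b i))\<^sup>2 \<le> 2 * ((cmod (a i))\<^sup>2 + (cmod (b i))\<^sup>2)" .
qed auto

lemma l2_scale: "l2 a \<Longrightarrow> l2 (\<lambda>i. c * a i)"
  unfolding l2_def by (simp add: norm_mult power_mult_distrib summable_on_cmult_right)

lemma ip_add_left: "l2 a \<Longrightarrow> l2 b \<Longrightarrow> l2 g \<Longrightarrow> ip (\<lambda>i. a i + b i) g = ip a g + ip b g"
  unfolding ip_def by (simp add: distrib_right infsum_add l2_summable_ip)

lemma ip_scale_left: "ip (\<lambda>i. c * a i) g = c * ip a g"
  unfolding ip_def by (simp add: mult.assoc infsum_cmult_right')

lemma ip_commute: "ip g f = cnj (ip f g)"
  unfolding ip_def by (simp flip: infsum_cnj add: mult.commute)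

lemma ip_self: "l2 a \<Longrightarrow> ip a a = of_real (\<Sum>\<^sub>\<infinity>i. (cmod (a i))\<^sup>2)"
proof -
  assume "l2 a"
  then have "((\<lambda>i. complex_of_real ((cmod (a i))\<^sup>2)) has_sum of_real (\<Sum>\<^sub>\<infinity>i. (cmod (a i))\<^sup>2)) UNIV"
    unfolding l2_def by (intro has_sum_of_real has_sum_infsum)
  then have *: "(\<Sum>\<^sub>\<infinity>i. complex_of_real ((cmod (a i))\<^sup>2)) = of_real (\<Sum>\<^sub>\<infinity>i. (cmod (a i))\<^sup>2)"
    by (rule infsumI)
  have "ip a a = (\<Sum>\<^sub>\<infinity>i. of_real ((cmod (a i))\<^sup>2))"
    unfolding ip_def by (rule infsum_cong) (simp only: complex_norm_square)
  also have "\<dots> = of_real (\<Sum>\<^sub>\<infinity>i. (cmod (a i))\<^sup>2)"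
    by (rule *)
  finally show ?thesis .
qed

lemma ip_self_ge_sum:
  assumes "l2 a" "finite A"
  shows "(\<Sum>i\<in>A. (cmod (a i))\<^sup>2) \<le> Re (ip a a)"
  using assms finite_sum_le_infsum[of "\<lambda>i. (cmod (a i))\<^sup>2" UNIV A] by (simp add: ip_self l2_def)

lemma ip_self_eq_0:
  assumes "l2 a" "ip a a = 0"
  shows "a i = 0"
  using ip_self_ge_sum[OF assms(1), of "{i}"] assms(2) by simp

text \<open>A family supported on the range of an injection is a relabelling of its pullback. The
  shifts, the embedding of one-variable sequences and the exchange of the two indices are all
  instances.\<close>

lemma
  fixes a b :: "'i \<Rightarrow> complex"
  assumes s: "inj s" and a: "\<And>i. a (s i) = a' i" "\<And>j. j \<notin> range s \<Longrightarrow> a j = 0"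
  shows l2_reindex: "l2 a \<longleftrightarrow> l2 a'"
    and ip_reindex_right: "ip g a = (\<Sum>\<^sub>\<infinity>i. g (s i) * cnj (a' i))"
    and has_sum_reindex_mult: "((\<lambda>j. a j * g j) has_sum S) UNIV \<longleftrightarrow> ((\<lambda>i. a' i * g (s i)) has_sum S) UNIV"
proof -
  have "(\<lambda>i. (cmod (a i))\<^sup>2) summable_on UNIV \<longleftrightarrow> (\<lambda>i. (cmod (a i))\<^sup>2) summable_on range s"
    by (rule summable_on_cong_neutral) (auto simp: a(2))
  also have "\<dots> \<longleftrightarrow> ((\<lambda>i. (cmod (a i))\<^sup>2) \<circ> s) summable_on UNIV"
    using s by (rule summable_on_reindex)
  finally show "l2 a \<longleftrightarrow> l2 a'" by (simp add: l2_def o_def a(1))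
  have "ip g a = (\<Sum>\<^sub>\<infinity>j\<in>range s. g j * cnj (a j))"
    unfolding ip_def by (rule infsum_cong_neutral) (auto simp: a(2))
  also have "\<dots> = infsum ((\<lambda>j. g j * cnj (a j)) \<circ> s) UNIV"
    using s by (rule infsum_reindex)
  finally show "ip g a = (\<Sum>\<^sub>\<infinity>i. g (s i) * cnj (a' i))" by (simp add: o_def a(1))
  have "((\<lambda>j. a j * g j) has_sum S) UNIV \<longleftrightarrow> ((\<lambda>j. a j * g j) has_sum S) (range s)"
    by (rule has_sum_cong_neutral) (auto simp: a(2))
  also have "\<dots> \<longleftrightarrow> (((\<lambda>j. a j * g j) \<circ> s) has_sum S) UNIV"
    using s by (rule has_sum_reindex)
  finally show "((\<lambda>j. a j * g j) has_sum S) UNIV \<longleftrightarrow> ((\<lambda>i. a' i * g (s i)) has_sum S) UNIV"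
    by (simp add: o_def a(1))
qed

text \<open>Evaluation at (z1, z2) as a sequence; its conjugate is the coefficient sequence of the
  Szego kernel at that point.\<close>

definition mon2 :: "complex \<Rightarrow> complex \<Rightarrow> nat \<times> nat \<Rightarrow> complex" where
  "mon2 z1 z2 = (\<lambda>(j,k). z1 ^ j * z2 ^ k)"

lemma mon2_sums_weighted:
  fixes x y :: real
  assumes "0 \<le> x" "x < 1" "0 \<le> y" "y < 1"
  shows "(\<lambda>(j,k). x ^ j * y ^ k) summable_on (UNIV :: (nat \<times> nat) set)"
proof -
  have 1: "(\<lambda>j. x ^ j) summable_on UNIV" "(\<lambda>k. y ^ k) summable_on UNIV"
    using assms by (auto intro!: summable_nonneg_imp_summable_on summable_geometric)
  have "(\<lambda>(j,k). x ^ j * y ^ k) summable_on (UNIV \<times> UNIV)"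
    using assms by (intro summable_on_SigmaI[where g="\<lambda>j. x ^ j * infsum (\<lambda>k. y ^ k) UNIV"])
      (auto intro!: has_sum_cmult_right has_sum_infsum summable_on_cmult_left 1)
  then show ?thesis by simp
qed

lemma mon2_l2:
  assumes "z1 \<in> disc" "z2 \<in> disc"
  shows "l2 (mon2 z1 z2)"
proof -
  have "(\<lambda>(j,k). ((cmod z1)\<^sup>2) ^ j * ((cmod z2)\<^sup>2) ^ k) summable_on (UNIV :: (nat \<times> nat) set)"
    using assms by (intro mon2_sums_weighted) (auto simp: power_less_one_iff)
  then show ?thesis
    unfolding l2_def
    by (rule summable_on_cong[THEN iffD1, rotated])
      (auto simp: mon2_def norm_mult norm_power power_mult_distrib power_even_eq mult.commute simp flip: power_mult)
qed

lemma H2_2_coeffs_alt: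
  "H2_2_coeffs a f \<longleftrightarrow> l2 a \<and> (\<forall>z1\<in>disc. \<forall>z2\<in>disc. ((\<lambda>i. a i * mon2 z1 z2 i) has_sum f z1 z2) UNIV) \<and>
     (\<forall>z1 z2. \<not> (z1 \<in> disc \<and> z2 \<in> disc) \<longrightarrow> f z1 z2 = 0)"
  unfolding H2_2_coeffs_def l2_def mon2_def by (simp add: case_prod_unfold mult.assoc)

definition fn2 :: "(nat \<times> nat \<Rightarrow> complex) \<Rightarrow> bifun" where
  "fn2 a = (\<lambda>z1 z2. if z1 \<in> disc \<and> z2 \<in> disc then (\<Sum>\<^sub>\<infinity>i. a i * mon2 z1 z2 i) else 0)"

lemma fn2_coeffs: "l2 a \<Longrightarrow> H2_2_coeffs a (fn2 a)"
  unfolding H2_2_coeffs_alt fn2_def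
  by (auto intro!: has_sum_infsum abs_summable_summable[OF l2_abs_summable_mult] mon2_l2)

lemma H2_2_coeffs_imp_fn2: "H2_2_coeffs a f \<Longrightarrow> f = fn2 a"
  unfolding H2_2_coeffs_alt fn2_def by (intro ext) (auto intro!: infsumI[symmetric])

lemma power_series_sums_0_coeff:
  fixes a :: "nat \<Rightarrow> complex"
  assumes "\<And>z. z \<in> disc \<Longrightarrow> (\<lambda>n. a n * z ^ n) sums 0"
  shows "a n = 0"
proof (rule ccontr)
  assume n: "a n \<noteq> 0"
  have "a 0 = 0"
    using assms[of 0] by simp
  with n have "n > 0" by (cases n) auto
  show False
  proof (rule powser_0_nonzero[of 1 0 a "\<lambda>_. 0" n])
    fix s :: real assume s: "0 < s" "\<And>z::complex. z \<in> cball 0 s - {0} \<Longrightarrow> (0::complex) \<noteq> 0"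
    then show False using s(2)[of "of_real s"] by simp
  qed (use n \<open>n > 0\<close> assms in auto)
qed

text \<open>Uniqueness, one variable at a time: for fixed z2 the inner sums over k are the
  coefficients of a power series in z1 with sum 0, and each of them is then such a series in
  z2.\<close>

lemma mon2_has_sum_0_coeff:
  assumes a: "l2 a"
    and 0: "\<And>z1 z2. z1 \<in> disc \<Longrightarrow> z2 \<in> disc \<Longrightarrow> ((\<lambda>i. a i * mon2 z1 z2 i) has_sum 0) UNIV"
  shows "a i = 0"
proof -
  have sm: "(\<lambda>i. a i * mon2 z1 z2 i) summable_on (UNIV \<times> UNIV)" if "z1 \<in> disc" "z2 \<in> disc" for z1 z2
    using abs_summable_summable[OF l2_abs_summable_mult[OF a mon2_l2[OF that]]] by simp
  have row: "(\<lambda>k. a (j,k) * z2 ^ k) summable_on UNIV" if "z2 \<in> disc" for j z2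
  proof -
    \<comment> \<open>Any nonzero point of the disc would do for z1: its power is divided out of the
      row afterwards.\<close>
    have "(\<lambda>(j,k). a (j,k) * mon2 (1/2) z2 (j,k)) summable_on (UNIV \<times> UNIV)"
      using sm[of "1/2" z2] that by (simp add: case_prod_unfold)
    from summable_on_SigmaD1[OF this, of j]
    have "(\<lambda>k. a (j,k) * mon2 (1/2) z2 (j,k)) summable_on UNIV"
      by simp
    then have "(\<lambda>k. 2^j * (a (j,k) * mon2 (1/2) z2 (j,k))) summable_on UNIV"
      by (rule summable_on_cmult_right)
    then show ?thesis
      by (simp add: mon2_def power_divide mult_ac)
  qed
  have inner0: "(\<Sum>\<^sub>\<infinity>k. a (j,k) * z2 ^ k) = 0" if z2: "z2 \<in> disc" for j z2
  proof (rule power_series_sums_0_coeff)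
    fix z1 :: complex assume z1: "z1 \<in> disc"
    have "((\<lambda>j. \<Sum>\<^sub>\<infinity>k. a (j,k) * mon2 z1 z2 (j,k)) has_sum 0) UNIV"
      by (rule has_sum_SigmaD[where B="\<lambda>_. UNIV" and f="\<lambda>i. a i * mon2 z1 z2 i"])
        (use 0[OF z1 z2] row[OF z2] in \<open>auto intro!: has_sum_infsum summable_on_cmult_right
            simp: mon2_def mult.left_commute\<close>)
    moreover have "(\<Sum>\<^sub>\<infinity>k. a (j,k) * mon2 z1 z2 (j,k)) = (\<Sum>\<^sub>\<infinity>k. a (j,k) * z2 ^ k) * z1 ^ j" for j
      by (subst infsum_cmult_left'[symmetric]) (simp add: mon2_def mult_ac)
    ultimately show "(\<lambda>j. (\<Sum>\<^sub>\<infinity>k. a (j,k) * z2 ^ k) * z1 ^ j) sums 0"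
      by (auto intro: has_sum_imp_sums)
  qed
  obtain j k where i: "i = (j,k)" by (cases i)
  have "a (j,k) = 0"
  proof (rule power_series_sums_0_coeff[where a="\<lambda>k. a (j,k)"])
    fix z :: complex assume z: "z \<in> disc"
    show "(\<lambda>k. a (j,k) * z ^ k) sums 0"
      using has_sum_imp_sums[OF has_sum_infsum[OF row[OF z, of j]]] by (simp only: inner0[OF z])
  qed
  then show ?thesis by (simp add: i)
qed

text \<open>The sequence picked by \<open>SOME\<close> is the only one, so every later computation
  of \<open>h2coef2\<close> merely has to exhibit some coefficient sequence.\<close>

lemma h2coef2_eqI:
  assumes "H2_2_coeffs a f"
  shows "h2coef2 f = a"
proof -
  define b where "b = h2coef2 f"
  have b: "H2_2_coeffs b f"
    unfolding b_def h2coef2_def using assms by (rule someI[where P="\<lambda>a. H2_2_coeffs a f"])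
  have "b i + (-1) * a i = 0" for i
  proof (rule mon2_has_sum_0_coeff[where a="\<lambda>i. b i + (-1) * a i"])
    show "l2 (\<lambda>i. b i + (-1) * a i)"
      using assms b unfolding H2_2_coeffs_alt by (intro l2_add l2_scale) auto
    fix z1 z2 :: complex assume "z1 \<in> disc" "z2 \<in> disc"
    with assms b have "((\<lambda>i. a i * mon2 z1 z2 i) has_sum f z1 z2) UNIV"
      "((\<lambda>i. b i * mon2 z1 z2 i) has_sum f z1 z2) UNIV"
      unfolding H2_2_coeffs_alt by auto
    from has_sum_add[OF this(2) has_sum_cmult_right[OF this(1), of "-1"]]
    show "((\<lambda>i. (b i + (-1) * a i) * mon2 z1 z2 i) has_sum 0) UNIV"
      by (simp add: algebra_simps)
  qed
  then show ?thesis unfolding b_def[symmetric] by auto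
qed

lemma H2_2_h2coef2: "f \<in> H2_2 \<Longrightarrow> H2_2_coeffs (h2coef2 f) f"
  unfolding H2_2_def using h2coef2_eqI by auto

lemma l2_h2coef2: "f \<in> H2_2 \<Longrightarrow> l2 (h2coef2 f)"
  using H2_2_h2coef2 H2_2_coeffs_alt by blast

lemma H2_2_outside: "f \<in> H2_2 \<Longrightarrow> \<not> (z1 \<in> disc \<and> z2 \<in> disc) \<Longrightarrow> f z1 z2 = 0"
  unfolding H2_2_def H2_2_coeffs_def by auto

lemma fn2_h2coef2: "f \<in> H2_2 \<Longrightarrow> fn2 (h2coef2 f) = f"
  using H2_2_h2coef2 H2_2_coeffs_imp_fn2 by metis

lemma h2coef2_fn2: "l2 a \<Longrightarrow> h2coef2 (fn2 a) = a"
  by (intro h2coef2_eqI fn2_coeffs)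

lemma fn2_H2_2: "l2 a \<Longrightarrow> fn2 a \<in> H2_2"
  unfolding H2_2_def using fn2_coeffs by auto

lemma H2_2_coeffs_add:
  "H2_2_coeffs a f \<Longrightarrow> H2_2_coeffs b g \<Longrightarrow> H2_2_coeffs (\<lambda>i. a i + b i) (\<lambda>z1 z2. f z1 z2 + g z1 z2)"
  unfolding H2_2_coeffs_alt by (auto simp: distrib_right intro: l2_add has_sum_add)

lemma H2_2_coeffs_scale:
  "H2_2_coeffs a f \<Longrightarrow> H2_2_coeffs (\<lambda>i. c * a i) (\<lambda>z1 z2. c * f z1 z2)"
  unfolding H2_2_coeffs_alt by (auto simp: mult.assoc intro: l2_scale has_sum_cmult_right)

lemma H2_2_coeffs_zero: "H2_2_coeffs (\<lambda>_. 0) (\<lambda>_ _. 0)"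
  unfolding H2_2_coeffs_alt by auto

section \<open>Shifts in the two indices\<close>

definition shift1 :: "(nat \<times> nat \<Rightarrow> complex) \<Rightarrow> nat \<times> nat \<Rightarrow> complex" where
  "shift1 a = (\<lambda>(j,k). if j = 0 then 0 else a (j - 1, k))"

definition shift2 :: "(nat \<times> nat \<Rightarrow> complex) \<Rightarrow> nat \<times> nat \<Rightarrow> complex" where
  "shift2 a = (\<lambda>(j,k). if k = 0 then 0 else a (j, k - 1))"

lemma shift1_simps [simp]: "shift1 a (Suc j, k) = a (j, k)" "shift1 a (0, k) = 0"
  and shift2_simps [simp]: "shift2 a (j, Suc k) = a (j, k)" "shift2 a (j, 0) = 0"
  by (auto simp: shift1_def shift2_def)

lemma shift1_outside: "i \<notin> range (map_prod Suc id) \<Longrightarrow> shift1 a i = 0"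
  by (cases i; cases "fst i") (auto simp: image_iff)

lemma shift2_outside: "i \<notin> range (map_prod id Suc) \<Longrightarrow> shift2 a i = 0"
  by (cases i; cases "snd i") (auto simp: image_iff)

lemma inj_map_prod_Suc: "inj (map_prod Suc id)" "inj (map_prod id Suc)"
  by (auto simp: inj_def)

lemma l2_shift [simp]: "l2 (shift1 a) \<longleftrightarrow> l2 a" "l2 (shift2 a) \<longleftrightarrow> l2 a"
  by (rule l2_reindex[OF inj_map_prod_Suc(1)]; auto simp: shift1_outside)
    (rule l2_reindex[OF inj_map_prod_Suc(2)]; auto simp: shift2_outside)

text \<open>The adjoint of a shift is the backward shift. As the latter undoes the former, shifts
  are isometric (\<open>ip_shift\<close>).\<close>

lemma ip_shift1_right: "ip g (shift1 a) = ip (\<lambda>(j,k). g (Suc j, k)) a"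
  by (subst ip_reindex_right[OF inj_map_prod_Suc(1), where a'=a])
    (auto simp: shift1_outside ip_def case_prod_unfold map_prod_def)

lemma ip_shift2_right: "ip g (shift2 a) = ip (\<lambda>(j,k). g (j, Suc k)) a"
  by (subst ip_reindex_right[OF inj_map_prod_Suc(2), where a'=a])
    (auto simp: shift2_outside ip_def case_prod_unfold map_prod_def)

lemma ip_shift [simp]: "ip (shift1 a) (shift1 b) = ip a b" "ip (shift2 a) (shift2 b) = ip a b"
  by (simp_all add: ip_shift1_right ip_shift2_right)

lemma mon2_Suc:
  "mon2 z1 z2 (map_prod Suc id i) = z1 * mon2 z1 z2 i"
  "mon2 z1 z2 (map_prod id Suc i) = z2 * mon2 z1 z2 i"
  by (cases i; simp add: mon2_def mult_ac)+

lemma has_sum_shift: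
  "((\<lambda>i. shift1 a i * mon2 z1 z2 i) has_sum S) UNIV \<longleftrightarrow> ((\<lambda>i. z1 * (a i * mon2 z1 z2 i)) has_sum S) UNIV"
  "((\<lambda>i. shift2 a i * mon2 z1 z2 i) has_sum S) UNIV \<longleftrightarrow> ((\<lambda>i. z2 * (a i * mon2 z1 z2 i)) has_sum S) UNIV"
  by (subst has_sum_reindex_mult[OF inj_map_prod_Suc(1), where a'=a];
      auto simp: shift1_outside mon2_Suc mult_ac)
    (subst has_sum_reindex_mult[OF inj_map_prod_Suc(2), where a'=a];
      auto simp: shift2_outside mon2_Suc mult_ac)

lemma H2_2_coeffs_Mz1: "H2_2_coeffs a f \<Longrightarrow> H2_2_coeffs (shift1 a) (Mz1 f)"
  and H2_2_coeffs_Mz2: "H2_2_coeffs a f \<Longrightarrow> H2_2_coeffs (shift2 a) (Mz2 f)"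
  unfolding H2_2_coeffs_alt by (auto simp: Mz1_def Mz2_def has_sum_shift has_sum_cmult_right)

lemma H2_2_add: "f \<in> H2_2 \<Longrightarrow> g \<in> H2_2 \<Longrightarrow> (\<lambda>z1 z2. f z1 z2 + g z1 z2) \<in> H2_2"
  and H2_2_scale: "f \<in> H2_2 \<Longrightarrow> (\<lambda>z1 z2. c * f z1 z2) \<in> H2_2"
  and H2_2_zero: "(\<lambda>_ _. 0) \<in> H2_2"
  and H2_2_Mz1: "f \<in> H2_2 \<Longrightarrow> Mz1 f \<in> H2_2"
  and H2_2_Mz2: "f \<in> H2_2 \<Longrightarrow> Mz2 f \<in> H2_2"
  unfolding H2_2_def
  by (auto intro: H2_2_coeffs_add H2_2_coeffs_scale H2_2_coeffs_zero H2_2_coeffs_Mz1 H2_2_coeffs_Mz2)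

lemma h2coef2_add:
    "f \<in> H2_2 \<Longrightarrow> g \<in> H2_2 \<Longrightarrow> h2coef2 (\<lambda>z1 z2. f z1 z2 + g z1 z2) = (\<lambda>i. h2coef2 f i + h2coef2 g i)"
  and h2coef2_scale: "f \<in> H2_2 \<Longrightarrow> h2coef2 (\<lambda>z1 z2. c * f z1 z2) = (\<lambda>i. c * h2coef2 f i)"
  and h2coef2_zero: "h2coef2 (\<lambda>_ _. 0) = (\<lambda>_. 0)"
  and h2coef2_Mz1: "f \<in> H2_2 \<Longrightarrow> h2coef2 (Mz1 f) = shift1 (h2coef2 f)"
  and h2coef2_Mz2: "f \<in> H2_2 \<Longrightarrow> h2coef2 (Mz2 f) = shift2 (h2coef2 f)"
  by (intro h2coef2_eqI H2_2_coeffs_add H2_2_coeffs_scale H2_2_coeffs_zero H2_2_coeffs_Mz1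
      H2_2_coeffs_Mz2 H2_2_h2coef2; assumption)+

lemma inner2_ip: "inner2 f g = ip (h2coef2 f) (h2coef2 g)"
  by (simp add: inner2_def ip_def)

lemma inner2_commute: "inner2 g f = cnj (inner2 f g)"
  unfolding inner2_ip by (rule ip_commute)

lemma inner2_add_left:
  "f \<in> H2_2 \<Longrightarrow> g \<in> H2_2 \<Longrightarrow> h \<in> H2_2 \<Longrightarrow> inner2 (\<lambda>z1 z2. f z1 z2 + g z1 z2) h = inner2 f h + inner2 g h"
  by (simp add: inner2_ip h2coef2_add ip_add_left l2_h2coef2)

lemma inner2_scale_left:
  "f \<in> H2_2 \<Longrightarrow> inner2 (\<lambda>z1 z2. c * f z1 z2) h = c * inner2 f h"
  by (simp add: inner2_ip h2coef2_scale ip_scale_left)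

lemma inner2_add_right:
  "f \<in> H2_2 \<Longrightarrow> g \<in> H2_2 \<Longrightarrow> h \<in> H2_2 \<Longrightarrow> inner2 h (\<lambda>z1 z2. f z1 z2 + g z1 z2) = inner2 h f + inner2 h g"
  using arg_cong[OF inner2_add_left[of f g h], of cnj] by (simp flip: inner2_commute)

lemma inner2_scale_right:
  "f \<in> H2_2 \<Longrightarrow> inner2 h (\<lambda>z1 z2. c * f z1 z2) = cnj c * inner2 h f"
  using arg_cong[OF inner2_scale_left[of f c h], of cnj] by (simp flip: inner2_commute)

lemma inner2_zero_left [simp]: "inner2 (\<lambda>_ _. 0) h = 0"
  and inner2_zero_right [simp]: "inner2 h (\<lambda>_ _. 0) = 0"
  by (simp_all add: inner2_ip h2coef2_zero ip_def)

lemma H2_2_sum: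
  "(\<And>i. i \<in> A \<Longrightarrow> f i \<in> H2_2) \<Longrightarrow> (\<lambda>z1 z2. \<Sum>i\<in>A. f i z1 z2) \<in> H2_2"
  by (induction A rule: infinite_finite_induct) (auto intro: H2_2_zero H2_2_add)

lemma inner2_sum_left:
  "(\<And>i. i \<in> A \<Longrightarrow> f i \<in> H2_2) \<Longrightarrow> h \<in> H2_2 \<Longrightarrow>
    inner2 (\<lambda>z1 z2. \<Sum>i\<in>A. f i z1 z2) h = (\<Sum>i\<in>A. inner2 (f i) h)"
  by (induction A rule: infinite_finite_induct) (auto simp: inner2_add_left H2_2_sum)

lemma inner2_sum_right:
  "(\<And>i. i \<in> A \<Longrightarrow> f i \<in> H2_2) \<Longrightarrow> h \<in> H2_2 \<Longrightarrow>
    inner2 h (\<lambda>z1 z2. \<Sum>i\<in>A. f i z1 z2) = (\<Sum>i\<in>A. inner2 h (f i))"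
  by (induction A rule: infinite_finite_induct) (auto simp: inner2_add_right H2_2_sum)

lemma inner2_self_eq_0:
  assumes "f \<in> H2_2" "inner2 f f = 0"
  shows "f = (\<lambda>_ _. 0)"
proof -
  have "h2coef2 f = (\<lambda>_. 0)"
    using ip_self_eq_0[OF l2_h2coef2[OF assms(1)]] assms(2) by (auto simp: inner2_ip)
  then show ?thesis
    using fn2_h2coef2[OF assms(1)] by (simp add: fn2_def cong: if_cong)
qed

lemma inner2_self_real: "inner2 f f = of_real (Re (inner2 f f))"
  using inner2_commute[of f f] by (simp add: complex_eq_iff)

lemma inner2_self_nonneg: "f \<in> H2_2 \<Longrightarrow> 0 \<le> Re (inner2 f f)"
  unfolding inner2_ip using ip_self_ge_sum[OF l2_h2coef2, of f "{}"] by simp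

lemma inner2_Mz1 [simp]: "f \<in> H2_2 \<Longrightarrow> g \<in> H2_2 \<Longrightarrow> inner2 (Mz1 f) (Mz1 g) = inner2 f g"
  and inner2_Mz2 [simp]: "f \<in> H2_2 \<Longrightarrow> g \<in> H2_2 \<Longrightarrow> inner2 (Mz2 f) (Mz2 g) = inner2 f g"
  by (simp_all add: inner2_ip h2coef2_Mz1 h2coef2_Mz2)

section \<open>The Szego kernel of the bidisk\<close>

definition szego2 :: "complex \<Rightarrow> complex \<Rightarrow> bifun" where
  "szego2 w1 w2 = fn2 (\<lambda>i. cnj (mon2 w1 w2 i))"

lemma szego2_H2_2: "w1 \<in> disc \<Longrightarrow> w2 \<in> disc \<Longrightarrow> szego2 w1 w2 \<in> H2_2"
  unfolding szego2_def by (intro fn2_H2_2 l2_cnj mon2_l2)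

lemma inner2_szego2:
  assumes "f \<in> H2_2" "w1 \<in> disc" "w2 \<in> disc"
  shows "inner2 f (szego2 w1 w2) = f w1 w2"
proof -
  have "inner2 f (szego2 w1 w2) = ip (h2coef2 f) (\<lambda>i. cnj (mon2 w1 w2 i))"
    unfolding inner2_ip szego2_def using assms by (simp add: h2coef2_fn2 l2_cnj mon2_l2)
  also have "\<dots> = (\<Sum>\<^sub>\<infinity>i. h2coef2 f i * mon2 w1 w2 i)"
    by (simp add: ip_def)
  also have "\<dots> = f w1 w2"
    using H2_2_h2coef2[OF assms(1)] assms(2,3) unfolding H2_2_coeffs_alt by (auto intro: infsumI)
  finally show ?thesis .
qed

text \<open>A product of two geometric series, kept in multiplied form so that it can be inserted as
  a factor 1 without discussing denominators.\<close>

lemma szego2_eq: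
  assumes w: "w1 \<in> disc" "w2 \<in> disc" and z: "z1 \<in> disc" "z2 \<in> disc"
  shows "(1 - z1 * cnj w1) * (1 - z2 * cnj w2) * szego2 w1 w2 z1 z2 = 1"
proof -
  have geom: "((\<lambda>n. x ^ n) has_sum (1 / (1 - x))) UNIV" if "norm x < 1" for x :: complex
    by (rule norm_summable_imp_has_sum)
      (use that in \<open>auto simp: norm_power intro: geometric_sums\<close>)
  define x y where "x = z1 * cnj w1" and "y = z2 * cnj w2"
  have xy: "norm x < 1" "norm y < 1"
    using w z mult_strict_mono'[of "cmod z1" 1 "cmod w1" 1] mult_strict_mono'[of "cmod z2" 1 "cmod w2" 1]
    by (auto simp: x_def y_def norm_mult)
  have sm: "(\<lambda>i. cnj (mon2 w1 w2 i) * mon2 z1 z2 i) summable_on (UNIV \<times> UNIV)"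
    using abs_summable_summable[OF l2_abs_summable_mult[OF l2_cnj[OF mon2_l2[OF w]] mon2_l2[OF z]]] by simp
  have "((\<lambda>i. cnj (mon2 w1 w2 i) * mon2 z1 z2 i) has_sum (1 / (1 - x) * (1 / (1 - y)))) (UNIV \<times> UNIV)"
  proof (rule has_sum_SigmaI)
    fix j :: nat
    show "((\<lambda>k. cnj (mon2 w1 w2 (j,k)) * mon2 z1 z2 (j,k)) has_sum (x ^ j * (1 / (1 - y)))) UNIV"
      using has_sum_cmult_right[OF geom[OF xy(2)], of "x ^ j"]
      by (simp add: mon2_def x_def y_def power_mult_distrib mult_ac)
  next
    show "((\<lambda>j. x ^ j * (1 / (1 - y))) has_sum (1 / (1 - x) * (1 / (1 - y)))) UNIV"
      by (rule has_sum_cmult_left[OF geom[OF xy(1)]])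
  qed (rule sm)
  then have "szego2 w1 w2 z1 z2 = 1 / (1 - x) * (1 / (1 - y))"
    unfolding szego2_def fn2_def using z by (simp add: infsumI)
  moreover have "x \<noteq> 1" "y \<noteq> 1" using xy by auto
  ultimately show ?thesis
    unfolding x_def[symmetric] y_def[symmetric] by simp
qed

section \<open>Multiplication by polynomials and reflection\<close>

definition mm :: "nat \<Rightarrow> nat \<Rightarrow> bifun \<Rightarrow> bifun" where
  "mm j k f = (\<lambda>z1 z2. z1 ^ j * z2 ^ k * f z1 z2)"

lemma mm_simps:
  "mm (Suc j) k f = Mz1 (mm j k f)" "mm 0 (Suc k) f = Mz2 (mm 0 k f)" "mm 0 0 f = f"
  by (auto simp: mm_def Mz1_def Mz2_def mult_ac)

lemma mm_H2_2 [simp]: "f \<in> H2_2 \<Longrightarrow> mm j k f \<in> H2_2"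
proof -
  assume f: "f \<in> H2_2"
  have "mm 0 k f \<in> H2_2" by (induction k) (auto simp: mm_simps f H2_2_Mz2)
  then show ?thesis by (induction j) (auto simp: mm_simps H2_2_Mz1)
qed

lemma inner2_mm: "f \<in> H2_2 \<Longrightarrow> g \<in> H2_2 \<Longrightarrow> inner2 (mm j k f) (mm j k g) = inner2 f g"
proof -
  assume fg: "f \<in> H2_2" "g \<in> H2_2"
  have "inner2 (mm 0 k f) (mm 0 k g) = inner2 f g"
    by (induction k) (auto simp: mm_simps fg)
  then show ?thesis by (induction j) (auto simp: mm_simps fg)
qed

lemma mm_mm: "mm j k (mm j' k' f) = mm (j + j') (k + k') f"
  by (auto simp: mm_def power_add mult_ac)

lemma shift1_apply: "shift1 a (j, k) = (if j = 0 then 0 else a (j - 1, k))"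
  and shift2_apply: "shift2 a (j, k) = (if k = 0 then 0 else a (j, k - 1))"
  by (auto simp: shift1_def shift2_def)

lemma h2coef2_mm:
  assumes f: "f \<in> H2_2"
  shows "h2coef2 (mm j k f) (a,b) = (if j \<le> a \<and> k \<le> b then h2coef2 f (a - j, b - k) else 0)"
proof -
  have 0: "h2coef2 (mm 0 k f) (a,b) = (if k \<le> b then h2coef2 f (a, b - k) else 0)" for a b
    by (induction k arbitrary: a b) (auto simp: mm_simps h2coef2_Mz2 f shift2_apply)
  show ?thesis
    by (induction j arbitrary: a) (auto simp: 0, auto simp: mm_simps h2coef2_Mz1 f shift1_apply)
qed

text \<open>Polynomials as coefficient arrays with a fixed degree bound (m, n): reflection and
  exchange of variables become reindexings, and a degree that drops needs no special care.\<close>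

definition pv :: "nat \<Rightarrow> nat \<Rightarrow> (nat \<Rightarrow> nat \<Rightarrow> complex) \<Rightarrow> bifun" where
  "pv m n c z1 z2 = (\<Sum>j\<le>m. \<Sum>k\<le>n. c j k * (z1 ^ j * z2 ^ k))"

definition pmul :: "nat \<Rightarrow> nat \<Rightarrow> (nat \<Rightarrow> nat \<Rightarrow> complex) \<Rightarrow> bifun \<Rightarrow> bifun" where
  "pmul m n c f = (\<lambda>z1 z2. pv m n c z1 z2 * f z1 z2)"

lemma pmul_alt: "pmul m n c f = (\<lambda>z1 z2. \<Sum>j\<le>m. \<Sum>k\<le>n. c j k * mm j k f z1 z2)"
  by (simp add: pmul_def pv_def mm_def sum_distrib_right mult.assoc)

lemma pmul_H2_2 [simp]: "f \<in> H2_2 \<Longrightarrow> pmul m n c f \<in> H2_2"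
  unfolding pmul_alt by (intro H2_2_sum H2_2_scale mm_H2_2)

lemma h2coef2_sum:
  "(\<And>i. i \<in> A \<Longrightarrow> f i \<in> H2_2) \<Longrightarrow> h2coef2 (\<lambda>z1 z2. \<Sum>i\<in>A. f i z1 z2) x = (\<Sum>i\<in>A. h2coef2 (f i) x)"
  by (induction A rule: infinite_finite_induct) (auto simp: h2coef2_zero h2coef2_add H2_2_sum)

lemma h2coef2_pmul:
  assumes "f \<in> H2_2"
  shows "h2coef2 (pmul m n c f) (a,b) =
    (\<Sum>j\<le>m. \<Sum>k\<le>n. c j k * (if j \<le> a \<and> k \<le> b then h2coef2 f (a - j, b - k) else 0))"
  unfolding pmul_alt
  by (simp add: h2coef2_sum H2_2_sum H2_2_scale assms h2coef2_scale h2coef2_mm)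

lemma inner2_pmul_left:
  assumes "f \<in> H2_2" "g \<in> H2_2"
  shows "inner2 (pmul m n c f) g = (\<Sum>j\<le>m. \<Sum>k\<le>n. c j k * inner2 (mm j k f) g)"
  unfolding pmul_alt
  by (simp add: inner2_sum_left H2_2_sum H2_2_scale assms inner2_scale_left)

lemma inner2_pmul_right:
  assumes "f \<in> H2_2" "g \<in> H2_2"
  shows "inner2 f (pmul m n c g) = (\<Sum>j\<le>m. \<Sum>k\<le>n. cnj (c j k) * inner2 f (mm j k g))"
  unfolding pmul_alt
  by (simp add: inner2_sum_right H2_2_sum H2_2_scale assms inner2_scale_right)

text \<open>Coefficients of z1^m z2^n conj(p(1/conj z1, 1/conj z2)) for the polynomial p with array
  \<open>c\<close>; \<open>coef2_refl2\<close> makes the link.\<close>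

definition rc :: "nat \<Rightarrow> nat \<Rightarrow> (nat \<Rightarrow> nat \<Rightarrow> complex) \<Rightarrow> nat \<Rightarrow> nat \<Rightarrow> complex" where
  "rc m n c = (\<lambda>j k. cnj (c (m - j) (n - k)))"

text \<open>On the torus the reflection of p is z1^m z2^n conj(p), and conj(p) moves across as p.
  Here this is checked monomial by monomial: multiplying both arguments by z1^(m-j) z2^(n-k) is
  isometric and turns z1^j z2^k g into z1^m z2^n g.\<close>

lemma inner2_refl:
  assumes "f \<in> H2_2" "g \<in> H2_2"
  shows "inner2 f (pmul m n (rc m n c) g) = inner2 (pmul m n c f) (mm m n g)"
proof -
  have "inner2 f (pmul m n (rc m n c) g) =
      (\<Sum>j\<le>m. \<Sum>k\<le>n. c (m - j) (n - k) * inner2 (mm (m - j) (n - k) f) (mm m n g))"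
    unfolding inner2_pmul_right[OF assms]
  proof (intro sum.cong refl)
    fix j k assume "j \<in> {..m}" "k \<in> {..n}"
    then have "inner2 (mm (m - j) (n - k) f) (mm m n g)
        = inner2 (mm (m - j) (n - k) f) (mm (m - j) (n - k) (mm j k g))"
      by (simp add: mm_mm)
    also have "\<dots> = inner2 f (mm j k g)"
      using assms by (simp add: inner2_mm)
    finally show "cnj (rc m n c j k) * inner2 f (mm j k g) =
        c (m - j) (n - k) * inner2 (mm (m - j) (n - k) f) (mm m n g)"
      by (simp add: rc_def)
  qed
  also have "\<dots> = (\<Sum>j\<le>m. \<Sum>k\<le>n. c j (n - k) * inner2 (mm j (n - k) f) (mm m n g))"
    by (rule sum.reindex_bij_witness[of _ "\<lambda>j. m - j" "\<lambda>j. m - j"]) auto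
  also have "\<dots> = (\<Sum>j\<le>m. \<Sum>k\<le>n. c j k * inner2 (mm j k f) (mm m n g))"
    by (intro sum.cong refl sum.reindex_bij_witness[of _ "\<lambda>j. n - j" "\<lambda>j. n - j"]) auto
  also have "\<dots> = inner2 (pmul m n c f) (mm m n g)"
    using assms by (simp add: inner2_pmul_left)
  finally show ?thesis .
qed

unbundle no vec_syntax

lemma pmul_pmul_commute: "pmul m n c (pmul m' n' d f) = pmul m' n' d (pmul m n c f)"
  and pmul_mm_commute: "pmul m n c (mm j k f) = mm j k (pmul m n c f)"
  by (auto simp: pmul_def mm_def mult_ac)

text \<open>The trace of the fact that p and its reflection have equal modulus on the torus:
  \<open>inner2_refl\<close> is applied twice, the two polynomials commuting in between.\<close>

lemma inner2_refl_refl: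
  assumes "f \<in> H2_2" "g \<in> H2_2"
  shows "inner2 (pmul m n (rc m n c) f) (pmul m n (rc m n c) g) = inner2 (pmul m n c f) (pmul m n c g)"
proof -
  have "inner2 (pmul m n (rc m n c) f) (pmul m n (rc m n c) g)
      = inner2 (pmul m n (rc m n c) (pmul m n c f)) (mm m n g)"
    using assms by (simp add: inner2_refl pmul_pmul_commute)
  also have "\<dots> = cnj (inner2 (mm m n g) (pmul m n (rc m n c) (pmul m n c f)))"
    by (rule inner2_commute)
  also have "\<dots> = cnj (inner2 (pmul m n c g) (pmul m n c f))"
    using assms by (simp add: inner2_refl pmul_mm_commute inner2_mm)
  also have "\<dots> = inner2 (pmul m n c f) (pmul m n c g)"
    by (rule inner2_commute[symmetric])
  finally show ?thesis .
qed

text \<open>The outer index is the power of z1 and the inner one that of z2, opposite to the nesting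
  in \<open>complex poly poly\<close>. In formal series 1/p exists and cancels before any
  summability is known.\<close>

definition fps2 :: "(nat \<times> nat \<Rightarrow> complex) \<Rightarrow> complex fps fps" where
  "fps2 a = Abs_fps (\<lambda>j. Abs_fps (\<lambda>k. a (j,k)))"

definition cf2 :: "complex fps fps \<Rightarrow> nat \<times> nat \<Rightarrow> complex" where
  "cf2 F = (\<lambda>(j,k). F $ j $ k)"

lemma cf2_fps2 [simp]: "cf2 (fps2 a) = a" and fps2_cf2 [simp]: "fps2 (cf2 F) = F"
  and fps2_nth [simp]: "fps2 a $ j $ k = a (j,k)" and cf2_apply [simp]: "cf2 F (j,k) = F $ j $ k"
  by (auto simp: cf2_def fps2_def intro!: fps_ext)

lemma fps2_mult_nth:
  "(F * G :: complex fps fps) $ a $ b = (\<Sum>j=0..a. \<Sum>k=0..b. F $ j $ k * G $ (a - j) $ (b - k))"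
  by (simp add: fps_mult_nth fps_sum_nth)

definition pfps :: "nat \<Rightarrow> nat \<Rightarrow> (nat \<Rightarrow> nat \<Rightarrow> complex) \<Rightarrow> complex fps fps" where
  "pfps m n c = fps2 (\<lambda>(j,k). if j \<le> m \<and> k \<le> n then c j k else 0)"

lemma sum_swap_bound:
  "(\<Sum>j=0..(a::nat). if j \<le> m then u j else (0::'a::comm_monoid_add)) = (\<Sum>j\<le>m. if j \<le> a then u j else 0)"
proof -
  have "(\<Sum>j=0..a. if j \<le> m then u j else 0) = sum u {j\<in>{0..a}. j \<le> m}"
    by (rule sum.inter_filter[symmetric]) simp
  also have "{j\<in>{0..a}. j \<le> m} = {j\<in>{..m}. j \<le> a}" by auto
  also have "sum u \<dots> = (\<Sum>j\<le>m. if j \<le> a then u j else 0)"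
    by (rule sum.inter_filter) simp
  finally show ?thesis .
qed

lemma pfps_mult_nth:
  "(pfps m n c * F) $ a $ b = (\<Sum>j\<le>m. \<Sum>k\<le>n. c j k * (if j \<le> a \<and> k \<le> b then F $ (a - j) $ (b - k) else 0))"
proof -
  have "(pfps m n c * F) $ a $ b =
      (\<Sum>j=0..a. if j \<le> m then \<Sum>k=0..b. if k \<le> n then c j k * F $ (a - j) $ (b - k) else 0 else 0)"
    by (auto simp: fps2_mult_nth pfps_def intro!: sum.cong)
  also have "\<dots> = (\<Sum>j\<le>m. if j \<le> a then \<Sum>k\<le>n. if k \<le> b then c j k * F $ (a - j) $ (b - k) else 0 else 0)"
    by (simp only: sum_swap_bound)
  also have "\<dots> = (\<Sum>j\<le>m. \<Sum>k\<le>n. c j k * (if j \<le> a \<and> k \<le> b then F $ (a - j) $ (b - k) else 0))"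
    by (auto intro!: sum.cong)
  finally show ?thesis .
qed

lemma h2coef2_pmul_fps:
  "f \<in> H2_2 \<Longrightarrow> h2coef2 (pmul m n c f) = cf2 (pfps m n c * fps2 (h2coef2 f))"
  by (rule ext) (auto simp: h2coef2_pmul pfps_mult_nth cong: if_cong)

lemma pmul_fn2: "l2 a \<Longrightarrow> pmul m n c (fn2 a) = fn2 (cf2 (pfps m n c * fps2 a))"
  by (metis fn2_h2coef2 fn2_H2_2 h2coef2_fn2 h2coef2_pmul_fps pmul_H2_2)

definition nbox :: "nat \<Rightarrow> (nat \<times> nat) set" where "nbox N = {..N} \<times> {..N}"

lemma finite_nbox [simp]: "finite (nbox N)" by (simp add: nbox_def)

lemma finite_subset_nbox: "finite A \<Longrightarrow> \<exists>N. A \<subseteq> nbox N"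
proof -
  assume A: "finite A"
  obtain N1 where N1: "\<forall>x\<in>fst ` A. x \<le> N1"
    using A finite_nat_set_iff_bounded_le by (metis finite_imageI)
  obtain N2 where N2: "\<forall>x\<in>snd ` A. x \<le> N2"
    using A finite_nat_set_iff_bounded_le by (metis finite_imageI)
  have "A \<subseteq> nbox (max N1 N2)"
    using N1 N2 by (force simp: nbox_def le_max_iff_disj)
  then show ?thesis ..
qed

lemma l2_nboxI:
  assumes "\<And>N. (\<Sum>i\<in>nbox N. (cmod (a i))\<^sup>2) \<le> C"
  shows "l2 a" "Re (ip a a) \<le> C"
proof -
  have *: "(\<Sum>i\<in>A. (cmod (a i))\<^sup>2) \<le> C" if A: "finite A" for A
  proof -
    obtain N where "A \<subseteq> nbox N" using finite_subset_nbox[OF A] ..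
    then have "(\<Sum>i\<in>A. (cmod (a i))\<^sup>2) \<le> (\<Sum>i\<in>nbox N. (cmod (a i))\<^sup>2)"
      by (intro sum_mono2) auto
    with assms[of N] show ?thesis by simp
  qed
  then show 1: "l2 a"
    unfolding l2_def by (intro nonneg_bdd_above_summable_on bdd_aboveI2) auto
  have "(\<Sum>\<^sub>\<infinity>i. (cmod (a i))\<^sup>2) \<le> C"
    by (rule infsum_le_finite_sums) (use 1 * in \<open>auto simp: l2_def\<close>)
  then show "Re (ip a a) \<le> C"
    by (simp add: ip_self 1)
qed

lemma L2_set_sum_le:
  "finite B \<Longrightarrow> L2_set (\<lambda>i. \<Sum>b\<in>B. u b i) A \<le> (\<Sum>b\<in>B. L2_set (u b) A)"
proof (induction B rule: finite_induct)
  case (insert x F)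
  then show ?case
    using L2_set_triangle_ineq[of "u x" "\<lambda>i. \<Sum>b\<in>F. u b i" A] by simp
qed (simp add: L2_set_def)

text \<open>Young's inequality for an \<open>\<ell>\<^sup>1\<close> and an \<open>\<ell>\<^sup>2\<close> sequence.\<close>
lemma l2_mult_abs_summable:
  assumes E: "(\<lambda>i. cmod (cf2 E i)) summable_on UNIV" and H: "l2 (cf2 H)"
  shows "l2 (cf2 (E * H))"
proof (rule l2_nboxI(1))
  fix N
  define h where "h = fn2 (cf2 H)"
  have h: "h \<in> H2_2" "h2coef2 h = cf2 H" "inner2 h h = ip (cf2 H) (cf2 H)"
    using H by (simp_all add: h_def fn2_H2_2 h2coef2_fn2 inner2_ip)
  define S where "S = (\<Sum>\<^sub>\<infinity>i. cmod (cf2 E i))"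
  define D where "D = sqrt (Re (ip (cf2 H) (cf2 H)))"
  have sh: "L2_set (\<lambda>i. cmod (h2coef2 (mm j k h) i)) (nbox N) \<le> D" for j k
    using ip_self_ge_sum[OF l2_h2coef2[OF mm_H2_2[OF h(1)]], of "nbox N" j k]
    by (simp add: L2_set_def D_def inner2_ip[symmetric] inner2_mm h)
  \<comment> \<open>The coefficients of the product are combinations of those of the shifts of
    \<open>h\<close>, with weights from \<open>E\<close>. Every shift has norm \<open>D\<close>, so
    the triangle inequality suffices.\<close>
  have "L2_set (\<lambda>i. cmod (cf2 (E * H) i)) (nbox N)
      \<le> L2_set (\<lambda>i. \<Sum>b\<in>nbox N. cmod (cf2 E b) * cmod (h2coef2 (mm (fst b) (snd b) h) i)) (nbox N)"
  proof (rule L2_set_mono)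
    fix i assume i: "i \<in> nbox N"
    obtain j k where jk: "i = (j,k)" "j \<le> N" "k \<le> N" using i by (cases i) (auto simp: nbox_def)
    have "cf2 (E * H) i = (\<Sum>l=0..j. \<Sum>t=0..k. cf2 E (l,t) * h2coef2 (mm l t h) i)"
      by (simp add: jk fps2_mult_nth h2coef2_mm h)
    also have "\<dots> = (\<Sum>b\<in>{0..j}\<times>{0..k}. cf2 E b * h2coef2 (mm (fst b) (snd b) h) i)"
      by (simp add: sum.cartesian_product case_prod_unfold cf2_def)
    also have "cmod \<dots> \<le> (\<Sum>b\<in>{0..j}\<times>{0..k}. cmod (cf2 E b) * cmod (h2coef2 (mm (fst b) (snd b) h) i))"
      by (rule order_trans[OF norm_sum]) (simp add: norm_mult)
    also have "\<dots> \<le> (\<Sum>b\<in>nbox N. cmod (cf2 E b) * cmod (h2coef2 (mm (fst b) (snd b) h) i))"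
      by (rule sum_mono2) (use jk in \<open>auto simp: nbox_def\<close>)
    finally show "cmod (cf2 (E * H) i) \<le> \<dots>" .
  qed auto
  also have "\<dots> \<le> (\<Sum>b\<in>nbox N. L2_set (\<lambda>i. cmod (cf2 E b) * cmod (h2coef2 (mm (fst b) (snd b) h) i)) (nbox N))"
    by (rule L2_set_sum_le) simp
  also have "\<dots> = (\<Sum>b\<in>nbox N. cmod (cf2 E b) * L2_set (\<lambda>i. cmod (h2coef2 (mm (fst b) (snd b) h) i)) (nbox N))"
    by (simp add: L2_set_right_distrib)
  also have "\<dots> \<le> (\<Sum>b\<in>nbox N. cmod (cf2 E b) * D)"
    by (intro sum_mono mult_left_mono sh) auto
  also have "\<dots> \<le> S * D"
    unfolding sum_distrib_right[symmetric] S_def D_def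
    by (intro mult_right_mono finite_sum_le_infsum E) (auto simp: ip_self[OF H] infsum_nonneg)
  finally have "(L2_set (\<lambda>i. cmod (cf2 (E * H) i)) (nbox N))\<^sup>2 \<le> (S * D)\<^sup>2"
    by (intro power_mono L2_set_nonneg)
  then show "(\<Sum>i\<in>nbox N. (cmod (cf2 (E * H) i))\<^sup>2) \<le> (S * D)\<^sup>2"
    by (simp add: L2_set_def sum_nonneg)
qed

text \<open>The dilate F(r z1, r z2).\<close>

definition scl :: "real \<Rightarrow> complex fps fps \<Rightarrow> complex fps fps" where
  "scl r F = fps2 (\<lambda>(j,k). of_real r ^ (j + k) * F $ j $ k)"

lemma scl_nth [simp]: "scl r F $ j $ k = of_real r ^ (j + k) * F $ j $ k"
  by (simp add: scl_def)

lemma scl_mult: "scl r (F * G) = scl r F * scl r G"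
proof (intro fps_ext)
  fix a b
  have "scl r (F * G) $ a $ b = (\<Sum>j=0..a. \<Sum>k=0..b. of_real r ^ (a + b) * (F $ j $ k * G $ (a - j) $ (b - k)))"
    by (simp add: fps2_mult_nth sum_distrib_left)
  also have "\<dots> = (scl r F * scl r G) $ a $ b"
    unfolding fps2_mult_nth
  proof (intro sum.cong refl)
    fix j k assume "j \<in> {0..a}" "k \<in> {0..b}"
    then have "a + b = (j + k) + ((a - j) + (b - k))" by simp
    then have "of_real r ^ (a + b) = (of_real r ^ (j + k) * of_real r ^ ((a - j) + (b - k)) :: complex)"
      by (metis power_add)
    then show "of_real r ^ (a + b) * (F $ j $ k * G $ (a - j) $ (b - k)) =
        scl r F $ j $ k * scl r G $ (a - j) $ (b - k)"
      by simp
  qed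
  finally show "scl r (F * G) $ a $ b = (scl r F * scl r G) $ a $ b" .
qed

lemma scl_1: "scl r 1 = 1"
  by (intro fps_ext) (auto simp: fps_one_nth)

lemma scl_pfps: "scl r (pfps m n c) = pfps m n (\<lambda>j k. of_real r ^ (j + k) * c j k)"
  by (intro fps_ext) (auto simp: pfps_def)

section \<open>Contractivity of the rational inner multiplier\<close>

lemma has_fps_expansion_poly:
  "(\<lambda>z::complex. \<Sum>i\<le>m. q i * z ^ i) has_fps_expansion (Abs_fps (\<lambda>i. if i \<le> m then q i else 0))"
proof -
  have "(\<lambda>z::complex. \<Sum>i\<le>m. q i * z ^ i) has_fps_expansion (\<Sum>i\<le>m. fps_const (q i) * fps_X ^ i)"
    by (intro fps_expansion_intros)
  also have "(\<Sum>i\<le>m. fps_const (q i) * fps_X ^ i) = Abs_fps (\<lambda>i. if i \<le> m then q i else 0)"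
    by (intro fps_ext) (simp add: fps_sum_nth fps_X_power_nth if_distrib cong: if_cong)
  finally show ?thesis .
qed

lemma has_fps_expansion_holomorphic:
  "f holomorphic_on disc \<Longrightarrow> f has_fps_expansion fps_expansion f 0"
  by (rule has_fps_expansion_fps_expansion[of disc]) auto

lemma has_fps_expansion_unique_disc:
  assumes "f has_fps_expansion F" "g has_fps_expansion G" "\<And>z::complex. z \<in> disc \<Longrightarrow> f z = g z"
  shows "F = G"
proof -
  have "eventually (\<lambda>z::complex. z \<in> disc) (nhds 0)"
    by (intro eventually_nhds_in_open) auto
  then have "eventually (\<lambda>z. f z = g z) (nhds 0)"
    by eventually_elim (rule assms(3))
  then have "f has_fps_expansion G \<longleftrightarrow> g has_fps_expansion G"
    by (intro has_fps_expansion_cong) auto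
  with assms show ?thesis
    using fps_expansion_unique_complex by blast
qed

lemma fps_expansion_cauchy_bound:
  assumes "f holomorphic_on disc" "0 < \<rho>" "\<rho> < 1" "\<And>z. cmod z = \<rho> \<Longrightarrow> cmod (f z) \<le> B"
  shows "cmod (fps_expansion f 0 $ k) \<le> B / \<rho> ^ k"
proof -
  have "norm ((deriv ^^ k) f 0) \<le> fact k * B / \<rho> ^ k"
  proof (rule Cauchy_inequality)
    show "f holomorphic_on ball 0 \<rho>"
      by (rule holomorphic_on_subset[OF assms(1)]) (use assms in auto)
    show "continuous_on (cball 0 \<rho>) f"
      by (rule continuous_on_subset[OF holomorphic_on_imp_continuous_on[OF assms(1)]]) (use assms in auto)
  qed (use assms in auto)
  then show ?thesis
    by (simp add: fps_expansion_def norm_divide field_simps)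
qed

lemma pv_continuous: "continuous_on A (\<lambda>z. pv m n c (fst z) (snd z))"
  unfolding pv_def by (intro continuous_intros)

lemma pv_holomorphic: "(\<lambda>z. pv m n c z w) holomorphic_on A" "(\<lambda>z. pv m n c w z) holomorphic_on A"
  unfolding pv_def by (intro holomorphic_intros)+

text \<open>The Taylor coefficients of \<open>1/p\<close> on the bidisk are built one variable at a time.\<close>
lemma pfps_inverse:
  assumes nz: "\<And>z1 z2. z1 \<in> disc \<Longrightarrow> z2 \<in> disc \<Longrightarrow> pv m n c z1 z2 \<noteq> 0"
  obtains E where "pfps m n c * E = 1"
    "\<And>\<rho>. 0 < \<rho> \<Longrightarrow> \<rho> < 1 \<Longrightarrow> \<exists>M. \<forall>j k. cmod (E $ j $ k) \<le> M / \<rho> ^ j / \<rho> ^ k"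
proof -
  \<comment> \<open>\<open>q i\<close> and \<open>A j\<close> are the Taylor coefficients in z1 of
    p(., z2) and of 1/p(., z2), viewed as functions of z2.\<close>
  define q where "q i z2 = (if i \<le> m then \<Sum>k\<le>n. c i k * z2 ^ k else 0)" for i and z2 :: complex
  define A where "A j z2 = fps_expansion (\<lambda>z1. 1 / pv m n c z1 z2) 0 $ j" for j z2
  have holg: "(\<lambda>z1. 1 / pv m n c z1 z2) holomorphic_on disc" if "z2 \<in> disc" for z2
    by (intro holomorphic_intros pv_holomorphic) (use nz that in auto)
  have rec: "(\<Sum>i=0..j. q i z2 * A (j - i) z2) = (if j = 0 then 1 else 0)" if z2: "z2 \<in> disc" for j z2
  proof -
    have 1: "(\<lambda>z1. pv m n c z1 z2) has_fps_expansion Abs_fps (\<lambda>i. q i z2)"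
    proof -
      have "(\<lambda>z1. pv m n c z1 z2) = (\<lambda>z1. \<Sum>i\<le>m. (\<Sum>k\<le>n. c i k * z2 ^ k) * z1 ^ i)"
        unfolding pv_def by (auto intro!: sum.cong simp: sum_distrib_right)
      then show ?thesis
        using has_fps_expansion_poly[of "\<lambda>i. \<Sum>k\<le>n. c i k * z2 ^ k" m] by (simp add: q_def)
    qed
    have "Abs_fps (\<lambda>i. q i z2) * fps_expansion (\<lambda>z1. 1 / pv m n c z1 z2) 0 = 1"
      by (rule has_fps_expansion_unique_disc[where g="\<lambda>_. 1"])
        (rule has_fps_expansion_mult[OF 1 has_fps_expansion_holomorphic[OF holg[OF z2]]],
          use nz z2 in \<open>auto intro: fps_expansion_intros\<close>)
    from arg_cong[OF this, of "\<lambda>F. F $ j"] show ?thesis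
      by (simp add: fps_mult_nth A_def)
  qed
  have q0: "q 0 z2 \<noteq> 0" if "z2 \<in> disc" for z2
  proof -
    have "pv m n c 0 z2 = (\<Sum>j\<in>{0}. \<Sum>k\<le>n. c j k * (0 ^ j * z2 ^ k))"
      unfolding pv_def by (rule sum.mono_neutral_right) (auto simp: power_0_left)
    then have "q 0 z2 = pv m n c 0 z2"
      by (simp add: q_def)
    with nz[of 0 z2] that show ?thesis by simp
  qed
  have holq: "q i holomorphic_on disc" for i
    unfolding q_def by (cases "i \<le> m") (auto intro!: holomorphic_intros)
  \<comment> \<open>Holomorphy in z2 is read off \<open>rec\<close> solved for \<open>A j\<close>;
    the divisor \<open>q 0 z2\<close> is p(0, z2), which has no zero in the disc.\<close>
  have holA: "A j holomorphic_on disc" for j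
  proof (induction j rule: less_induct)
    case (less j)
    have "(\<lambda>z2. ((if j = 0 then 1 else 0) - (\<Sum>i\<in>{1..j}. q i z2 * A (j - i) z2)) / q 0 z2) holomorphic_on disc"
      by (intro holomorphic_intros holq less q0) auto
    then show ?case
    proof (rule holomorphic_transform)
      fix z2 :: complex assume z2: "z2 \<in> disc"
      have "(\<Sum>i=0..j. q i z2 * A (j - i) z2) = q 0 z2 * A j z2 + (\<Sum>i\<in>{1..j}. q i z2 * A (j - i) z2)"
        by (simp add: sum.atLeast_Suc_atMost)
      with rec[OF z2, of j] q0[OF z2]
      show "((if j = 0 then 1 else 0) - (\<Sum>i\<in>{1..j}. q i z2 * A (j - i) z2)) / q 0 z2 = A j z2"
        by (simp add: field_simps)
    qed
  qed
  define E where "E = Abs_fps (\<lambda>j. fps_expansion (A j) 0)"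
  show thesis
  proof (rule that[of E])
    show "pfps m n c * E = 1"
    proof (rule fps_ext)
      fix a
      have P: "(\<lambda>z2. q i z2) has_fps_expansion pfps m n c $ i" for i
      proof -
        have "pfps m n c $ i = (if i \<le> m then Abs_fps (\<lambda>k. if k \<le> n then c i k else 0) else 0)"
          by (rule fps_ext) (auto simp: pfps_def)
        then show ?thesis
          unfolding q_def using has_fps_expansion_poly[of "c i" n] by simp
      qed
      have "(\<lambda>z2. \<Sum>i=0..a. q i z2 * A (a - i) z2) has_fps_expansion
          (\<Sum>i=0..a. pfps m n c $ i * fps_expansion (A (a - i)) 0)"
        by (intro fps_expansion_intros P has_fps_expansion_holomorphic holA)
      then have "(\<Sum>i=0..a. pfps m n c $ i * fps_expansion (A (a - i)) 0) = fps_const (if a = 0 then 1 else 0)"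
        by (rule has_fps_expansion_unique_disc[where g="\<lambda>_. if a = 0 then 1 else 0"])
          (use rec in \<open>auto intro: fps_expansion_intros\<close>)
      then show "(pfps m n c * E) $ a = 1 $ a"
        by (auto simp: fps_mult_nth E_def)
    qed
  next
    fix \<rho> :: real assume \<rho>: "0 < \<rho>" "\<rho> < 1"
    have "compact ((\<lambda>z. 1 / pv m n c (fst z) (snd z)) ` (cball 0 \<rho> \<times> cball 0 \<rho>))"
      by (intro compact_continuous_image continuous_intros pv_continuous compact_Times)
        (use nz \<rho> in auto)
    then obtain M where M: "\<And>x. x \<in> (\<lambda>z. 1 / pv m n c (fst z) (snd z)) ` (cball 0 \<rho> \<times> cball 0 \<rho>) \<Longrightarrow> cmod x \<le> M"
      using compact_imp_bounded bounded_iff by metis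
    have M: "cmod (1 / pv m n c z1 z2) \<le> M" if "cmod z1 \<le> \<rho>" "cmod z2 \<le> \<rho>" for z1 z2
      by (rule M) (use that in \<open>auto intro!: image_eqI[of _ _ "(z1,z2)"]\<close>)
    \<comment> \<open>Cauchy's estimate in z1 on the circle of radius \<open>\<rho>\<close>, then
      for each \<open>A j\<close> in z2 on the same radius.\<close>
    have "cmod (A j z2) \<le> M / \<rho> ^ j" if "cmod z2 = \<rho>" for j z2
      unfolding A_def by (rule fps_expansion_cauchy_bound) (use holg \<rho> that M in auto)
    then have "cmod (E $ j $ k) \<le> M / \<rho> ^ j / \<rho> ^ k" for j k
      unfolding E_def fps_nth_Abs_fps by (intro fps_expansion_cauchy_bound holA \<rho>)
    then show "\<exists>M. \<forall>j k. cmod (E $ j $ k) \<le> M / \<rho> ^ j / \<rho> ^ k" by blast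
  qed
qed

lemma scl_abs_summable:
  assumes E: "\<And>\<rho>. 0 < \<rho> \<Longrightarrow> \<rho> < 1 \<Longrightarrow> \<exists>M. \<forall>j k. cmod (E $ j $ k) \<le> M / \<rho> ^ j / \<rho> ^ k"
    and r: "0 < r" "r < 1"
  shows "(\<lambda>i. cmod (cf2 (scl r E) i)) summable_on UNIV"
proof -
  \<comment> \<open>Since r is the square of \<open>\<rho>\<close>, half of the decay of r^(j+k)
    pays for the growth allowed to \<open>E\<close>, and the other half is a convergent geometric
    series.\<close>
  define \<rho> where "\<rho> = sqrt r"
  have \<rho>: "0 < \<rho>" "\<rho> < 1" "r = \<rho> * \<rho>" using r by (auto simp: \<rho>_def)
  obtain M where M: "\<And>j k. cmod (E $ j $ k) \<le> M / \<rho> ^ j / \<rho> ^ k"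
    using E[OF \<rho>(1,2)] by blast
  have "(\<lambda>i. M * (case i of (j,k) \<Rightarrow> \<rho> ^ j * \<rho> ^ k)) summable_on (UNIV :: (nat \<times> nat) set)"
    using \<rho> by (intro summable_on_cmult_right mon2_sums_weighted) auto
  then show ?thesis
  proof (rule summable_on_comparison_test)
    fix i :: "nat \<times> nat"
    obtain j k where i: "i = (j,k)" by (cases i)
    have "cmod (cf2 (scl r E) i) = r ^ (j + k) * cmod (E $ j $ k)"
      using r by (simp add: i norm_mult norm_power)
    also have "\<dots> \<le> r ^ (j + k) * (M / \<rho> ^ j / \<rho> ^ k)"
      using r by (intro mult_left_mono M) auto
    also have "\<dots> = M * (\<rho> ^ j * \<rho> ^ k)"
      using \<rho>(1) by (simp add: \<rho>(3) power_mult_distrib power_add)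
    finally show "cmod (cf2 (scl r E) i) \<le> M * (case i of (j,k) \<Rightarrow> \<rho> ^ j * \<rho> ^ k)" by (simp add: i)
  qed auto
qed

text \<open>Each coefficient is a finite sum of products of entries that depend polynomially on r,
  so the limit may be taken entry by entry.\<close>

lemma pfps_scl_refl_tendsto:
  "((\<lambda>r. cf2 (pfps m n (rc m n (\<lambda>j k. of_real r ^ (j + k) * c j k)) * (scl r E * H)) i)
     \<longlongrightarrow> cf2 (pfps m n (rc m n c) * (E * H)) i) (at_left 1)"
proof -
  obtain a b where i: "i = (a,b)" by (cases i)
  have one: "((\<lambda>r. complex_of_real r ^ j) \<longlongrightarrow> 1) (at_left 1)" for j
    by (rule tendsto_eq_intros refl)+ simp
  have EH: "((\<lambda>r. (scl r E * H) $ a $ b) \<longlongrightarrow> (E * H) $ a $ b) (at_left 1)" for a b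
    unfolding fps2_mult_nth scl_nth by (rule tendsto_eq_intros one refl)+ simp
  have R: "((\<lambda>r. rc m n (\<lambda>j k. of_real r ^ (j + k) * c j k) j k) \<longlongrightarrow> rc m n c j k) (at_left 1)" for j k
    unfolding rc_def by (rule tendsto_eq_intros one refl)+ simp
  show ?thesis
    unfolding i cf2_apply pfps_mult_nth
    by (intro tendsto_sum tendsto_mult R) (auto intro: EH)
qed

text \<open>For r < 1 the dilate of p divides f inside H^2, and multiplying the quotient by the
  reflection of the dilate restores the norm of f. As r tends to 1 only finite partial sums pass to
  the limit, as in Fatou's lemma, so equality degrades to an inequality.\<close>

lemma refl_quotient_contraction:
  assumes nz: "\<And>z1 z2. z1 \<in> disc \<Longrightarrow> z2 \<in> disc \<Longrightarrow> pv m n c z1 z2 \<noteq> 0"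
    and f: "f \<in> H2_2"
  defines "\<Theta> \<equiv> \<lambda>z1 z2. pv m n (rc m n c) z1 z2 / pv m n c z1 z2"
  shows "Mult2 \<Theta> f \<in> H2_2" "Re (inner2 (Mult2 \<Theta> f) (Mult2 \<Theta> f)) \<le> Re (inner2 f f)"
proof -
  obtain E where E: "pfps m n c * E = 1"
    and Eb: "\<And>\<rho>. 0 < \<rho> \<Longrightarrow> \<rho> < 1 \<Longrightarrow> \<exists>M. \<forall>j k. cmod (E $ j $ k) \<le> M / \<rho> ^ j / \<rho> ^ k"
    using pfps_inverse[OF nz] by blast
  define H where "H = fps2 (h2coef2 f)"
  have H: "l2 (cf2 H)" "fn2 (cf2 H) = f" "ip (cf2 H) (cf2 H) = inner2 f f"
    using f by (simp_all add: H_def l2_h2coef2 fn2_h2coef2 inner2_ip)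
  define cr where "cr r = (\<lambda>j k. of_real r ^ (j + k) * c j k)" for r :: real
  define G where "G r = pfps m n (rc m n (cr r)) * (scl r E * H)" for r
  have est: "(\<Sum>i\<in>nbox N. (cmod (cf2 (G r) i))\<^sup>2) \<le> Re (inner2 f f)"
    if r: "0 < r" "r < 1" for r N
  proof -
    have l: "l2 (cf2 (scl r E * H))"
      by (rule l2_mult_abs_summable[OF scl_abs_summable[OF Eb r] H(1)])
    define g where "g = fn2 (cf2 (scl r E * H))"
    have g: "g \<in> H2_2" unfolding g_def by (rule fn2_H2_2[OF l])
    \<comment> \<open>Only p and its inverse are dilated, not f: their product is still 1 and f is
      recovered exactly.\<close>
    have "pfps m n (cr r) * (scl r E * H) = scl r (pfps m n c * E) * H"
      by (simp only: scl_mult scl_pfps cr_def mult.assoc)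
    then have "pfps m n (cr r) * (scl r E * H) = H"
      by (simp only: E scl_1 mult_1)
    then have "pmul m n (cr r) g = f"
      unfolding g_def pmul_fn2[OF l] by (simp only: fps2_cf2 H)
    then have "inner2 (pmul m n (rc m n (cr r)) g) (pmul m n (rc m n (cr r)) g) = inner2 f f"
      using inner2_refl_refl[OF g g, of m n "cr r"] by simp
    moreover have "h2coef2 (pmul m n (rc m n (cr r)) g) = cf2 (G r)"
      using h2coef2_pmul_fps[OF g] by (simp add: g_def G_def h2coef2_fn2[OF l])
    moreover have "l2 (h2coef2 (pmul m n (rc m n (cr r)) g))"
      by (intro l2_h2coef2 pmul_H2_2 g)
    ultimately show ?thesis
      using ip_self_ge_sum[of "h2coef2 (pmul m n (rc m n (cr r)) g)" "nbox N"] by (simp add: inner2_ip)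
  qed
  define B where "B = pfps m n (rc m n c) * (E * H)"
  have est1: "(\<Sum>i\<in>nbox N. (cmod (cf2 B i))\<^sup>2) \<le> Re (inner2 f f)" for N
  proof (rule tendsto_upperbound)
    show "((\<lambda>r. \<Sum>i\<in>nbox N. (cmod (cf2 (G r) i))\<^sup>2)
        \<longlongrightarrow> (\<Sum>i\<in>nbox N. (cmod (cf2 B i))\<^sup>2)) (at_left 1)"
      unfolding B_def G_def cr_def by (intro tendsto_intros pfps_scl_refl_tendsto)
    have "eventually (\<lambda>r::real. r \<in> {0<..<1}) (at_left 1)"
      by (rule eventually_at_leftI[of 0]) auto
    then show "\<forall>\<^sub>F r in at_left 1. (\<Sum>i\<in>nbox N. (cmod (cf2 (G r) i))\<^sup>2)
        \<le> Re (inner2 f f)"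
      by eventually_elim (use est in auto)
  qed simp
  note B = l2_nboxI[OF est1]
  \<comment> \<open>Cancelling p against \<open>E\<close> formally identifies the limit: p times it
    is the reflection times f.\<close>
  have "pmul m n c (fn2 (cf2 B)) = pmul m n (rc m n c) f"
  proof -
    have "pfps m n c * B = pfps m n (rc m n c) * ((pfps m n c * E) * H)"
      by (simp add: B_def mult_ac)
    then have "pfps m n c * B = pfps m n (rc m n c) * H" by (simp add: E)
    then show ?thesis
      using pmul_fn2[OF B(1)] pmul_fn2[OF H(1)] by (simp add: H(2))
  qed
  then have pB: "pv m n c z1 z2 * fn2 (cf2 B) z1 z2 = pv m n (rc m n c) z1 z2 * f z1 z2" for z1 z2
    by (auto simp: pmul_def dest: fun_cong)
  have "Mult2 \<Theta> f = fn2 (cf2 B)"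
  proof (intro ext)
    fix z1 z2
    show "Mult2 \<Theta> f z1 z2 = fn2 (cf2 B) z1 z2"
    proof (cases "z1 \<in> disc \<and> z2 \<in> disc")
      case True
      with nz[of z1 z2] pB[of z1 z2] show ?thesis
        by (simp add: Mult2_def \<Theta>_def field_simps)
    qed (auto simp: Mult2_def fn2_def)
  qed
  then show "Mult2 \<Theta> f \<in> H2_2" "Re (inner2 (Mult2 \<Theta> f) (Mult2 \<Theta> f)) \<le> Re (inner2 f f)"
    using B by (simp_all add: fn2_H2_2 inner2_ip h2coef2_fn2)
qed

section \<open>Weak convergence of the shifts to zero\<close>

lemma ip_cauchy_schwarz:
  assumes "l2 a" "l2 b"
  shows "cmod (ip a b) \<le> sqrt (Re (ip a a)) * sqrt (Re (ip b b))"
proof -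
  have sm: "(\<lambda>i. cmod (a i * cnj (b i))) summable_on UNIV"
    by (rule l2_abs_summable_mult) (use assms in \<open>auto intro: l2_cnj\<close>)
  have "cmod (ip a b) \<le> (\<Sum>\<^sub>\<infinity>i. cmod (a i * cnj (b i)))"
    unfolding ip_def by (rule norm_infsum_bound[OF sm])
  also have "\<dots> \<le> sqrt (Re (ip a a)) * sqrt (Re (ip b b))"
  proof (rule infsum_le_finite_sums[OF sm])
    fix F :: "'a set" assume F: "finite F" "F \<subseteq> UNIV"
    have "(\<Sum>i\<in>F. cmod (a i * cnj (b i))) = (\<Sum>i\<in>F. \<bar>cmod (a i)\<bar> * \<bar>cmod (b i)\<bar>)"
      by (simp add: norm_mult)
    also have "\<dots> \<le> L2_set (\<lambda>i. cmod (a i)) F * L2_set (\<lambda>i. cmod (b i)) F"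
      by (rule L2_set_mult_ineq)
    also have "\<dots> \<le> sqrt (Re (ip a a)) * sqrt (Re (ip b b))"
      unfolding L2_set_def using ip_self_ge_sum[OF assms(1) F(1)] ip_self_ge_sum[OF assms(2) F(1)]
      by (intro mult_mono) (auto simp: sum_nonneg intro: order_trans[OF _ ip_self_ge_sum[OF assms(1), of "{}"], simplified])
    finally show "(\<Sum>i\<in>F. cmod (a i * cnj (b i))) \<le> sqrt (Re (ip a a)) * sqrt (Re (ip b b))" .
  qed
  finally show ?thesis .
qed

lemma l2_tail_tendsto_0:
  assumes "l2 (b :: nat \<times> nat \<Rightarrow> complex)"
  shows "(\<lambda>N. \<Sum>\<^sub>\<infinity>i\<in>{i. N \<le> fst i}. (cmod (b i))\<^sup>2) \<longlonglongrightarrow> 0"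
proof (rule LIMSEQ_I)
  fix e :: real assume e: "0 < e"
  define u where "u i = (cmod (b i))\<^sup>2" for i
  have u: "u summable_on A" for A
    using assms unfolding l2_def u_def by (rule summable_on_subset_banach) auto
  have u0: "u i \<ge> 0" for i by (simp add: u_def)
  obtain F where F: "finite F" "dist (sum u F) (infsum u UNIV) \<le> e / 2"
    using infsum_finite_approximation[OF u, of "e/2" UNIV] e by auto
  obtain N0 where N0: "F \<subseteq> nbox N0" using finite_subset_nbox[OF F(1)] ..
  show "\<exists>no. \<forall>n\<ge>no. norm ((\<Sum>\<^sub>\<infinity>i\<in>{i. n \<le> fst i}. (cmod (b i))\<^sup>2) - 0) < e"
  proof (intro exI allI impI)
    fix N assume N: "N \<ge> Suc N0"
    have disj: "F \<inter> {i. N \<le> fst i} = {}" using N0 N by (auto simp: nbox_def)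
    have "sum u F + infsum u {i. N \<le> fst i} = infsum u (F \<union> {i. N \<le> fst i})"
      using infsum_Un_disjoint[OF u u disj] F(1) by simp
    also have "\<dots> \<le> infsum u UNIV"
      by (rule infsum_mono2[OF u u]) (use u0 in auto)
    finally have "infsum u {i. N \<le> fst i} \<le> e / 2"
      using F(2) unfolding dist_real_def by linarith
    moreover have "infsum u {i. N \<le> fst i} \<ge> 0" by (rule infsum_nonneg) (use u0 in auto)
    ultimately show "norm ((\<Sum>\<^sub>\<infinity>i\<in>{i. N \<le> fst i}. (cmod (b i))\<^sup>2) - 0) < e"
      using e unfolding u_def by simp
  qed
qed

text \<open>The coefficients of z1^N f live on indices whose first entry is at least N, so
  Cauchy-Schwarz sees only a tail of g.\<close>

lemma inner2_mm_weakly_null: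
  assumes f: "f \<in> H2_2" and g: "g \<in> H2_2"
  shows "(\<lambda>N. inner2 (mm N 0 f) g) \<longlonglongrightarrow> 0"
proof (rule Lim_null_comparison)
  define D where "D = sqrt (Re (inner2 f f))"
  define b where "b = h2coef2 g"
  have b: "l2 b" unfolding b_def by (rule l2_h2coef2[OF g])
  show "(\<lambda>N. D * sqrt (\<Sum>\<^sub>\<infinity>i\<in>{i. N \<le> fst i}. (cmod (b i))\<^sup>2)) \<longlonglongrightarrow> 0"
    using tendsto_mult[OF tendsto_const tendsto_real_sqrt[OF l2_tail_tendsto_0[OF b]], of D] by simp
  have "cmod (inner2 (mm N 0 f) g) \<le> D * sqrt (\<Sum>\<^sub>\<infinity>i\<in>{i. N \<le> fst i}. (cmod (b i))\<^sup>2)" for N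
  proof -
    define bN where "bN = (\<lambda>i. if N \<le> fst i then b i else 0)"
    have "(\<lambda>i. (cmod (bN i))\<^sup>2) summable_on UNIV"
      using b unfolding l2_def by (rule summable_on_comparison_test) (auto simp: bN_def)
    then have bN: "l2 bN" by (simp add: l2_def)
    have "inner2 (mm N 0 f) g = ip (h2coef2 (mm N 0 f)) bN"
      unfolding inner2_ip ip_def bN_def b_def
      by (rule infsum_cong) (auto simp: h2coef2_mm[OF f])
    also have "cmod \<dots> \<le> sqrt (Re (ip (h2coef2 (mm N 0 f)) (h2coef2 (mm N 0 f)))) * sqrt (Re (ip bN bN))"
      by (intro ip_cauchy_schwarz bN l2_h2coef2 mm_H2_2 f)
    also have "Re (ip bN bN) = (\<Sum>\<^sub>\<infinity>i\<in>{i. N \<le> fst i}. (cmod (b i))\<^sup>2)"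
      unfolding ip_self[OF bN] Re_complex_of_real
      by (rule infsum_cong_neutral) (auto simp: bN_def)
    also have "ip (h2coef2 (mm N 0 f)) (h2coef2 (mm N 0 f)) = inner2 f f"
      using inner2_mm[OF f f] by (simp add: inner2_ip)
    finally show ?thesis by (simp add: D_def)
  qed
  then show "\<forall>\<^sub>F N in sequentially. norm (inner2 (mm N 0 f) g)
      \<le> D * sqrt (\<Sum>\<^sub>\<infinity>i\<in>{i. N \<le> fst i}. (cmod (b i))\<^sup>2)" by simp
qed

section \<open>Bezout identity for coprime bivariate polynomials\<close>

lemma fract_poly_clear_denominators:
  fixes u :: "complex poly fract poly"
  obtains t a where "t \<noteq> 0" "smult (to_fract t) u = fract_poly a"
proof -
  obtain x y where xy: "fract_content u = Fract x y" "y \<noteq> 0"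
    by (cases "fract_content u") auto
  have "to_fract y * fract_content u = to_fract x"
    using xy by (simp add: to_fract_def eq_fract)
  then have "smult (to_fract y) u = fract_poly (smult x (primitive_part_fract u))"
    by (subst content_times_primitive_part_fract[symmetric, of u])
       (simp only: smult_smult fract_poly_smult)
  with xy(2) show thesis by (rule that[of y])
qed

text \<open>Over the fraction field of C[z1] the polynomials in z2 form a principal ideal ring, so a
  gcd of p and q is a combination of them. By Gauss's lemma this gcd is constant in z2, and clearing
  denominators leaves a polynomial in z1 alone.\<close>

lemma coprime_bivariate_bezout:
  fixes p q :: "complex poly poly"
  assumes "coprime p q" "p \<noteq> 0"
  obtains a b r where "r \<noteq> 0" "a * p + b * q = [:r:]"
proof -
  define P Q where "P = fract_poly p" and "Q = fract_poly q"
  define I where "I = {u * P + v * Q | u v. True}"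
  have lin: "x - y * d \<in> I" if xd: "x \<in> I" "d \<in> I" for x y d
  proof -
    obtain u v u' v' where "x = u * P + v * Q" "d = u' * P + v' * Q"
      using xd unfolding I_def by blast
    then have "x - y * d = (u - y * u') * P + (v - y * v') * Q"
      by (simp add: algebra_simps)
    then show ?thesis unfolding I_def by blast
  qed
  have PI: "P \<in> I" "Q \<in> I"
  proof -
    have "P = 1 * P + 0 * Q" "Q = 0 * P + 1 * Q" by auto
    then show "P \<in> I" "Q \<in> I" unfolding I_def by blast+
  qed
  have "P \<noteq> 0" using assms(2) by (simp add: P_def)
  \<comment> \<open>An element of least degree divides the whole ideal by division with remainder,
    hence is a gcd.\<close>
  then obtain d where d: "d \<in> I" "d \<noteq> 0" "\<And>x. x \<in> I \<Longrightarrow> x \<noteq> 0 \<Longrightarrow> degree d \<le> degree x"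
    using ex_has_least_nat[of "\<lambda>x. x \<in> I \<and> x \<noteq> 0" P degree] PI by blast
  have dvdI: "d dvd x" if x: "x \<in> I" for x
  proof -
    have "x mod d = x - (x div d) * d" by (simp add: minus_div_mult_eq_mod)
    then have "x mod d \<in> I" using lin[OF x d(1)] by metis
    moreover have "x mod d = 0 \<or> degree (x mod d) < degree d" using d(2) by (rule degree_mod_less)
    ultimately show ?thesis using d(3)[of "x mod d"] by (metis dvd_eq_mod_eq_0 not_less)
  qed
  define d' where "d' = primitive_part_fract d"
  have dd': "smult (fract_content d) (fract_poly d') = d" unfolding d'_def by (rule content_times_primitive_part_fract)
  have fc: "fract_content d \<noteq> 0" using d(2) by simp
  \<comment> \<open>A primitive polynomial that divides over the fraction field already divides over
    C[z1], so coprimality applies to \<open>d'\<close>.\<close>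
  have "content d' = 1" unfolding d'_def using d(2) by simp
  moreover have "fract_poly d' dvd P" "fract_poly d' dvd Q"
    using dvdI[OF PI(1)] dvdI[OF PI(2)] dd' fc by (metis smult_dvd_iff)+
  ultimately have "d' dvd p" "d' dvd q"
    unfolding P_def Q_def by (auto intro: fract_poly_dvdD)
  with assms(1) have "is_unit d'" by (metis coprime_common_divisor)
  then have "degree d' = 0"
    by (metis is_unit_poly_iff degree_pCons_0)
  then have "degree d = 0" by (subst dd'[symmetric]) (simp add: degree_map_poly)
  then obtain \<delta> where \<delta>: "d = [:\<delta>:]" by (metis degree_eq_zeroE)
  then have \<delta>0: "\<delta> \<noteq> 0" using d(2) by auto
  obtain x y where xy: "\<delta> = Fract x y" "y \<noteq> 0" by (cases \<delta>) auto
  have x0: "x \<noteq> 0" using \<delta>0 xy by (auto simp: fract_collapse)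
  have yd: "to_fract y * \<delta> = to_fract x" using xy by (simp add: to_fract_def eq_fract)
  obtain u v where uv: "d = u * P + v * Q" using d(1) unfolding I_def by blast
  obtain s a where s: "s \<noteq> 0" "smult (to_fract s) u = fract_poly a"
    by (rule fract_poly_clear_denominators)
  obtain t b where t: "t \<noteq> 0" "smult (to_fract t) v = fract_poly b"
    by (rule fract_poly_clear_denominators)
  have "smult (to_fract (s * t * y)) d = [:to_fract (s * t * x):]"
    unfolding \<delta> using yd by (simp add: mult_ac)
  then have "fract_poly [:s * t * x:] = smult (to_fract (s * t * y)) (u * P + v * Q)"
    using uv by (simp add: map_poly_pCons)
  also have "\<dots> = smult (to_fract (t * y)) (smult (to_fract s) u) * P
      + smult (to_fract (s * y)) (smult (to_fract t) v) * Q"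
    by (simp add: smult_add_right mult_ac)
  also have "\<dots> = fract_poly (smult (t * y) a * p + smult (s * y) b * q)"
    by (simp only: s(2) t(2) P_def Q_def fract_poly_add fract_poly_mult fract_poly_smult)
  finally have "smult (t * y) a * p + smult (s * y) b * q = [:s * t * x:]"
    by (metis fract_poly_eq_iff)
  moreover have "s * t * x \<noteq> 0" using s t x0 by simp
  ultimately show thesis by (rule that[rotated])
qed

section \<open>Isometry of the rational inner multiplier\<close>

lemma eval2_pCons: "eval2 (pCons a p) z1 z2 = poly a z1 + z2 * eval2 p z1 z2"
  unfolding eval2_def by (simp add: map_poly_pCons)

lemma eval2_0: "eval2 0 z1 z2 = 0"
  by (simp add: eval2_def)

lemma eval2_add: "eval2 (p + q) z1 z2 = eval2 p z1 z2 + eval2 q z1 z2"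
  by (induction p q rule: poly_induct2) (auto simp: eval2_pCons eval2_0 algebra_simps)

lemma eval2_smult: "eval2 (smult a p) z1 z2 = poly a z1 * eval2 p z1 z2"
  by (induction p) (auto simp: eval2_pCons eval2_0 algebra_simps)

lemma eval2_mult: "eval2 (p * q) z1 z2 = eval2 p z1 z2 * eval2 q z1 z2"
  by (induction p) (auto simp: eval2_pCons eval2_0 eval2_add eval2_smult algebra_simps)

definition rmul :: "complex poly \<Rightarrow> bifun \<Rightarrow> bifun" where
  "rmul r f = (\<lambda>z1 z2. poly r z1 * f z1 z2)"

lemma rmul_H2_2: "f \<in> H2_2 \<Longrightarrow> rmul r f \<in> H2_2"
proof (induction r)
  case 0
  then show ?case by (simp add: rmul_def H2_2_zero)
next
  case (pCons a r)
  have "rmul (pCons a r) f = (\<lambda>z1 z2. a * f z1 z2 + Mz1 (rmul r f) z1 z2)"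
    by (auto simp: rmul_def Mz1_def algebra_simps)
  with pCons show ?case by (auto intro: H2_2_add H2_2_scale H2_2_Mz1)
qed

lemma eval2_mult_H2_2: "f \<in> H2_2 \<Longrightarrow> (\<lambda>z1 z2. eval2 p z1 z2 * f z1 z2) \<in> H2_2"
proof (induction p)
  case 0
  then show ?case by (simp add: eval2_0 H2_2_zero)
next
  case (pCons a p)
  have "(\<lambda>z1 z2. eval2 (pCons a p) z1 z2 * f z1 z2)
      = (\<lambda>z1 z2. rmul a f z1 z2 + Mz2 (\<lambda>z1 z2. eval2 p z1 z2 * f z1 z2) z1 z2)"
    by (auto simp: rmul_def Mz2_def eval2_pCons algebra_simps)
  with pCons show ?case by (auto intro: H2_2_add rmul_H2_2 H2_2_Mz2)
qed

section \<open>The defect form of a contractive multiplier\<close>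

locale multiplier =
  fixes \<Theta> :: "bifun"
  assumes mult_H2: "\<And>f. f \<in> H2_2 \<Longrightarrow> Mult2 \<Theta> f \<in> H2_2"
    and contractive: "\<And>f. f \<in> H2_2 \<Longrightarrow> Re (inner2 (Mult2 \<Theta> f) (Mult2 \<Theta> f)) \<le> Re (inner2 f f)"
begin

text \<open>The sesquilinear form of the identity minus T'T, where T is multiplication by
  \<open>\<Theta>\<close> and T' its adjoint. It is positive semidefinite because T is a
  contraction, and it vanishes exactly when T is isometric.\<close>

definition defect :: "bifun \<Rightarrow> bifun \<Rightarrow> complex" where
  "defect f g = inner2 f g - inner2 (Mult2 \<Theta> f) (Mult2 \<Theta> g)"

lemma Mult2_add: "Mult2 \<Theta> (\<lambda>z1 z2. f z1 z2 + g z1 z2) = (\<lambda>z1 z2. Mult2 \<Theta> f z1 z2 + Mult2 \<Theta> g z1 z2)"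
  and Mult2_scale: "Mult2 \<Theta> (\<lambda>z1 z2. a * f z1 z2) = (\<lambda>z1 z2. a * Mult2 \<Theta> f z1 z2)"
  and Mult2_mm: "Mult2 \<Theta> (mm j k f) = mm j k (Mult2 \<Theta> f)"
  and Mult2_pmul: "Mult2 \<Theta> (pmul m n c f) = pmul m n c (Mult2 \<Theta> f)"
  by (intro ext, simp add: Mult2_def algebra_simps mm_def pmul_def)+

lemma defect_add_left:
  "f \<in> H2_2 \<Longrightarrow> g \<in> H2_2 \<Longrightarrow> h \<in> H2_2 \<Longrightarrow> defect (\<lambda>z1 z2. f z1 z2 + g z1 z2) h = defect f h + defect g h"
  by (simp add: defect_def Mult2_add inner2_add_left mult_H2)

lemma defect_scale_left: "f \<in> H2_2 \<Longrightarrow> defect (\<lambda>z1 z2. a * f z1 z2) h = a * defect f h"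
  by (simp add: defect_def Mult2_scale inner2_scale_left mult_H2 right_diff_distrib)

lemma defect_commute: "defect g f = cnj (defect f g)"
  by (simp add: defect_def inner2_commute[of f g] inner2_commute[of "Mult2 \<Theta> f"])

lemma defect_mm: "f \<in> H2_2 \<Longrightarrow> g \<in> H2_2 \<Longrightarrow> defect (mm j k f) (mm j k g) = defect f g"
  by (simp add: defect_def Mult2_mm inner2_mm mult_H2)

lemma defect_nonneg: "f \<in> H2_2 \<Longrightarrow> 0 \<le> Re (defect f f)"
  using contractive by (simp add: defect_def)

text \<open>The degenerate case of Cauchy-Schwarz for a positive semidefinite form: since u is null,
  moving h along u changes the value of the form linearly, which positivity forbids unless the slope
  is 0.\<close>

lemma defect_self_eq_0:
  assumes "u \<in> H2_2" "h \<in> H2_2" "defect u u = 0"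
  shows "defect u h = 0"
proof (rule ccontr)
  assume nz: "defect u h \<noteq> 0"
  define b where "b = (cmod (defect u h))\<^sup>2"
  have b: "b > 0" using nz by (simp add: b_def)
  have est: "0 \<le> Re (defect h h) - 2 * s * b" for s :: real
  proof -
    define t where "t = - of_real s * cnj (defect u h)"
    define v where "v = (\<lambda>z1 z2. h z1 z2 + t * u z1 z2)"
    have v: "v \<in> H2_2" unfolding v_def by (intro H2_2_add H2_2_scale assms)
    have hv: "defect x v = defect x h + cnj t * defect x u" if "x \<in> H2_2" for x
    proof -
      have "defect v x = defect h x + t * defect u x"
        unfolding v_def using that assms by (simp add: defect_add_left defect_scale_left H2_2_scale)
      then show ?thesis
        using arg_cong[of _ _ cnj] by (simp add: defect_commute[of x] flip: complex_cnj_add complex_cnj_mult)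
    qed
    have "defect v v = defect h v + t * defect u v"
      unfolding v_def[abs_def] using v assms by (simp add: defect_add_left defect_scale_left H2_2_scale v_def)
    also have "\<dots> = defect h h + cnj t * defect h u + t * defect u h"
      using assms by (simp add: hv)
    also have "cnj t * defect h u = cnj (t * defect u h)"
      by (simp add: defect_commute[of h u])
    also have "t * defect u h = - of_real s * (defect u h * cnj (defect u h))"
      unfolding t_def by (simp add: mult_ac)
    also have "defect u h * cnj (defect u h) = of_real b"
      unfolding b_def by (simp only: complex_norm_square)
    finally show ?thesis using defect_nonneg[OF v] by (simp add: mult_ac)
  qed
  show False
    \<comment> \<open>This choice of s makes the lower bound demanded by positivity equal to
      -1.\<close>
    using est[of "(Re (defect h h) + 1) / (2 * b)"] b by (simp add: field_simps)
qed

lemma defect_weakly_null: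
  "f \<in> H2_2 \<Longrightarrow> g \<in> H2_2 \<Longrightarrow> (\<lambda>N. defect (mm N 0 f) g) \<longlonglongrightarrow> 0"
  unfolding defect_def Mult2_mm
  using tendsto_diff[OF inner2_mm_weakly_null[of f g] inner2_mm_weakly_null[of "Mult2 \<Theta> f" "Mult2 \<Theta> g"]]
  by (simp add: mult_H2)

text \<open>A linear factor \<open>z\<^sub>1 - a\<close> in the null space of the defect can be cancelled: otherwise
  \<open>defect (z\<^sub>1\<^sup>N f) g = a\<^sup>N defect f g\<close> would contradict weak convergence to \<open>0\<close>, on the left or,
  when \<open>\<bar>a\<bar> < 1\<close>, on the right argument.\<close>
lemma defect_eq_0_of_rmul:
  assumes "r \<noteq> 0" "\<And>f h. f \<in> H2_2 \<Longrightarrow> h \<in> H2_2 \<Longrightarrow> defect (rmul r f) h = 0"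
    and "f \<in> H2_2" "h \<in> H2_2"
  shows "defect f h = 0"
  using assms
proof (induction "degree r" arbitrary: r f h)
  case 0
  then obtain a where a: "r = [:a:]" by (metis degree_eq_zeroE)
  with 0 have "a \<noteq> 0" "defect (\<lambda>z1 z2. a * f z1 z2) h = 0" by (auto simp: rmul_def)
  then show ?case using 0 by (simp add: defect_scale_left)
next
  case (Suc d)
  then obtain a where "poly r a = 0"
    using alg_closed_imp_poly_has_root[of r] by auto
  then obtain s where s: "r = [:-a, 1:] * s" using poly_eq_0_iff_dvd by blast
  have s0: "s \<noteq> 0" using Suc.prems s by auto
  then have "degree r = Suc (degree s)" unfolding s by (subst degree_mult_eq) auto
  then have ds: "d = degree s" using Suc.hyps by simp
  have "defect (rmul s f) h = 0" if fh: "f \<in> H2_2" "h \<in> H2_2" for f h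
  proof -
    \<comment> \<open>Modulo (z1 - a) s f, which is null for the form, z1 acts on s f as the scalar
      a.\<close>
    have step: "defect (mm (Suc N) 0 (rmul s f)) h = a * defect (mm N 0 (rmul s f)) h"
      if h: "h \<in> H2_2" for N h
    proof -
      define F where "F = mm N 0 f"
      have F: "F \<in> H2_2" using fh by (simp add: F_def)
      have "mm (Suc N) 0 (rmul s f) = (\<lambda>z1 z2. rmul r F z1 z2 + a * mm N 0 (rmul s f) z1 z2)"
        by (auto simp: s F_def mm_def rmul_def algebra_simps)
      then show ?thesis
        using Suc.prems(2)[OF F h] F h fh
        by (simp add: defect_add_left defect_scale_left rmul_H2_2 H2_2_scale)
    qed
    have pow: "defect (mm N 0 (rmul s f)) h = a ^ N * defect (rmul s f) h" if "h \<in> H2_2" for N h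
      by (induction N) (use step that in \<open>auto simp: mm_simps(3)\<close>)
    have F: "rmul s f \<in> H2_2" using fh by (simp add: rmul_H2_2)
    have "(\<lambda>N. norm (defect (mm N 0 (rmul s f)) h)) \<longlonglongrightarrow> 0"
      using defect_weakly_null[OF F fh(2)] by (simp add: tendsto_norm_zero)
    moreover have "(\<lambda>N. norm (defect (mm N 0 h) (rmul s f))) \<longlonglongrightarrow> 0"
      using defect_weakly_null[OF fh(2) F] by (simp add: tendsto_norm_zero)
    \<comment> \<open>Which of the two terms dominates the fixed number depends on the modulus of a;
      their sum lets a single limit serve both cases.\<close>
    ultimately have lim: "(\<lambda>N. norm (defect (mm N 0 (rmul s f)) h) + norm (defect (mm N 0 h) (rmul s f))) \<longlonglongrightarrow> 0"
      using tendsto_add by fastforce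
    have "norm (defect (rmul s f) h) \<le> norm (defect (mm N 0 (rmul s f)) h) + norm (defect (mm N 0 h) (rmul s f))" for N
    proof (cases "cmod a \<ge> 1")
      case True
      then have "norm (defect (rmul s f) h) \<le> cmod a ^ N * norm (defect (rmul s f) h)"
        by (simp add: mult_le_cancel_right1 one_le_power)
      then have "norm (defect (rmul s f) h) \<le> norm (defect (mm N 0 (rmul s f)) h)"
        by (simp add: pow[OF fh(2)] norm_mult norm_power)
      then show ?thesis by (simp add: add_increasing2)
    next
      case False
      have "defect (rmul s f) h = defect (mm N 0 (rmul s f)) (mm N 0 h)"
        using F fh by (simp add: defect_mm)
      also have "\<dots> = a ^ N * defect (rmul s f) (mm N 0 h)"
        using fh by (simp add: pow)
      finally have "norm (defect (rmul s f) h) = cmod a ^ N * norm (defect (rmul s f) (mm N 0 h))"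
        by (simp add: norm_mult norm_power)
      also have "\<dots> \<le> 1 * norm (defect (rmul s f) (mm N 0 h))"
        using False by (intro mult_right_mono power_le_one) auto
      also have "norm (defect (rmul s f) (mm N 0 h)) = norm (defect (mm N 0 h) (rmul s f))"
        by (metis complex_mod_cnj defect_commute)
      finally show ?thesis by (simp add: add_increasing)
    qed
    then have "norm (defect (rmul s f) h) \<le> 0"
      by (intro tendsto_lowerbound[OF lim]) auto
    then show ?thesis by simp
  qed
  then show ?case
    using Suc.hyps(1)[OF ds s0] Suc.prems by blast
qed

end

lemma refl_quotient_isometry:
  assumes nz: "\<And>z1 z2. z1 \<in> disc \<Longrightarrow> z2 \<in> disc \<Longrightarrow> pv m n c z1 z2 \<noteq> 0"
    and p: "\<And>z1 z2. eval2 p z1 z2 = pv m n c z1 z2"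
    and q: "\<And>z1 z2. eval2 q z1 z2 = pv m n (rc m n c) z1 z2"
    and bezout: "a * p + b * q = [:r:]" "r \<noteq> 0"
    and fg: "f \<in> H2_2" "g \<in> H2_2"
  defines "\<Theta> \<equiv> \<lambda>z1 z2. pv m n (rc m n c) z1 z2 / pv m n c z1 z2"
  shows "inner2 (Mult2 \<Theta> f) (Mult2 \<Theta> g) = inner2 f g"
proof -
  interpret multiplier \<Theta>
    by unfold_locales (use refl_quotient_contraction[OF nz] in \<open>auto simp: \<Theta>_def\<close>)
  have Mp: "Mult2 \<Theta> (pmul m n c f) = pmul m n (rc m n c) f" if "f \<in> H2_2" for f
  proof (intro ext)
    fix z1 z2
    show "Mult2 \<Theta> (pmul m n c f) z1 z2 = pmul m n (rc m n c) f z1 z2"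
      using nz[of z1 z2] H2_2_outside[OF that, of z1 z2]
      by (cases "z1 \<in> disc \<and> z2 \<in> disc") (auto simp: Mult2_def \<Theta>_def pmul_def)
  qed
  \<comment> \<open>\<open>\<Theta>\<close> p f is the reflection times f and has the inner products
    of p f, so p f is a null vector; \<open>defect_self_eq_0\<close> then covers every h.\<close>
  have 1: "defect (pmul m n c f) h = 0" if "f \<in> H2_2" "h \<in> H2_2" for f h
    by (rule defect_self_eq_0) (use that in \<open>auto simp: defect_def Mp inner2_refl_refl\<close>)
  \<comment> \<open>In both terms of the defect the reflection on the right becomes p on the left,
    which reduces this to the previous fact.\<close>
  have 2: "defect f (pmul m n (rc m n c) h) = 0" if fh: "f \<in> H2_2" "h \<in> H2_2" for f h
  proof -
    have "defect f (pmul m n (rc m n c) h) = defect (pmul m n c f) (mm m n h)"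
      using fh by (simp add: defect_def Mult2_pmul inner2_refl mult_H2 Mult2_mm)
    with 1 fh show ?thesis by simp
  qed
  have 3: "defect (rmul r f) h = 0" if fh: "f \<in> H2_2" "h \<in> H2_2" for f h
  proof -
    define u v where "u = (\<lambda>z1 z2. eval2 a z1 z2 * f z1 z2)" and "v = (\<lambda>z1 z2. eval2 b z1 z2 * f z1 z2)"
    have uv: "u \<in> H2_2" "v \<in> H2_2" unfolding u_def v_def using fh by (simp_all add: eval2_mult_H2_2)
    have r: "poly r z1 = eval2 a z1 z2 * eval2 p z1 z2 + eval2 b z1 z2 * eval2 q z1 z2" for z1 z2
      unfolding eval2_mult[symmetric] eval2_add[symmetric] bezout by (simp add: eval2_pCons eval2_0)
    have "rmul r f = (\<lambda>z1 z2. pmul m n c u z1 z2 + pmul m n (rc m n c) v z1 z2)"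
    proof (intro ext)
      fix z1 z2
      show "rmul r f z1 z2 = pmul m n c u z1 z2 + pmul m n (rc m n c) v z1 z2"
        using r[of z1 z2] unfolding rmul_def by (simp add: pmul_def u_def v_def p q algebra_simps)
    qed
    then show ?thesis
      using 1[OF uv(1) fh(2)] 2[OF fh(2) uv(2)] uv fh
      by (simp add: defect_add_left defect_commute[of "pmul m n (rc m n c) v"])
  qed
  have "defect f g = 0"
    by (rule defect_eq_0_of_rmul[OF bezout(2) 3 fg])
  then show ?thesis by (simp add: defect_def)
qed

section \<open>Wandering subspaces and Agler kernels\<close>

text \<open>Gaussian elimination, one equation and one unknown at a time. The dimension counts in
  \<open>onb_le\<close> and \<open>kernel_basis\<close> rest on it.\<close>

lemma homogeneous_system:
  fixes A :: "'i \<Rightarrow> 'j \<Rightarrow> complex"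
  assumes "finite J" "finite I" "card J < card I"
  shows "\<exists>x. (\<exists>i\<in>I. x i \<noteq> 0) \<and> (\<forall>j\<in>J. (\<Sum>i\<in>I. x i * A i j) = 0)"
  using assms
proof (induction J arbitrary: I A rule: finite_induct)
  case empty
  then obtain i where "i \<in> I" by fastforce
  then show ?case by (intro exI[of _ "\<lambda>_. 1"]) auto
next
  case (insert j0 J)
  show ?case
  proof (cases "\<forall>i\<in>I. A i j0 = 0")
    case True
    have "card J < card I" using insert by simp
    then obtain x where "\<exists>i\<in>I. x i \<noteq> 0" "\<forall>j\<in>J. (\<Sum>i\<in>I. x i * A i j) = 0"
      using insert.IH[of I A] insert.prems by auto
    then show ?thesis using True by (intro exI[of _ x]) auto
  next
    case False
    then obtain i0 where i0: "i0 \<in> I" "A i0 j0 \<noteq> 0" by blast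
    \<comment> \<open>The system that remains after equation \<open>j0\<close> is solved for the
      unknown \<open>i0\<close> and substituted into the others.\<close>
    define B where "B i j = A i j - A i j0 / A i0 j0 * A i0 j" for i j
    have "card J < card (I - {i0})" using insert i0 by simp
    then obtain y where y: "\<exists>i\<in>I - {i0}. y i \<noteq> 0" "\<And>j. j \<in> J \<Longrightarrow> (\<Sum>i\<in>I - {i0}. y i * B i j) = 0"
      using insert.IH[of "I - {i0}" B] insert.prems by auto
    define x where "x = y(i0 := - (\<Sum>i\<in>I - {i0}. y i * A i j0) / A i0 j0)"
    have x: "(\<Sum>i\<in>I. x i * A i j) = (\<Sum>i\<in>I - {i0}. y i * B i j)" for j
    proof -
      have "(\<Sum>i\<in>I. x i * A i j) = x i0 * A i0 j + (\<Sum>i\<in>I - {i0}. x i * A i j)"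
        using i0 insert.prems by (simp add: sum.remove)
      also have "(\<Sum>i\<in>I - {i0}. x i * A i j) = (\<Sum>i\<in>I - {i0}. y i * A i j)"
        by (rule sum.cong) (auto simp: x_def)
      also have "x i0 * A i0 j = (\<Sum>i\<in>I - {i0}. - (y i * (A i j0 / A i0 j0 * A i0 j)))"
        by (simp add: x_def sum_negf sum_distrib_right sum_distrib_left sum_divide_distrib mult_ac)
      finally show ?thesis
        by (simp add: B_def right_diff_distrib sum.distrib[symmetric] algebra_simps)
    qed
    have "B i j0 = 0" for i using i0 by (simp add: B_def)
    then have "(\<Sum>i\<in>I. x i * A i j) = 0" if "j \<in> insert j0 J" for j
      using that y(2) by (auto simp: x)
    moreover have "\<exists>i\<in>I. x i \<noteq> 0" using y(1) by (auto simp: x_def)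
    ultimately show ?thesis by blast
  qed
qed

definition rif :: "nat \<Rightarrow> nat \<Rightarrow> (nat \<Rightarrow> nat \<Rightarrow> complex) \<Rightarrow> bifun" where
  "rif m n c = (\<lambda>z1 z2. pv m n (rc m n c) z1 z2 / pv m n c z1 z2)"

text \<open>The monomial with exponent pair \<open>i\<close>, cut off to the bidisk; testing against
  it reads off a single coefficient.\<close>

definition monf :: "nat \<times> nat \<Rightarrow> bifun" where
  "monf i = fn2 (\<lambda>x. if x = i then 1 else 0)"

lemma l2_indicator: "l2 (\<lambda>x. if x = i then 1 else 0)"
  unfolding l2_def by (rule finite_nonzero_values_imp_summable_on) (rule finite_subset[of _ "{i}"], auto)

lemma monf_H2_2 [simp]: "monf i \<in> H2_2"
  unfolding monf_def by (rule fn2_H2_2[OF l2_indicator])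

lemma inner2_mm_monf:
  assumes f: "f \<in> H2_2"
  shows "inner2 f (mm j k (monf (a, b))) = h2coef2 f (a + j, b + k)"
proof -
  have "h2coef2 (mm j k (monf (a, b))) = (\<lambda>x. if x = (a + j, b + k) then 1 else 0)"
  proof
    fix x :: "nat \<times> nat"
    show "h2coef2 (mm j k (monf (a, b))) x = (if x = (a + j, b + k) then 1 else 0)"
      by (cases x) (auto simp: h2coef2_mm monf_H2_2, auto simp: monf_def h2coef2_fn2[OF l2_indicator])
  qed
  then have "inner2 f (mm j k (monf (a, b))) = (\<Sum>\<^sub>\<infinity>x. h2coef2 f x * cnj (if x = (a + j, b + k) then 1 else 0))"
    by (simp add: inner2_ip ip_def)
  also have "\<dots> = (\<Sum>\<^sub>\<infinity>x\<in>{(a + j, b + k)}. h2coef2 f x)"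
    by (rule infsum_cong_neutral) auto
  finally show ?thesis by simp
qed

lemma inner2_lincomb_left:
  "f \<in> H2_2 \<Longrightarrow> g \<in> H2_2 \<Longrightarrow> h \<in> H2_2 \<Longrightarrow>
    inner2 (\<lambda>z1 z2. f z1 z2 + a * g z1 z2) h = inner2 f h + a * inner2 g h"
  by (simp add: inner2_add_left inner2_scale_left H2_2_scale)

lemma inner2_lincomb_right:
  "f \<in> H2_2 \<Longrightarrow> g \<in> H2_2 \<Longrightarrow> h \<in> H2_2 \<Longrightarrow>
    inner2 h (\<lambda>z1 z2. f z1 z2 + a * g z1 z2) = inner2 h f + cnj a * inner2 h g"
  by (simp add: inner2_add_right inner2_scale_right H2_2_scale)

lemma h2coef2_eq_0_imp:
  assumes "f \<in> H2_2" "\<And>a b. h2coef2 f (a,b) = 0"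
  shows "f = (\<lambda>_ _. 0)"
proof -
  have "h2coef2 f = (\<lambda>_. 0)" using assms(2) by auto
  then have "inner2 f f = 0" by (simp add: inner2_ip ip_def)
  then show ?thesis using assms(1) inner2_self_eq_0 by blast
qed

lemma H2_2_polynomial:
  assumes f: "f \<in> H2_2" and z: "z1 \<in> disc" "z2 \<in> disc"
    and 0: "\<And>a b. \<not> (a < m \<and> b \<le> n) \<Longrightarrow> h2coef2 f (a,b) = 0"
  shows "f z1 z2 = (\<Sum>j<m. \<Sum>k\<le>n. h2coef2 f (j,k) * (z1 ^ j * z2 ^ k))"
proof -
  have "((\<lambda>i. h2coef2 f i * mon2 z1 z2 i) has_sum f z1 z2) UNIV"
    using H2_2_h2coef2[OF f] z unfolding H2_2_coeffs_alt by blast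
  then have "((\<lambda>i. h2coef2 f i * mon2 z1 z2 i) has_sum f z1 z2) ({..<m} \<times> {..n})"
    by (rule has_sum_cong_neutral[THEN iffD1, rotated -1]) (use 0 in auto)
  then have "f z1 z2 = (\<Sum>i\<in>{..<m} \<times> {..n}. h2coef2 f i * mon2 z1 z2 i)"
    by (simp add: has_sum_finite_iff)
  then show ?thesis
    by (simp add: sum.cartesian_product mon2_def case_prod_unfold)
qed

text \<open>Formulated for a coefficient array, with the isometry among the assumptions, so that
  exchanging the variables yields another interpretation of the same locale
  (\<open>agler_swap\<close>).\<close>

locale agler =
  fixes m n :: nat and c :: "nat \<Rightarrow> nat \<Rightarrow> complex"
    and S1 S2 :: "bifun set"
  assumes nz: "\<And>z1 z2. z1 \<in> disc \<Longrightarrow> z2 \<in> disc \<Longrightarrow> pv m n c z1 z2 \<noteq> 0"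
    and isom: "\<And>f g. f \<in> H2_2 \<Longrightarrow> g \<in> H2_2 \<Longrightarrow>
      inner2 (Mult2 (rif m n c) f) (Mult2 (rif m n c) g) = inner2 f g"
    and S1: "S1 \<subseteq> H2_2" "(\<lambda>_ _. 0) \<in> S1" "\<And>f. f \<in> S1 \<Longrightarrow> Mz1 f \<in> S1"
      "\<And>f g. f \<in> S1 \<Longrightarrow> g \<in> S1 \<Longrightarrow> (\<lambda>z1 z2. f z1 z2 + g z1 z2) \<in> S1"
      "\<And>f a. f \<in> S1 \<Longrightarrow> (\<lambda>z1 z2. a * f z1 z2) \<in> S1"
    and S2: "S2 \<subseteq> H2_2" "(\<lambda>_ _. 0) \<in> S2" "\<And>f. f \<in> S2 \<Longrightarrow> Mz2 f \<in> S2"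
      "\<And>f g. f \<in> S2 \<Longrightarrow> g \<in> S2 \<Longrightarrow> (\<lambda>z1 z2. f z1 z2 + g z1 z2) \<in> S2"
      "\<And>f a. f \<in> S2 \<Longrightarrow> (\<lambda>z1 z2. a * f z1 z2) \<in> S2"
    and orth: "\<And>f g. f \<in> S1 \<Longrightarrow> g \<in> S2 \<Longrightarrow> inner2 f g = 0"
    and decomp: "model2 (rif m n c) = {(\<lambda>z1 z2. f z1 z2 + g z1 z2) | f g. f \<in> S1 \<and> g \<in> S2}"
begin

abbreviation "\<Theta> \<equiv> rif m n c"
abbreviation "W1 \<equiv> wander Mz1 S1"
abbreviation "W2 \<equiv> wander Mz2 S2"
abbreviation "pm \<equiv> pmul m n c"

lemma Mult2_H2: "f \<in> H2_2 \<Longrightarrow> Mult2 \<Theta> f \<in> H2_2"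
  using refl_quotient_contraction(1)[OF nz] by (simp add: rif_def)

lemma S_H2: "f \<in> S1 \<Longrightarrow> f \<in> H2_2" "f \<in> S2 \<Longrightarrow> f \<in> H2_2"
  using S1 S2 by auto

lemma S_model: "f \<in> S1 \<Longrightarrow> f \<in> model2 \<Theta>" "f \<in> S2 \<Longrightarrow> f \<in> model2 \<Theta>"
proof -
  show "f \<in> model2 \<Theta>" if "f \<in> S1"
    unfolding decomp using that S2(2) by (intro CollectI exI[of _ f] exI[of _ "\<lambda>_ _. 0"]) auto
  show "f \<in> model2 \<Theta>" if "f \<in> S2"
    unfolding decomp using that S1(2) by (intro CollectI exI[of _ "\<lambda>_ _. 0"] exI[of _ f]) auto
qed

lemma Mult2_pm: "f \<in> H2_2 \<Longrightarrow> Mult2 \<Theta> (pm f) = pmul m n (rc m n c) f"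
proof (intro ext)
  fix z1 z2
  assume "f \<in> H2_2"
  then show "Mult2 \<Theta> (pm f) z1 z2 = pmul m n (rc m n c) f z1 z2"
    using nz[of z1 z2] H2_2_outside[of f z1 z2]
    by (cases "z1 \<in> disc \<and> z2 \<in> disc") (auto simp: Mult2_def rif_def pmul_def)
qed

text \<open>On the torus \<open>\<Theta>\<close> is \<open>z\<^sub>1\<^sup>m z\<^sub>2\<^sup>n\<close> times the conjugate of \<open>p\<close> over \<open>p\<close>,
  so orthogonality to \<open>\<Theta> p g\<close> is orthogonality of \<open>p f\<close> to \<open>z\<^sub>1\<^sup>m z\<^sub>2\<^sup>n g\<close>.\<close>
lemma pm_coeff_0:
  assumes "f \<in> H2_2" "mm i l f \<in> model2 \<Theta>" "m \<le> a + i" "n \<le> b + l"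
  shows "h2coef2 (pm f) (a, b) = 0"
proof -
  define g where "g = monf (a + i - m, b + l - n)"
  have g: "g \<in> H2_2" by (simp add: g_def)
  have "0 = inner2 (mm i l f) (Mult2 \<Theta> (pm g))"
    using assms(2) g unfolding model2_def by simp
  also have "\<dots> = inner2 (mm i l (pm f)) (mm m n g)"
    using assms(1) g by (simp add: Mult2_pm inner2_refl pmul_mm_commute)
  also have "\<dots> = h2coef2 (mm i l (pm f)) (a + i, b + l)"
    using assms by (simp add: g_def inner2_mm_monf)
  also have "\<dots> = h2coef2 (pm f) (a, b)"
    using assms by (simp add: h2coef2_mm)
  finally show ?thesis by simp
qed

lemma S_mm: "f \<in> S1 \<Longrightarrow> mm j 0 f \<in> S1" "f \<in> S2 \<Longrightarrow> mm 0 j f \<in> S2"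
  by (induction j) (auto simp: mm_simps S1 S2)

text \<open>Invariance under z1 permits i = m in \<open>pm_coeff_0\<close>; the condition on a then
  always holds and only the one on b remains. The next lemma is the same with l = n.\<close>

lemma S1_pm_coeff_0: "f \<in> S1 \<Longrightarrow> n \<le> b \<Longrightarrow> h2coef2 (pm f) (a, b) = 0"
  by (rule pm_coeff_0[of f m 0]) (auto simp: S_H2 S_model S_mm)

lemma S2_pm_coeff_0: "f \<in> S2 \<Longrightarrow> m \<le> a \<Longrightarrow> h2coef2 (pm f) (a, b) = 0"
  by (rule pm_coeff_0[of f 0 n]) (auto simp: S_H2 S_model S_mm)

definition bshift :: "bifun \<Rightarrow> bifun" where
  "bshift f = fn2 (\<lambda>(j,k). h2coef2 f (j, Suc k))"

lemma bshift_l2: "f \<in> H2_2 \<Longrightarrow> l2 (\<lambda>(j,k). h2coef2 f (j, Suc k))"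
proof -
  assume f: "f \<in> H2_2"
  have "(\<lambda>i. (cmod (h2coef2 f i))\<^sup>2) summable_on range (map_prod id Suc)"
    using l2_h2coef2[OF f] unfolding l2_def by (rule summable_on_subset_banach) auto
  then have "((\<lambda>i. (cmod (h2coef2 f i))\<^sup>2) \<circ> map_prod id Suc) summable_on UNIV"
    by (simp only: summable_on_reindex[OF inj_map_prod_Suc(2)])
  then show ?thesis
    by (simp add: l2_def o_def case_prod_unfold map_prod_def)
qed

lemma bshift_H2: "f \<in> H2_2 \<Longrightarrow> bshift f \<in> H2_2"
  unfolding bshift_def by (intro fn2_H2_2 bshift_l2)

lemma h2coef2_bshift: "f \<in> H2_2 \<Longrightarrow> h2coef2 (bshift f) (j, k) = h2coef2 f (j, Suc k)"
  unfolding bshift_def by (simp add: h2coef2_fn2 bshift_l2)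

lemma inner2_bshift: "f \<in> H2_2 \<Longrightarrow> g \<in> H2_2 \<Longrightarrow> inner2 (bshift f) g = inner2 f (Mz2 g)"
  by (simp add: inner2_ip h2coef2_Mz2 ip_shift2_right bshift_def h2coef2_fn2 bshift_l2)

lemma W2_D: "f \<in> W2 \<Longrightarrow> f \<in> S2" "f \<in> W2 \<Longrightarrow> f \<in> H2_2" "f \<in> W2 \<Longrightarrow> g \<in> S2 \<Longrightarrow> inner2 f (Mz2 g) = 0"
  using S2 by (auto simp: wander_def)

text \<open>\<open>Mz2\<close> commutes with \<open>\<Theta>\<close>, so its adjoint
  \<open>bshift\<close> preserves the model space. The component h of the result in
  \<open>S2\<close> satisfies <h, h> = <bshift f, h> = <f, z2 h> = 0.\<close>

lemma bshift_W2:
  assumes f: "f \<in> W2"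
  shows "bshift f \<in> S1"
proof -
  note H = W2_D(2)[OF f]
  have "inner2 (bshift f) (Mult2 \<Theta> g) = 0" if g: "g \<in> H2_2" for g
  proof -
    have "inner2 (bshift f) (Mult2 \<Theta> g) = inner2 f (Mult2 \<Theta> (Mz2 g))"
      using H g by (simp add: inner2_bshift Mult2_H2)
        (intro arg_cong[where f="inner2 f"] ext, simp add: Mz2_def Mult2_def)
    also have "\<dots> = 0"
      using S_model(2)[OF W2_D(1)[OF f]] g by (simp add: model2_def H2_2_Mz2)
    finally show ?thesis .
  qed
  then have "bshift f \<in> model2 \<Theta>"
    using bshift_H2[OF H] by (simp add: model2_def)
  then obtain g h where gh: "g \<in> S1" "h \<in> S2" "bshift f = (\<lambda>z1 z2. g z1 z2 + h z1 z2)"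
    unfolding decomp by blast
  note gh' = S_H2(1)[OF gh(1)] S_H2(2)[OF gh(2)]
  have "inner2 h h = inner2 (bshift f) h"
    using gh orth gh' by (simp add: inner2_add_left)
  also have "\<dots> = 0" using inner2_bshift[OF H gh'(2)] W2_D(3)[OF f gh(2)] by simp
  finally have "h = (\<lambda>_ _. 0)" using gh' inner2_self_eq_0 by blast
  then show ?thesis using gh by simp
qed

lemma W2_pm_coeff_0:
  assumes f: "f \<in> W2" and ab: "\<not> (a < m \<and> b \<le> n)"
  shows "h2coef2 (pm f) (a, b) = 0"
proof (cases "m \<le> a")
  case True
  then show ?thesis using S2_pm_coeff_0 W2_D[OF f] by blast
next
  case False
  with ab have b: "n < b" by simp
  note H = W2_D(2)[OF f]
  \<comment> \<open>As b > n, this coefficient uses f only at second indices b - k >= 1, where the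
    backward shift carries the same entries one place lower. So the bound < n valid on
    \<open>S1\<close> becomes <= n.\<close>
  have "h2coef2 (pm f) (a, b) = h2coef2 (pm (bshift f)) (a, b - 1)"
    unfolding h2coef2_pmul[OF H] h2coef2_pmul[OF bshift_H2[OF H]]
    using b by (intro sum.cong refl) (auto simp: h2coef2_bshift[OF H] Suc_diff_le[symmetric])
  also have "\<dots> = 0" by (rule S1_pm_coeff_0[OF bshift_W2[OF f]]) (use b in simp)
  finally show ?thesis .
qed

lemma W2_polynomial:
  assumes "f \<in> W2" "z1 \<in> disc" "z2 \<in> disc"
  shows "pv m n c z1 z2 * f z1 z2 = (\<Sum>j<m. \<Sum>k\<le>n. h2coef2 (pm f) (j,k) * (z1 ^ j * z2 ^ k))"
  using H2_2_polynomial[OF pmul_H2_2[OF W2_D(2)[OF assms(1)], of m n c] assms(2,3) W2_pm_coeff_0[OF assms(1)]]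
  by (simp add: pmul_def)

lemma W2_zero: "(\<lambda>_ _. 0) \<in> W2"
  and W2_add: "f \<in> W2 \<Longrightarrow> g \<in> W2 \<Longrightarrow> (\<lambda>z1 z2. f z1 z2 + g z1 z2) \<in> W2"
  and W2_scale: "f \<in> W2 \<Longrightarrow> (\<lambda>z1 z2. a * f z1 z2) \<in> W2"
  using S2 by (auto simp: wander_def inner2_add_left inner2_scale_left S_H2 H2_2_Mz2)

lemma W2_sum: "(\<And>i. i \<in> A \<Longrightarrow> f i \<in> W2) \<Longrightarrow> (\<lambda>z1 z2. \<Sum>i\<in>A. f i z1 z2) \<in> W2"
  by (induction A rule: infinite_finite_induct) (auto intro: W2_zero W2_add)

text \<open>An orthonormal system of length d in \<open>W2\<close>; completeness is added only in
  \<open>W2_basis\<close>.\<close>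

definition onb :: "nat \<Rightarrow> (nat \<Rightarrow> complex \<Rightarrow> complex \<Rightarrow> complex) \<Rightarrow> bool" where
  "onb d u \<longleftrightarrow> (\<forall>i<d. u i \<in> W2) \<and> (\<forall>i<d. \<forall>l<d. inner2 (u i) (u l) = (if i = l then 1 else 0))"

text \<open>The smaller power of z2 cancels by isometry; what remains pairs a wandering function
  with an element of z2 \<open>S2\<close>.\<close>

lemma W2_shift_orthogonal:
  assumes "f \<in> W2" "g \<in> W2" "l \<noteq> l'"
  shows "inner2 (mm 0 l f) (mm 0 l' g) = 0"
proof -
  have 1: "inner2 (mm 0 l f) (mm 0 l' g) = 0" if fg: "f \<in> W2" "g \<in> W2" and l: "l < l'" for f g l l'
  proof -
    define k where "k = l' - l - 1"
    have "mm 0 l' g = mm 0 l (Mz2 (mm 0 k g))"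
      using l by (simp add: mm_simps[symmetric] mm_mm k_def)
    then have "inner2 (mm 0 l f) (mm 0 l' g) = inner2 f (Mz2 (mm 0 k g))"
      using fg by (simp add: inner2_mm W2_D H2_2_Mz2)
    also have "\<dots> = 0" using fg by (simp add: W2_D S_mm)
    finally show ?thesis .
  qed
  show ?thesis
  proof (cases "l < l'")
    case True then show ?thesis using 1 assms by blast
  next
    case False
    then have "inner2 (mm 0 l' g) (mm 0 l f) = 0" using 1 assms by simp
    then show ?thesis by (metis inner2_commute complex_cnj_zero)
  qed
qed

text \<open>More than \<open>m\<close> orthonormal functions \<open>u\<^sub>i\<close> would have orthonormal shifts \<open>z\<^sub>2\<^sup>l u\<^sub>i\<close>, which after
  multiplication by \<open>p\<close> are too many polynomials for their bidegree.\<close>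
lemma onb_le:
  assumes u: "onb d u"
  shows "d \<le> m"
proof (rule ccontr)
  assume "\<not> d \<le> m"
  then have d: "m < d" by simp
  \<comment> \<open>The (m+1)(L+1) shifted functions have numerators in a space of m(n+L+1)
    coefficients. The difference is L + 1 - m n, so L = m n leaves exactly one to spare.\<close>
  define L where "L = m * n"
  define I J where "I = {..m} \<times> {..L}" and "J = {..<m} \<times> {..n + L}"
  have "card J = m * n + m * (L + 1)"
    by (simp add: J_def card_cartesian_product algebra_simps)
  also have "\<dots> < card I"
    by (simp add: I_def card_cartesian_product L_def)
  finally obtain x where x: "\<exists>i\<in>I. x i \<noteq> 0"
    "\<And>j. j \<in> J \<Longrightarrow> (\<Sum>i\<in>I. x i * h2coef2 (pm (mm 0 (snd i) (u (fst i)))) j) = 0"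
    using homogeneous_system[of J I "\<lambda>i. h2coef2 (pm (mm 0 (snd i) (u (fst i))))"]
    unfolding I_def J_def by blast
  have uI: "u (fst i) \<in> W2" if "i \<in> I" for i
    using u d that unfolding onb_def I_def by auto
  define G where "G = (\<lambda>z1 z2. \<Sum>i\<in>I. x i * mm 0 (snd i) (u (fst i)) z1 z2)"
  have G: "G \<in> H2_2" unfolding G_def by (intro H2_2_sum H2_2_scale mm_H2_2 W2_D uI)
  have "pm G = (\<lambda>_ _. 0)"
  proof (rule h2coef2_eq_0_imp)
    show "pm G \<in> H2_2" using G by simp
    fix a b
    have "pm G = (\<lambda>z1 z2. \<Sum>i\<in>I. x i * pm (mm 0 (snd i) (u (fst i))) z1 z2)"
      by (auto simp: pmul_def G_def sum_distrib_left mult_ac)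
    then have s: "h2coef2 (pm G) (a, b) = (\<Sum>i\<in>I. x i * h2coef2 (pm (mm 0 (snd i) (u (fst i)))) (a, b))"
      using uI by (simp add: h2coef2_sum H2_2_scale W2_D h2coef2_scale)
    show "h2coef2 (pm G) (a, b) = 0"
    proof (cases "(a, b) \<in> J")
      case True then show ?thesis using x(2) s by simp
    next
      case False
      have "h2coef2 (pm (mm 0 (snd i) (u (fst i)))) (a, b) = 0" if i: "i \<in> I" for i
      proof -
        have "\<not> (a < m \<and> b - snd i \<le> n)" if "snd i \<le> b"
          using False i unfolding I_def J_def by auto
        then show ?thesis
          using W2_pm_coeff_0[OF uI[OF i]] W2_D[OF uI[OF i]] by (simp add: pmul_mm_commute h2coef2_mm)
      qed
      then show ?thesis using s by simp
    qed
  qed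
  then have "pm G z1 z2 = 0" for z1 z2 by simp
  then have pG: "pv m n c z1 z2 * G z1 z2 = 0" for z1 z2
    by (simp add: pmul_def)
  have G0: "G = (\<lambda>_ _. 0)"
  proof (intro ext)
    fix z1 z2
    show "G z1 z2 = 0"
      using pG[of z1 z2] nz[of z1 z2] H2_2_outside[OF G, of z1 z2] by auto
  qed
  have "x i' = 0" if i': "i' \<in> I" for i'
  proof -
    have "0 = inner2 G (mm 0 (snd i') (u (fst i')))" by (simp add: G0)
    also have "\<dots> = (\<Sum>i\<in>I. x i * inner2 (mm 0 (snd i) (u (fst i))) (mm 0 (snd i') (u (fst i'))))"
      unfolding G_def using uI i' by (simp add: inner2_sum_left inner2_scale_left H2_2_scale W2_D)
    also have "\<dots> = (\<Sum>i\<in>I. x i * (if i = i' then 1 else 0))"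
    proof (intro sum.cong refl arg_cong2[where f="(*)"])
      fix i assume i: "i \<in> I"
      have "fst i < d" "fst i' < d" using d i i' by (auto simp: I_def)
      then have "inner2 (u (fst i)) (u (fst i')) = (if fst i = fst i' then 1 else 0)"
        using u by (simp add: onb_def)
      then show "inner2 (mm 0 (snd i) (u (fst i))) (mm 0 (snd i') (u (fst i'))) = (if i = i' then 1 else 0)"
        using W2_shift_orthogonal[OF uI[OF i] uI[OF i'], of "snd i" "snd i'"] uI[OF i] uI[OF i']
        by (cases "snd i = snd i'") (auto simp: inner2_mm W2_D prod_eq_iff)
    qed
    also have "\<dots> = x i'" using i' by (simp add: I_def if_distrib[where f="\<lambda>y. _ * y"] cong: if_cong)
    finally show ?thesis by simp
  qed
  with x(1) show False by blast
qed

text \<open>By \<open>onb_le\<close> there is an orthonormal system of maximal length; the nonzero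
  remainder of an f outside its span could be normalised and appended.\<close>

lemma W2_basis:
  obtains d u where "onb d u" "\<And>f. f \<in> W2 \<Longrightarrow> f = (\<lambda>z1 z2. \<Sum>i<d. inner2 f (u i) * u i z1 z2)"
proof -
  have "\<exists>u. onb 0 u" by (simp add: onb_def)
  then obtain d where d: "\<exists>u. onb d u" "\<And>d'. \<exists>u. onb d' u \<Longrightarrow> d' \<le> d"
    using Nat.ex_has_greatest_nat[of "\<lambda>d. \<exists>u. onb d u" 0 m] onb_le by blast
  then obtain u where u: "onb d u" by blast
  have uW: "u i \<in> W2" if "i < d" for i using u that by (simp add: onb_def)
  have uH: "u i \<in> H2_2" if "i < d" for i using uW[OF that] by (rule W2_D)
  have "f = (\<lambda>z1 z2. \<Sum>i<d. inner2 f (u i) * u i z1 z2)" if f: "f \<in> W2" for f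
  proof (rule ccontr)
    define s where "s = (\<lambda>z1 z2. \<Sum>i<d. inner2 f (u i) * u i z1 z2)"
    define h where "h = (\<lambda>z1 z2. f z1 z2 + (-1) * s z1 z2)"
    assume "f \<noteq> (\<lambda>z1 z2. \<Sum>i<d. inner2 f (u i) * u i z1 z2)"
    then have "f \<noteq> s" by (simp add: s_def)
    have sW: "s \<in> W2" unfolding s_def by (intro W2_sum W2_scale uW) auto
    have hW: "h \<in> W2" unfolding h_def by (intro W2_add W2_scale f sW)
    have "h \<noteq> (\<lambda>_ _. 0)"
    proof
      assume "h = (\<lambda>_ _. 0)"
      then have "h z1 z2 = 0" for z1 z2 by simp
      then have "f z1 z2 = s z1 z2" for z1 z2 by (simp add: h_def)
      with \<open>f \<noteq> s\<close> show False by blast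
    qed
    have horth: "inner2 h (u l) = 0" if l: "l < d" for l
    proof -
      have "inner2 s (u l) = (\<Sum>i<d. inner2 f (u i) * inner2 (u i) (u l))"
        unfolding s_def by (subst inner2_sum_left) (auto intro!: H2_2_scale uH l sum.cong simp: inner2_scale_left uH)
      also have "\<dots> = (\<Sum>i<d. inner2 f (u i) * (if i = l then 1 else 0))"
        using u l by (intro sum.cong refl) (auto simp: onb_def)
      also have "\<dots> = inner2 f (u l)" using l by (simp add: if_distrib[where f="\<lambda>y. _ * y"] cong: if_cong)
      finally show ?thesis
        unfolding h_def using inner2_lincomb_left[OF W2_D(2)[OF f] W2_D(2)[OF sW] uH[OF l], of "-1"] by simp
    qed
    define N where "N = Re (inner2 h h)"
    have N: "inner2 h h = of_real N" unfolding N_def by (rule inner2_self_real)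
    have "N \<noteq> 0" using N inner2_self_eq_0[OF W2_D(2)[OF hW]] \<open>h \<noteq> _\<close> by auto
    moreover have "N \<ge> 0" unfolding N_def by (rule inner2_self_nonneg[OF W2_D(2)[OF hW]])
    ultimately have Npos: "N > 0" by simp
    define t where "t = complex_of_real (1 / sqrt N)"
    define e where "e = (\<lambda>z1 z2. t * h z1 z2)"
    have eW: "e \<in> W2" unfolding e_def by (rule W2_scale[OF hW])
    have he: "inner2 e g = t * inner2 h g" for g
      unfolding e_def using hW by (simp add: inner2_scale_left W2_D)
    have "inner2 e e = t * (cnj t * of_real N)"
      unfolding he using hW N by (simp add: e_def inner2_scale_right W2_D)
    also have "\<dots> = of_real (1 / sqrt N * (1 / sqrt N) * N)"
      by (simp only: t_def complex_cnj_complex_of_real of_real_mult mult.assoc)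
    also have "1 / sqrt N * (1 / sqrt N) * N = 1" using Npos by (simp add: field_simps)
    finally have ee: "inner2 e e = 1" by simp
    have eu: "inner2 e (u l) = 0" "inner2 (u l) e = 0" if "l < d" for l
      using he horth[OF that] inner2_commute[of e "u l"] by simp_all
    have "onb (Suc d) (u(d := e))"
      unfolding onb_def using u eW ee eu by (auto simp: onb_def less_Suc_eq)
    then have "Suc d \<le> d" using d(2) by blast
    then show False by simp
  qed
  with u show thesis by (rule that)
qed

lemma W1_D: "f \<in> W1 \<Longrightarrow> f \<in> S1" "f \<in> W1 \<Longrightarrow> f \<in> H2_2" "f \<in> W1 \<Longrightarrow> g \<in> S1 \<Longrightarrow> inner2 f (Mz1 g) = 0"
  using S1 by (auto simp: wander_def)

text \<open>The reproducing kernel of \<open>\<K>\<^sub>\<Theta>\<close> splits along \<open>S\<^sub>1 \<oplus> S\<^sub>2\<close>;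
  the factor \<open>1 - z\<^sub>i w\<^sub>i\<close> (conjugated in \<open>w\<^sub>i\<close>) turns each part into the kernel of the wandering subspace.\<close>
lemma agler_kernels:
  assumes w: "w1 \<in> disc" "w2 \<in> disc"
  obtains K1 K2 where "K1 \<in> W1" "K2 \<in> W2"
    "\<And>f. f \<in> W1 \<Longrightarrow> inner2 f K1 = f w1 w2" "\<And>f. f \<in> W2 \<Longrightarrow> inner2 f K2 = f w1 w2"
    "\<And>z1 z2. z1 \<in> disc \<Longrightarrow> z2 \<in> disc \<Longrightarrow> 1 - \<Theta> z1 z2 * cnj (\<Theta> w1 w2)
       = (1 - z2 * cnj w2) * K1 z1 z2 + (1 - z1 * cnj w1) * K2 z1 z2"
proof -
  define k where "k = szego2 w1 w2"
  define t where "t = cnj (\<Theta> w1 w2)"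
  \<comment> \<open>The Szego kernel times 1 - \<open>\<Theta>\<close>(z)
    conj(\<open>\<Theta>\<close>(w)), which is the reproducing kernel of the model space.\<close>
  define kT where "kT = (\<lambda>z1 z2. k z1 z2 + (- t) * Mult2 \<Theta> k z1 z2)"
  have k: "k \<in> H2_2" "Mult2 \<Theta> k \<in> H2_2" using w by (simp_all add: k_def szego2_H2_2 Mult2_H2)
  have kTH: "kT \<in> H2_2" unfolding kT_def by (intro H2_2_add H2_2_scale k)
  have rep: "inner2 f k = f w1 w2" if "f \<in> H2_2" for f
    using that w by (simp add: k_def inner2_szego2)
  have innerkT: "inner2 f kT = f w1 w2 - \<Theta> w1 w2 * inner2 f (Mult2 \<Theta> k)" if "f \<in> H2_2" for f
    unfolding kT_def inner2_lincomb_right[OF k that] by (simp add: rep that t_def)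
  have "inner2 kT (Mult2 \<Theta> g) = 0" if g: "g \<in> H2_2" for g
  proof -
    have "inner2 (Mult2 \<Theta> g) kT = Mult2 \<Theta> g w1 w2 - \<Theta> w1 w2 * inner2 g k"
      using g k by (simp add: innerkT Mult2_H2 isom)
    also have "\<dots> = 0" using w g by (simp add: rep Mult2_def)
    finally show ?thesis by (metis inner2_commute complex_cnj_zero)
  qed
  then have "kT \<in> model2 \<Theta>" using kTH by (simp add: model2_def)
  then obtain s1 s2 where s: "s1 \<in> S1" "s2 \<in> S2" "kT = (\<lambda>z1 z2. s1 z1 z2 + s2 z1 z2)"
    unfolding decomp by blast
  note sH = S_H2(1)[OF s(1)] S_H2(2)[OF s(2)]
  have repM: "inner2 f kT = f w1 w2" if "f \<in> model2 \<Theta>" for f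
    using that innerkT[of f] k by (simp add: model2_def)
  have rs1: "inner2 f s1 = f w1 w2" if f: "f \<in> S1" for f
    using repM[OF S_model(1)[OF f]] orth[OF f s(2)] sH S_H2(1)[OF f] by (simp add: s inner2_add_right)
  have rs2: "inner2 f s2 = f w1 w2" if f: "f \<in> S2" for f
  proof -
    have "inner2 f s1 = 0" using orth[OF s(1) f] by (metis inner2_commute complex_cnj_zero)
    then show ?thesis
      using repM[OF S_model(2)[OF f]] sH S_H2(2)[OF f] by (simp add: s inner2_add_right)
  qed
  \<comment> \<open>For g in \<open>S1\<close>, pairing z1 g with \<open>K1\<close> gives w1 g(w) -
    w1 g(w) = 0, so \<open>K1\<close> is wandering. Against a wandering f the second term of
    \<open>K1\<close> drops out and the first reproduces f.\<close>
  define K1 where "K1 = (\<lambda>z1 z2. s1 z1 z2 + (- cnj w1) * Mz1 s1 z1 z2)"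
  define K2 where "K2 = (\<lambda>z1 z2. s2 z1 z2 + (- cnj w2) * Mz2 s2 z1 z2)"
  have iK1: "inner2 f K1 = inner2 f s1 - w1 * inner2 f (Mz1 s1)" if "f \<in> H2_2" for f
    unfolding K1_def inner2_lincomb_right[OF sH(1) H2_2_Mz1[OF sH(1)] that] by simp
  have iK2: "inner2 f K2 = inner2 f s2 - w2 * inner2 f (Mz2 s2)" if "f \<in> H2_2" for f
    unfolding K2_def inner2_lincomb_right[OF sH(2) H2_2_Mz2[OF sH(2)] that] by simp
  show thesis
  proof (rule that[of K1 K2])
    have "inner2 K1 (Mz1 g) = 0" if g: "g \<in> S1" for g
    proof -
      have "inner2 (Mz1 g) K1 = 0"
        using g sH s by (simp add: iK1 S_H2 H2_2_Mz1 rs1 S1) (simp add: Mz1_def)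
      then show ?thesis by (metis inner2_commute complex_cnj_zero)
    qed
    moreover have "K1 \<in> S1" unfolding K1_def by (intro S1 s)
    ultimately show "K1 \<in> W1" by (simp add: wander_def)
    have "inner2 K2 (Mz2 g) = 0" if g: "g \<in> S2" for g
    proof -
      have "inner2 (Mz2 g) K2 = 0"
        using g sH s by (simp add: iK2 S_H2 H2_2_Mz2 rs2 S2) (simp add: Mz2_def)
      then show ?thesis by (metis inner2_commute complex_cnj_zero)
    qed
    moreover have "K2 \<in> S2" unfolding K2_def by (intro S2 s)
    ultimately show "K2 \<in> W2" by (simp add: wander_def)
    show "inner2 f K1 = f w1 w2" if f: "f \<in> W1" for f
      using W1_D[OF f] W1_D(3)[OF f s(1)] by (simp add: iK1 rs1)
    show "inner2 f K2 = f w1 w2" if f: "f \<in> W2" for f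
      using W2_D[OF f] W2_D(3)[OF f s(2)] by (simp add: iK2 rs2)
    fix z1 z2 :: complex assume z: "z1 \<in> disc" "z2 \<in> disc"
    define a b where "a = 1 - z1 * cnj w1" and "b = 1 - z2 * cnj w2"
    have "1 - \<Theta> z1 z2 * t = (a * b * k z1 z2) * (1 - \<Theta> z1 z2 * t)"
      using szego2_eq[OF w z] by (simp add: k_def a_def b_def)
    also have "\<dots> = a * b * kT z1 z2"
      using z by (simp add: kT_def Mult2_def algebra_simps)
    also have "\<dots> = b * (a * s1 z1 z2) + a * (b * s2 z1 z2)"
      by (simp add: s algebra_simps)
    also have "a * s1 z1 z2 = K1 z1 z2" by (simp add: a_def K1_def Mz1_def algebra_simps)
    also have "b * s2 z1 z2 = K2 z1 z2" by (simp add: b_def K2_def Mz2_def algebra_simps)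
    finally show "1 - \<Theta> z1 z2 * cnj (\<Theta> w1 w2) = (1 - z2 * cnj w2) * K1 z1 z2 + (1 - z1 * cnj w1) * K2 z1 z2"
      by (simp add: a_def b_def t_def)
  qed
qed

end

section \<open>One-variable model spaces\<close>

text \<open>An isometric copy of the one-variable Hardy space: functions constant in z2 on the
  bidisk. Inner products and the reflection identities are thereby inherited. Only z2 needs a guard,
  since f already vanishes off the disc.\<close>

definition emb :: "(complex \<Rightarrow> complex) \<Rightarrow> bifun" where
  "emb f = (\<lambda>z1 z2. if z2 \<in> disc then f z1 else 0)"

definition emb_coeff :: "(nat \<Rightarrow> complex) \<Rightarrow> nat \<times> nat \<Rightarrow> complex" where
  "emb_coeff a = (\<lambda>(j,k). if k = 0 then a j else 0)"

lemma inj_row0: "inj (\<lambda>j. (j, 0::nat))" by (auto simp: inj_def)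

lemma emb_coeff_row0: "emb_coeff a (j, 0) = a j" "i \<notin> range (\<lambda>j. (j, 0)) \<Longrightarrow> emb_coeff a i = 0"
  by (auto simp: emb_coeff_def split: prod.splits)

lemmas emb_reindex = inj_row0 emb_coeff_row0

lemmas l2_emb_reindex = l2_reindex[where s="\<lambda>j. (j, 0)" and a="emb_coeff a" and a'=a, OF emb_reindex] for a
lemmas ip_emb_reindex = ip_reindex_right[where s="\<lambda>j. (j, 0)" and a="emb_coeff a" and a'=a, OF emb_reindex] for a
lemmas has_sum_emb_reindex =
  has_sum_reindex_mult[where s="\<lambda>j. (j, 0)" and a="emb_coeff a" and a'=a, OF emb_reindex] for a

lemma l2_nat_iff: "l2 (a :: nat \<Rightarrow> complex) \<longleftrightarrow> summable (\<lambda>j. (cmod (a j))\<^sup>2)"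
  unfolding l2_def by (rule summable_on_UNIV_nonneg_real_iff) auto

lemma l2_emb_coeff: "l2 (emb_coeff a) \<longleftrightarrow> summable (\<lambda>j. (cmod (a j))\<^sup>2)"
  unfolding l2_nat_iff[symmetric] by (rule l2_emb_reindex)

lemma emb_coeffs:
  assumes "H2_1_coeffs a f"
  shows "H2_2_coeffs (emb_coeff a) (emb f)"
proof -
  have l2: "l2 (emb_coeff a)" using assms by (simp add: l2_emb_coeff H2_1_coeffs_def)
  have "((\<lambda>i. emb_coeff a i * mon2 z1 z2 i) has_sum f z1) UNIV" if z: "z1 \<in> disc" "z2 \<in> disc" for z1 z2
  proof -
    have "(\<lambda>i. emb_coeff a i * mon2 z1 z2 i) summable_on UNIV"
      by (rule abs_summable_summable[OF l2_abs_summable_mult[OF l2 mon2_l2[OF z]]])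
    then obtain S where S: "((\<lambda>i. emb_coeff a i * mon2 z1 z2 i) has_sum S) UNIV"
      by (auto simp: summable_on_def)
    then have "((\<lambda>j. a j * mon2 z1 z2 (j, 0)) has_sum S) UNIV"
      by (subst (asm) has_sum_emb_reindex)
    then have "(\<lambda>j. a j * z1 ^ j) sums S"
      using has_sum_imp_sums by (fastforce simp: mon2_def)
    moreover have "(\<lambda>j. a j * z1 ^ j) sums f z1"
      using assms z by (simp add: H2_1_coeffs_def)
    ultimately show ?thesis using S sums_unique2 by metis
  qed
  then show ?thesis
    unfolding H2_2_coeffs_alt using l2 assms by (auto simp: emb_def H2_1_coeffs_def)
qed

lemma emb_H2_2: "f \<in> H2_1 \<Longrightarrow> emb f \<in> H2_2"
  unfolding H2_1_def H2_2_def using emb_coeffs by blast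

lemma H2_1_emb:
  assumes F: "emb f \<in> H2_2" and out: "\<And>z. z \<notin> disc \<Longrightarrow> f z = 0"
  shows "f \<in> H2_1"
proof -
  define A where "A = h2coef2 (emb f)"
  have A: "H2_2_coeffs A (emb f)" unfolding A_def by (rule H2_2_h2coef2[OF F])
  then have "(\<lambda>i. (cmod (A i))\<^sup>2) summable_on range (\<lambda>j. (j, 0))"
    unfolding H2_2_coeffs_alt l2_def by (auto intro: summable_on_subset_banach)
  then have "((\<lambda>i. (cmod (A i))\<^sup>2) \<circ> (\<lambda>j. (j, 0))) summable_on UNIV"
    by (simp only: summable_on_reindex[OF inj_row0])
  then have "summable (\<lambda>j. (cmod (A (j, 0)))\<^sup>2)"
    unfolding l2_nat_iff[symmetric] l2_def by (simp add: o_def)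
  moreover have "(\<lambda>j. A (j, 0) * z ^ j) sums f z" if z: "z \<in> disc" for z
  proof -
    have "((\<lambda>i. A i * mon2 z 0 i) has_sum f z) UNIV"
      using A z unfolding H2_2_coeffs_alt emb_def by (auto dest: bspec[of _ _ 0])
    \<comment> \<open>At z2 = 0 every term with k > 0 drops out.\<close>
    then have "((\<lambda>i. A i * mon2 z 0 i) has_sum f z) (range (\<lambda>j. (j, 0)))"
      by (rule has_sum_cong_neutral[THEN iffD1, rotated -1])
        (auto simp: mon2_def power_0_left image_iff split: prod.splits)
    then have "(((\<lambda>i. A i * mon2 z 0 i) \<circ> (\<lambda>j. (j, 0))) has_sum f z) UNIV"
      by (simp only: has_sum_reindex[OF inj_row0])
    from has_sum_imp_sums[OF this] show ?thesis by (simp add: o_def mon2_def)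
  qed
  ultimately have "H2_1_coeffs (\<lambda>j. A (j, 0)) f"
    using out by (simp add: H2_1_coeffs_def)
  then show ?thesis unfolding H2_1_def by blast
qed

lemma H2_1_outside: "f \<in> H2_1 \<Longrightarrow> z \<notin> disc \<Longrightarrow> f z = 0"
  unfolding H2_1_def H2_1_coeffs_def by auto

lemma h2coef2_emb:
  assumes "f \<in> H2_1"
  shows "h2coef2 (emb f) = emb_coeff (h2coef1 f)"
proof -
  have "H2_1_coeffs (h2coef1 f) f"
    unfolding h2coef1_def using assms by (auto simp: H2_1_def intro: someI[where P="\<lambda>a. H2_1_coeffs a f"])
  then show ?thesis by (intro h2coef2_eqI emb_coeffs)
qed

lemma inner1_emb:
  assumes f: "f \<in> H2_1" and g: "g \<in> H2_1"
  shows "inner1 f g = inner2 (emb f) (emb g)"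
proof -
  have l2: "l2 (h2coef1 f)" "l2 (h2coef1 g)"
    using l2_h2coef2[OF emb_H2_2] f g unfolding l2_nat_iff l2_emb_coeff[symmetric] by (auto simp: h2coef2_emb)
  have "inner2 (emb f) (emb g) = (\<Sum>\<^sub>\<infinity>j. emb_coeff (h2coef1 f) (j, 0) * cnj (h2coef1 g j))"
    unfolding inner2_ip h2coef2_emb[OF f] h2coef2_emb[OF g]
    by (rule ip_emb_reindex)
  also have "\<dots> = (\<Sum>\<^sub>\<infinity>j. h2coef1 f j * cnj (h2coef1 g j))"
    by (simp add: emb_coeff_row0)
  also have "\<dots> = inner1 f g"
    unfolding inner1_def
    using has_sum_imp_sums[OF has_sum_infsum[OF l2_summable_ip[OF l2]]] by (rule sums_unique)
  finally show ?thesis ..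
qed

lemma H2_1_lincomb:
  assumes "f \<in> H2_1" "g \<in> H2_1"
  shows "(\<lambda>z. f z + a * g z) \<in> H2_1"
proof (rule H2_1_emb)
  have "emb (\<lambda>z. f z + a * g z) = (\<lambda>z1 z2. emb f z1 z2 + a * emb g z1 z2)"
    by (intro ext) (simp add: emb_def)
  then show "emb (\<lambda>z. f z + a * g z) \<in> H2_2"
    using assms by (simp add: H2_2_add H2_2_scale emb_H2_2)
qed (use H2_1_outside[OF assms(1)] H2_1_outside[OF assms(2)] in auto)

lemma H2_1_zero: "(\<lambda>_. 0) \<in> H2_1"
  by (rule H2_1_emb) (simp_all add: emb_def H2_2_zero)

lemma H2_1_scale: "f \<in> H2_1 \<Longrightarrow> (\<lambda>z. a * f z) \<in> H2_1"
  using H2_1_lincomb[OF H2_1_zero, of f a] by simp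

lemma inner1_lincomb_left:
  assumes "f \<in> H2_1" "g \<in> H2_1" "h \<in> H2_1"
  shows "inner1 (\<lambda>z. f z + a * g z) h = inner1 f h + a * inner1 g h"
proof -
  have "emb (\<lambda>z. f z + a * g z) = (\<lambda>z1 z2. emb f z1 z2 + a * emb g z1 z2)"
    by (intro ext) (simp add: emb_def)
  then show ?thesis
    using assms by (simp add: inner1_emb H2_1_lincomb inner2_lincomb_left emb_H2_2)
qed

lemma inner1_commute:
  "f \<in> H2_1 \<Longrightarrow> g \<in> H2_1 \<Longrightarrow> inner1 g f = cnj (inner1 f g)"
  by (simp add: inner1_emb inner2_commute[of "emb g"])

lemma inner1_lincomb_right:
  assumes "f \<in> H2_1" "g \<in> H2_1" "h \<in> H2_1"
  shows "inner1 h (\<lambda>z. f z + a * g z) = inner1 h f + cnj a * inner1 h g"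
  using assms inner1_lincomb_left[OF assms, of a]
  by (simp add: inner1_commute[of _ h] H2_1_lincomb)

lemma H2_1_sum:
  "(\<And>i. i \<in> A \<Longrightarrow> f i \<in> H2_1) \<Longrightarrow> (\<lambda>z. \<Sum>i\<in>A. x i * f i z) \<in> H2_1"
proof (induction A rule: infinite_finite_induct)
  case (insert i A)
  then show ?case using H2_1_lincomb[of "\<lambda>z. \<Sum>i\<in>A. x i * f i z" "f i" "x i"] by (simp add: add.commute)
qed (simp_all add: H2_1_zero)

lemma inner1_zero: "inner1 (\<lambda>_. 0) h = 0" if "h \<in> H2_1"
  using that by (simp add: inner1_emb H2_1_zero) (simp add: emb_def)

lemma inner1_sum_left:
  "(\<And>i. i \<in> A \<Longrightarrow> f i \<in> H2_1) \<Longrightarrow> h \<in> H2_1 \<Longrightarrow>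
    inner1 (\<lambda>z. \<Sum>i\<in>A. x i * f i z) h = (\<Sum>i\<in>A. x i * inner1 (f i) h)"
proof (induction A rule: infinite_finite_induct)
  case (insert i A)
  then show ?case
    using inner1_lincomb_left[of "\<lambda>z. \<Sum>i\<in>A. x i * f i z" "f i" h "x i"] H2_1_sum[of A f x]
    by (simp add: add.commute)
qed (simp_all add: inner1_zero)

lemma inner1_sum_right:
  assumes "\<And>i. i \<in> A \<Longrightarrow> f i \<in> H2_1" "h \<in> H2_1"
  shows "inner1 h (\<lambda>z. \<Sum>i\<in>A. x i * f i z) = (\<Sum>i\<in>A. cnj (x i) * inner1 h (f i))"
proof -
  have "inner1 h (\<lambda>z. \<Sum>i\<in>A. x i * f i z) = cnj (\<Sum>i\<in>A. x i * inner1 (f i) h)"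
    using assms inner1_commute[of "\<lambda>z. \<Sum>i\<in>A. x i * f i z" h] by (simp add: H2_1_sum inner1_sum_left)
  also have "\<dots> = (\<Sum>i\<in>A. cnj (x i) * inner1 h (f i))"
    unfolding cnj_sum complex_cnj_mult using assms by (intro sum.cong refl) (simp add: inner1_commute[symmetric])
  finally show ?thesis .
qed

text \<open>The coefficients of the quotient satisfy s_k = b_k + a s_(k-1). For norms truncated at N
  this gives norm(s) <= norm(b) + |a| norm(s), hence the bound D / (1 - |a|) for every N; truncation
  makes the subtraction legitimate.\<close>

lemma H2_1_divide_linear:
  assumes g: "g \<in> H2_1" and a: "cmod a < 1"
  shows "(\<lambda>z. if z \<in> disc then g z / (1 - a * z) else 0) \<in> H2_1"
proof -
  define b where "b = h2coef1 g"
  define s where "s = rec_nat (b 0) (\<lambda>k x. b (Suc k) + a * x)"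
  have s: "s 0 = b 0" "s (Suc k) = b (Suc k) + a * s k" for k by (simp_all add: s_def)
  have emb_g: "H2_2_coeffs (emb_coeff b) (emb g)"
    using H2_2_h2coef2[OF emb_H2_2[OF g]] by (simp add: h2coef2_emb[OF g] b_def)
  then have b: "summable (\<lambda>j. (cmod (b j))\<^sup>2)" by (simp add: H2_2_coeffs_alt l2_emb_coeff)
  define D where "D = sqrt (\<Sum>j. (cmod (b j))\<^sup>2)"
  have Db: "L2_set (\<lambda>k. cmod (b k)) {..N} \<le> D" for N
    unfolding L2_set_def D_def using b by (intro real_sqrt_le_mono sum_le_suminf) auto
  have est: "L2_set (\<lambda>k. cmod (s k)) {..N} \<le> D / (1 - cmod a)" for N
  proof -
    define sh where "sh k = (if k = 0 then 0 else cmod (s (k - 1)))" for k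
    have "L2_set sh {..N} \<le> L2_set (\<lambda>k. cmod (s k)) {..N}"
    proof -
      have "(\<Sum>k\<le>N. (sh k)\<^sup>2) \<le> (\<Sum>k\<le>N. (cmod (s k))\<^sup>2)"
      proof (cases N)
        case (Suc M)
        then have "(\<Sum>k\<le>N. (sh k)\<^sup>2) = (\<Sum>k\<le>M. (cmod (s k))\<^sup>2)"
          by (simp add: sum.atMost_Suc_shift sh_def del: sum.atMost_Suc)
        also have "\<dots> \<le> (\<Sum>k\<le>N. (cmod (s k))\<^sup>2)" by (rule sum_mono2) (use Suc in auto)
        finally show ?thesis .
      qed (simp add: sh_def)
      then show ?thesis by (simp add: L2_set_def)
    qed
    then have "cmod a * L2_set sh {..N} \<le> cmod a * L2_set (\<lambda>k. cmod (s k)) {..N}"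
      by (intro mult_left_mono) auto
    moreover have "L2_set (\<lambda>k. cmod (s k)) {..N} \<le> L2_set (\<lambda>k. cmod (b k) + cmod a * sh k) {..N}"
    proof (rule L2_set_mono)
      fix k show "cmod (s k) \<le> cmod (b k) + cmod a * sh k"
        by (cases k) (auto simp: s sh_def norm_mult intro: order_trans[OF norm_triangle_ineq])
    qed auto
    moreover have "\<dots> \<le> L2_set (\<lambda>k. cmod (b k)) {..N} + cmod a * L2_set sh {..N}"
      using L2_set_triangle_ineq[of "\<lambda>k. cmod (b k)" "\<lambda>k. cmod a * sh k" "{..N}"]
      by (simp add: L2_set_right_distrib)
    ultimately have "L2_set (\<lambda>k. cmod (s k)) {..N} * (1 - cmod a) \<le> D"
      using Db[of N] by (simp add: algebra_simps)
    then show ?thesis using a by (simp add: pos_le_divide_eq)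
  qed
  have "summable (\<lambda>k. (cmod (s k))\<^sup>2)"
  proof (rule summableI_nonneg_bounded[where x = "(D / (1 - cmod a))\<^sup>2"])
    fix N
    have "(\<Sum>k<N. (cmod (s k))\<^sup>2) \<le> (\<Sum>k\<le>N. (cmod (s k))\<^sup>2)" by (rule sum_mono2) auto
    also have "\<dots> = (L2_set (\<lambda>k. cmod (s k)) {..N})\<^sup>2" by (simp add: L2_set_def sum_nonneg)
    also have "\<dots> \<le> (D / (1 - cmod a))\<^sup>2" by (intro power_mono est L2_set_nonneg)
    finally show "(\<Sum>k<N. (cmod (s k))\<^sup>2) \<le> (D / (1 - cmod a))\<^sup>2" .
  qed auto
  then have l2s: "l2 (emb_coeff s)" by (simp add: l2_emb_coeff)
  define F where "F = fn2 (emb_coeff s)"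
  have F: "H2_2_coeffs (emb_coeff s) F" unfolding F_def by (rule fn2_coeffs[OF l2s])
  have "(\<lambda>i. emb_coeff s i + (- a) * shift1 (emb_coeff s) i) = emb_coeff b"
  proof
    fix i :: "nat \<times> nat"
    obtain j k where i: "i = (j, k)" by (cases i)
    show "emb_coeff s i + (- a) * shift1 (emb_coeff s) i = emb_coeff b i"
      unfolding i by (cases j) (auto simp: emb_coeff_def s)
  qed
  with H2_2_coeffs_add[OF F H2_2_coeffs_scale[OF H2_2_coeffs_Mz1[OF F], of "-a"]]
  have "H2_2_coeffs (emb_coeff b) (\<lambda>z1 z2. F z1 z2 + (- a) * Mz1 F z1 z2)" by simp
  then have eq: "(\<lambda>z1 z2. F z1 z2 + (- a) * Mz1 F z1 z2) = emb g"
    using emb_g H2_2_coeffs_imp_fn2 by metis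
  have "emb (\<lambda>z. if z \<in> disc then g z / (1 - a * z) else 0) = F"
  proof (intro ext)
    fix z1 z2
    show "emb (\<lambda>z. if z \<in> disc then g z / (1 - a * z) else 0) z1 z2 = F z1 z2"
    proof (cases "z1 \<in> disc \<and> z2 \<in> disc")
      case True
      have "cmod (a * z1) < 1" using mult_strict_mono'[of "cmod a" 1 "cmod z1" 1] a True by (simp add: norm_mult)
      then have "1 - a * z1 \<noteq> 0" by auto
      moreover have "F z1 z2 + (- a) * Mz1 F z1 z2 = emb g z1 z2" using eq by metis
      ultimately show ?thesis using True by (simp add: emb_def Mz1_def field_simps)
    next
      case False
      then show ?thesis by (auto simp: emb_def F_def fn2_def)
    qed
  qed
  then have "emb (\<lambda>z. if z \<in> disc then g z / (1 - a * z) else 0) \<in> H2_2"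
    unfolding F_def using fn2_H2_2[OF l2s] by simp
  then show ?thesis by (rule H2_1_emb) auto
qed

text \<open>A zero rho lies outside the closed disc and enters as a_i = conj(1/rho). If the degree
  falls short of m, entries a_i = 0 pad with factors 1; under reflection these become factors z, so
  the Blaschke degree is still m.\<close>

lemma poly_no_zeros_factorization:
  assumes "degree p \<le> m" "\<And>z. cmod z \<le> 1 \<Longrightarrow> poly p z \<noteq> 0"
  shows "\<exists>C a. C \<noteq> 0 \<and> (\<forall>i<m. a i \<in> disc) \<and> (\<forall>z. poly p z = C * (\<Prod>i<m. 1 - cnj (a i) * z))"
  using assms
proof (induction m arbitrary: p)
  case 0
  then obtain C where "p = [:C:]" by (metis degree_eq_zeroE le_zero_eq)
  with 0(2)[of 0] show ?case by auto
next
  case (Suc m)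
  show ?case
  proof (cases "degree p = 0")
    case True
    then obtain C where "p = [:C:]" by (metis degree_eq_zeroE)
    with Suc(3)[of 0] show ?thesis by (intro exI[of _ C] exI[of _ "\<lambda>_. 0"]) auto
  next
    case False
    then obtain \<rho> where \<rho>: "poly p \<rho> = 0" using alg_closed_imp_poly_has_root[of p] by auto
    with Suc(3)[of \<rho>] have \<rho>1: "cmod \<rho> > 1" by force
    then have \<rho>0: "\<rho> \<noteq> 0" by auto
    obtain s where s: "p = [:-\<rho>, 1:] * s" using \<rho> poly_eq_0_iff_dvd by blast
    have "s \<noteq> 0" using False s by auto
    then have "degree p = Suc (degree s)" unfolding s by (subst degree_mult_eq) auto
    then have "degree s \<le> m" using Suc.prems by simp
    moreover have "poly s z \<noteq> 0" if "cmod z \<le> 1" for z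
      using Suc(3)[OF that] by (auto simp: s)
    ultimately obtain C a where C: "C \<noteq> 0" "\<forall>i<m. a i \<in> disc"
      "\<And>z. poly s z = C * (\<Prod>i<m. 1 - cnj (a i) * z)" using Suc.IH by blast
    have "poly p z = (- \<rho> * C) * (\<Prod>i<Suc m. 1 - cnj ((a(m := cnj (1 / \<rho>))) i) * z)" for z
    proof -
      have "(\<Prod>i<m. 1 - cnj ((a(m := cnj (1 / \<rho>))) i) * z) = (\<Prod>i<m. 1 - cnj (a i) * z)"
        by (rule prod.cong) auto
      then show ?thesis using \<rho>0 by (simp add: s C(3) field_simps)
    qed
    moreover have "cnj (1 / \<rho>) \<in> disc" using \<rho>1 by (simp add: norm_divide divide_less_eq)
    then have "\<forall>i<Suc m. (a(m := cnj (1 / \<rho>))) i \<in> disc" using C(2) by (auto simp: less_Suc_eq)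
    moreover have "- \<rho> * C \<noteq> 0" using \<rho>0 C by simp
    ultimately show ?thesis by blast
  qed
qed

text \<open>Meant for P = p(., tau) and \<open>\<kappa>\<close> = tau^n; then \<open>B\<close> is
  the slice of \<open>\<Theta>\<close> at tau.\<close>

locale disc_polynomial =
  fixes m :: nat and b :: "nat \<Rightarrow> complex" and \<kappa> :: complex
  assumes nz_cdisc: "\<And>z. cmod z \<le> 1 \<Longrightarrow> (\<Sum>j\<le>m. b j * z ^ j) \<noteq> 0"
    and \<kappa>: "cmod \<kappa> = 1"
begin

definition P :: "complex \<Rightarrow> complex" where "P z = (\<Sum>j\<le>m. b j * z ^ j)"
definition R :: "complex \<Rightarrow> complex" where "R z = (\<Sum>j\<le>m. cnj (b (m - j)) * z ^ j)"
definition B :: "complex \<Rightarrow> complex" where "B z = \<kappa> * R z / P z"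

lemma P_nonzero: "cmod z \<le> 1 \<Longrightarrow> P z \<noteq> 0"
  using nz_cdisc by (simp add: P_def)

lemma factorization:
  obtains C a where "C \<noteq> 0" "\<And>i. i < m \<Longrightarrow> a i \<in> disc" "\<And>z. P z = C * (\<Prod>i<m. 1 - cnj (a i) * z)"
    "\<And>z. R z = cnj C * (\<Prod>i<m. z - a i)"
proof -
  define p where "p = (\<Sum>j\<le>m. monom (b j) j)"
  have p: "poly p z = P z" for z by (simp add: p_def P_def poly_sum poly_monom)
  have "degree p \<le> m" unfolding p_def by (intro degree_sum_le) (auto intro: order_trans[OF degree_monom_le])
  from poly_no_zeros_factorization[OF this] obtain C a where
    C: "C \<noteq> 0" "\<And>i. i < m \<Longrightarrow> a i \<in> disc" "\<And>z. P z = C * (\<Prod>i<m. 1 - cnj (a i) * z)"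
    using P_nonzero p by metis
  have Rnz: "R z = cnj C * (\<Prod>i<m. z - a i)" if z: "z \<noteq> 0" for z
  proof -
    have "R z = (\<Sum>j\<le>m. cnj (b j) * z ^ (m - j))"
      unfolding R_def by (rule sum.reindex_bij_witness[of _ "\<lambda>j. m - j" "\<lambda>j. m - j"]) auto
    also have "\<dots> = (\<Sum>j\<le>m. z ^ m * (cnj (b j) * (1 / z) ^ j))"
      using z by (intro sum.cong) (auto simp: power_diff power_one_over field_simps)
    also have "\<dots> = z ^ m * cnj (P (1 / cnj z))"
      by (simp add: P_def sum_distrib_left)
    also have "\<dots> = cnj C * (z ^ m * (\<Prod>i<m. 1 - a i * (1 / z)))"
      by (simp add: C(3))
    also have "z ^ m * (\<Prod>i<m. 1 - a i * (1 / z)) = (\<Prod>i<m. z * (1 - a i * (1 / z)))"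
      by (simp add: prod.distrib)
    also have "\<dots> = (\<Prod>i<m. z - a i)"
      using z by (intro prod.cong) (auto simp: field_simps)
    finally show ?thesis .
  qed
  \<comment> \<open>The reflection formula divides by z, so the value at 0 is reached by
    continuity.\<close>
  have "R 0 = cnj C * (\<Prod>i<m. 0 - a i)"
  proof (rule tendsto_unique[of "at 0"])
    have "continuous_on UNIV R" unfolding R_def by (intro continuous_intros)
    then show "(R \<longlongrightarrow> R 0) (at 0)" by (auto simp: continuous_on_def)
    have "continuous_on UNIV (\<lambda>z. cnj C * (\<Prod>i<m. z - a i))" by (intro continuous_intros)
    then have "((\<lambda>z. cnj C * (\<Prod>i<m. z - a i)) \<longlongrightarrow> cnj C * (\<Prod>i<m. 0 - a i)) (at 0)"
      unfolding continuous_on_def by (auto dest: spec[of _ 0])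
    then show "(R \<longlongrightarrow> cnj C * (\<Prod>i<m. 0 - a i)) (at 0)"
      by (rule Lim_transform_eventually) (auto simp: eventually_at_filter Rnz)
  qed auto
  then have "R z = cnj C * (\<Prod>i<m. z - a i)" for z using Rnz by (cases "z = 0") auto
  with C show thesis by (intro that)
qed

lemma blaschke_B: "blaschke_deg B m"
proof -
  obtain C a where C: "C \<noteq> 0" "\<And>i. i < m \<Longrightarrow> a i \<in> disc" "\<And>z. P z = C * (\<Prod>i<m. 1 - cnj (a i) * z)"
    "\<And>z. R z = cnj C * (\<Prod>i<m. z - a i)" by (rule factorization) blast
  have "B z = (\<kappa> * cnj C / C) * (\<Prod>i<m. (z - a i) / (1 - cnj (a i) * z))" for z
    by (simp add: B_def C(3,4) prod_dividef)
  moreover have "cmod (\<kappa> * cnj C / C) = 1" using C(1) \<kappa> by (simp add: norm_mult norm_divide)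
  ultimately show ?thesis using C(2) unfolding blaschke_deg_def by blast
qed

lemma H2_1_divide_P:
  assumes "g \<in> H2_1"
  shows "(\<lambda>z. if z \<in> disc then g z / P z else 0) \<in> H2_1"
proof -
  obtain C a where C: "C \<noteq> 0" "\<And>i. i < m \<Longrightarrow> a i \<in> disc" "\<And>z. P z = C * (\<Prod>i<m. 1 - cnj (a i) * z)"
    by (rule factorization) blast
  have "(\<lambda>z. if z \<in> disc then g z / (\<Prod>i<k. 1 - cnj (a i) * z) else 0) \<in> H2_1" if "k \<le> m" for k
    using that
  proof (induction k)
    case 0
    have "(\<lambda>z. if z \<in> disc then g z / (\<Prod>i<0. 1 - cnj (a i) * z) else 0) = g"
      using H2_1_outside[OF assms] by auto
    then show ?case using assms by simp
  next
    case (Suc k)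
    then have "(\<lambda>z. if z \<in> disc then (if z \<in> disc then g z / (\<Prod>i<k. 1 - cnj (a i) * z) else 0) / (1 - cnj (a k) * z) else 0) \<in> H2_1"
      using C(2)[of k] by (intro H2_1_divide_linear) auto
    moreover have "(\<lambda>z. if z \<in> disc then (if z \<in> disc then g z / (\<Prod>i<k. 1 - cnj (a i) * z) else 0) / (1 - cnj (a k) * z) else 0)
        = (\<lambda>z. if z \<in> disc then g z / (\<Prod>i<Suc k. 1 - cnj (a i) * z) else 0)"
      by (intro ext) simp
    ultimately show ?case by simp
  qed
  from H2_1_scale[OF this[OF order_refl], of "1 / C"]
  have "(\<lambda>z. 1 / C * (if z \<in> disc then g z / (\<Prod>i<m. 1 - cnj (a i) * z) else 0)) \<in> H2_1" .
  moreover have "(\<lambda>z. 1 / C * (if z \<in> disc then g z / (\<Prod>i<m. 1 - cnj (a i) * z) else 0))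
      = (\<lambda>z. if z \<in> disc then g z / P z else 0)"
    by (intro ext) (simp add: C(3))
  ultimately show ?thesis by simp
qed

definition q :: "(nat \<Rightarrow> complex) \<Rightarrow> complex \<Rightarrow> complex" where
  "q x = (\<lambda>z. if z \<in> disc then (\<Sum>j<m. x j * z ^ j) else 0)"

lemma q_coeffs: "H2_1_coeffs (\<lambda>j. if j < m then x j else 0) (q x)"
  unfolding H2_1_coeffs_def
proof (intro conjI ballI allI impI)
  show "summable (\<lambda>j. (cmod (if j < m then x j else 0))\<^sup>2)"
    by (rule summable_finite[of "{..<m}"]) auto
  fix z :: complex assume "z \<in> disc"
  moreover have "(\<lambda>j. (if j < m then x j else 0) * z ^ j) sums (\<Sum>j<m. (if j < m then x j else 0) * z ^ j)"
    by (rule sums_finite) auto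
  ultimately show "(\<lambda>j. (if j < m then x j else 0) * z ^ j) sums q x z" by (simp add: q_def)
qed (simp add: q_def)

lemma q_H2_1: "q x \<in> H2_1" unfolding H2_1_def using q_coeffs by blast

lemma q_divide_P: "(\<lambda>z. q x z / P z) \<in> H2_1"
proof -
  have "(\<lambda>z. q x z / P z) = (\<lambda>z. if z \<in> disc then q x z / P z else 0)"
    by (auto simp: q_def)
  then show ?thesis using H2_1_divide_P[OF q_H2_1] by metis
qed

lemma Mult1_B_emb:
  assumes "g \<in> H2_1"
  defines "g' \<equiv> \<lambda>z. if z \<in> disc then g z / P z else 0"
  shows "emb (Mult1 B g) = (\<lambda>z1 z2. \<kappa> * pmul m 0 (rc m 0 (\<lambda>j _. b j)) (emb g') z1 z2)"
    "Mult1 B g \<in> H2_1"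
proof -
  show 1: "emb (Mult1 B g) = (\<lambda>z1 z2. \<kappa> * pmul m 0 (rc m 0 (\<lambda>j _. b j)) (emb g') z1 z2)"
    by (intro ext) (auto simp: emb_def Mult1_def g'_def pmul_def pv_def rc_def B_def R_def)
  show "Mult1 B g \<in> H2_1"
  proof (rule H2_1_emb)
    show "emb (Mult1 B g) \<in> H2_2"
      unfolding 1 g'_def by (intro H2_2_scale pmul_H2_2 emb_H2_2 H2_1_divide_P assms(1))
  qed (simp add: Mult1_def)
qed

text \<open>\<open>inner2_refl\<close> with n = 0 turns the pairing of q/P with B g into that of q
  with z^m g/P, up to a constant; this vanishes because q has degree below m.\<close>

lemma q_divide_P_model1: "(\<lambda>z. q x z / P z) \<in> model1 B"
proof -
  define v where "v = (\<lambda>z. q x z / P z)"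
  have v: "v \<in> H2_1" unfolding v_def by (rule q_divide_P)
  have "inner1 v (Mult1 B g) = 0" if g: "g \<in> H2_1" for g
  proof -
    define g' where "g' = (\<lambda>z. if z \<in> disc then g z / P z else 0)"
    have g': "emb g' \<in> H2_2" unfolding g'_def by (intro emb_H2_2 H2_1_divide_P g)
    have pq: "pmul m 0 (\<lambda>j _. b j) (emb v) = emb (q x)"
      using P_nonzero by (intro ext) (auto simp: pmul_def pv_def emb_def v_def P_def[symmetric] q_def)
    have "inner1 v (Mult1 B g) = inner2 (emb v) (\<lambda>z1 z2. \<kappa> * pmul m 0 (rc m 0 (\<lambda>j _. b j)) (emb g') z1 z2)"
      using v g by (simp add: inner1_emb Mult1_B_emb g'_def)
    also have "\<dots> = cnj \<kappa> * inner2 (emb (q x)) (mm m 0 (emb g'))"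
      using g' v by (simp add: inner2_scale_right inner2_refl emb_H2_2 pq)
    also have "inner2 (emb (q x)) (mm m 0 (emb g')) = 0"
    proof -
      have z: "h2coef2 (emb (q x)) i * cnj (h2coef2 (mm m 0 (emb g')) i) = 0" for i
        using h2coef2_eqI[OF emb_coeffs[OF q_coeffs[of x]]]
        by (cases i) (auto simp: emb_coeff_def h2coef2_mm[OF g'])
      show ?thesis by (simp only: inner2_def z infsum_0_simp)
    qed
    finally show ?thesis by simp
  qed
  then show ?thesis using v unfolding model1_def v_def by blast
qed

text \<open>The factor 1 - z conj(w) has no zero in the disc, so the identity forces U to be the
  Szego kernel times 1 - B(z) conj(B(w)), and h is orthogonal to the part in B H^2.\<close>

lemma model1_reproducing:
  assumes h: "h \<in> model1 B" and w: "w \<in> disc" and U: "U \<in> H2_1"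
    "\<And>z. z \<in> disc \<Longrightarrow> (1 - z * cnj w) * U z = 1 - B z * cnj (B w)"
  shows "inner1 h U = h w"
proof -
  define k where "k = (\<lambda>z. szego2 w 0 z 0)"
  have emb_k: "emb k = szego2 w 0"
  proof (intro ext)
    fix z1 z2
    show "emb k z1 z2 = szego2 w 0 z1 z2"
    proof (cases "z1 \<in> disc \<and> z2 \<in> disc")
      case True
      then have "(1 - z1 * cnj w) * szego2 w 0 z1 z2 = 1" "(1 - z1 * cnj w) * szego2 w 0 z1 0 = 1"
        using szego2_eq[of w 0 z1] w by auto
      then have "szego2 w 0 z1 z2 = szego2 w 0 z1 0"
        by (metis mult_cancel_left mult_zero_left zero_neq_one)
      then show ?thesis using True by (simp add: emb_def k_def)
    next
      case False
      then show ?thesis by (auto simp: emb_def k_def szego2_def fn2_def)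
    qed
  qed
  have k: "k \<in> H2_1"
    by (rule H2_1_emb) (use w in \<open>auto simp: emb_k szego2_H2_2\<close>, simp add: k_def szego2_def fn2_def)
  have hH: "h \<in> H2_1" using h by (simp add: model1_def)
  have "U = (\<lambda>z. k z + (- cnj (B w)) * Mult1 B k z)"
  proof
    fix z
    show "U z = k z + (- cnj (B w)) * Mult1 B k z"
    proof (cases "z \<in> disc")
      case True
      have k1: "(1 - z * cnj w) * k z = 1" using szego2_eq[of w 0 z 0] w True by (simp add: k_def)
      then have "1 - z * cnj w \<noteq> 0" by auto
      moreover have "(1 - z * cnj w) * (k z + (- cnj (B w)) * Mult1 B k z)
          = ((1 - z * cnj w) * k z) * (1 - B z * cnj (B w))"
        using True by (simp add: Mult1_def algebra_simps)
      ultimately show ?thesis using U(2)[OF True] k1 by (metis mult_1 mult_cancel_left)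
    next
      case False
      then show ?thesis using H2_1_outside[OF U(1)] H2_1_outside[OF k] by (simp add: Mult1_def)
    qed
  qed
  then have "inner1 h U = inner1 h k + cnj (- cnj (B w)) * inner1 h (Mult1 B k)"
    using inner1_lincomb_right[OF k Mult1_B_emb(2)[OF k] hH] by metis
  also have "inner1 h (Mult1 B k) = 0" using h k by (simp add: model1_def)
  also have "inner1 h k = h w"
    using hH k w by (simp add: inner1_emb emb_k inner2_szego2 emb_H2_2) (simp add: emb_def)
  finally show ?thesis by simp
qed

lemma q_eq_0_imp:
  assumes "\<And>z. z \<in> disc \<Longrightarrow> q x z = 0" "j < m"
  shows "x j = 0"
proof -
  have "(if j < m then x j else 0) = 0"
    by (rule power_series_sums_0_coeff[where a="\<lambda>j. if j < m then x j else 0"])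
      (use q_coeffs[of x] assms(1) in \<open>auto simp: H2_1_coeffs_def\<close>)
  with assms(2) show ?thesis by simp
qed

text \<open>A sum of \<open>d \<le> m\<close> rank-one terms representing the kernel of the \<open>m\<close>-dimensional model space
  forces \<open>d = m\<close>, and the functions involved are an orthonormal basis.\<close>
lemma kernel_basis:
  fixes u :: "nat \<Rightarrow> complex \<Rightarrow> complex"
  assumes d: "d \<le> m" and u: "\<And>i. i < d \<Longrightarrow> \<exists>x. u i = (\<lambda>z. q x z / P z)"
    and ker: "\<And>z w. z \<in> disc \<Longrightarrow> w \<in> disc \<Longrightarrow>
      (1 - z * cnj w) * (\<Sum>i<d. cnj (u i w) * u i z) = 1 - B z * cnj (B w)"
  shows "d = m" "\<And>h. h \<in> model1 B \<Longrightarrow> h = (\<lambda>z. \<Sum>i<d. inner1 h (u i) * u i z)"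
    "\<And>i l. i < d \<Longrightarrow> l < d \<Longrightarrow> inner1 (u i) (u l) = (if i = l then 1 else 0)"
    "\<And>x. (\<lambda>z. \<Sum>i<d. x i * u i z) \<in> model1 B"
proof -
  have um: "u i \<in> model1 B" if "i < d" for i using u[OF that] q_divide_P_model1 by metis
  have uH: "u i \<in> H2_1" if "i < d" for i using um[OF that] by (simp add: model1_def)
  show exp: "h = (\<lambda>z. \<Sum>i<d. inner1 h (u i) * u i z)" if h: "h \<in> model1 B" for h
  proof
    fix w
    show "h w = (\<Sum>i<d. inner1 h (u i) * u i w)"
    proof (cases "w \<in> disc")
      case True
      have "h w = inner1 h (\<lambda>z. \<Sum>i<d. cnj (u i w) * u i z)"
        by (rule model1_reproducing[OF h True, symmetric]) (use uH ker True in \<open>auto intro: H2_1_sum\<close>)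
      also have "\<dots> = (\<Sum>i<d. inner1 h (u i) * u i w)"
        using uH h by (subst inner1_sum_right) (auto simp: model1_def mult.commute)
      finally show ?thesis .
    next
      case False
      have "h w = 0" using h False H2_1_outside by (simp add: model1_def)
      moreover have "u i w = 0" if "i < d" for i using uH[OF that] False by (rule H2_1_outside)
      ultimately show ?thesis by simp
    qed
  qed
  \<comment> \<open>The quotients z^j / P with j < m: independent members of the model space to
    count against.\<close>
  define v where "v j = (\<lambda>z. q (\<lambda>i. if i = j then 1 else 0) z / P z)" for j
  have vm: "v j \<in> model1 B" for j unfolding v_def by (rule q_divide_P_model1)
  have vx: "(\<Sum>j<m. x j * v j z) = q x z / P z" for x z
  proof -
    have "(\<Sum>j<m. x j * v j z) = (\<Sum>j<m. x j * q (\<lambda>i. if i = j then 1 else 0) z) / P z"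
      by (simp add: v_def sum_divide_distrib)
    also have "(\<Sum>j<m. x j * q (\<lambda>i. if i = j then 1 else 0) z) = q x z"
      by (auto simp: q_def if_distrib[of "\<lambda>x. x * _"] cong: if_cong intro!: sum.cong)
    finally show ?thesis .
  qed
  have indep: "x j = 0" if "\<And>z. (\<Sum>j<m. x j * v j z) = 0" "j < m" for x j
  proof (rule q_eq_0_imp[OF _ that(2)])
    fix z :: complex assume "z \<in> disc"
    then show "q x z = 0" using that(1)[of z] P_nonzero[of z] by (simp add: vx)
  qed
  have comb: "(\<Sum>j<m. x j * v j z) = (\<Sum>i<d. (\<Sum>j<m. x j * inner1 (v j) (u i)) * u i z)" for x z
  proof -
    have "(\<Sum>j<m. x j * v j z) = (\<Sum>j<m. \<Sum>i<d. x j * inner1 (v j) (u i) * u i z)"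
      by (subst exp[OF vm]) (simp add: sum_distrib_left mult.assoc)
    also have "\<dots> = (\<Sum>i<d. \<Sum>j<m. x j * inner1 (v j) (u i) * u i z)" by (rule sum.swap)
    finally show ?thesis by (simp add: sum_distrib_right)
  qed
  show "d = m"
  proof (rule ccontr)
    assume "d \<noteq> m"
    with d have "card {..<d} < card {..<m}" by simp
    then obtain x where x: "\<exists>j\<in>{..<m}. x j \<noteq> 0" "\<forall>i\<in>{..<d}. (\<Sum>j<m. x j * inner1 (v j) (u i)) = 0"
      using homogeneous_system[of "{..<d}" "{..<m}" "\<lambda>j i. inner1 (v j) (u i)"] by auto
    then have "(\<Sum>j<m. x j * v j z) = 0" for z by (simp add: comb)
    with indep x(1) show False by blast
  qed
  have uindep: "t i = 0" if t: "\<And>z. (\<Sum>i<d. t i * u i z) = 0" and i: "i < d" for t i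
  proof -
    \<comment> \<open>The additional unknown x_m multiplies the relation t. Since t sums to 0,
      independence of the v_j forces the other x_j to vanish; hence x_m is nonzero, and x_m t_i = 0
      gives t_i = 0.\<close>
    have "card {..<d} < card {..m}" using d by simp
    then obtain x where x: "\<exists>j\<in>{..m}. x j \<noteq> 0"
      "\<forall>i\<in>{..<d}. (\<Sum>j\<le>m. x j * (if j < m then inner1 (v j) (u i) else - t i)) = 0"
      using homogeneous_system[of "{..<d}" "{..m}" "\<lambda>j i. if j < m then inner1 (v j) (u i) else - t i"] by auto
    have x2: "(\<Sum>j<m. x j * inner1 (v j) (u i)) = x m * t i" if "i < d" for i
    proof -
      have "(\<Sum>j\<le>m. x j * (if j < m then inner1 (v j) (u i) else - t i)) =
          (\<Sum>j<m. x j * inner1 (v j) (u i)) - x m * t i"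
        by (simp add: lessThan_Suc_atMost[symmetric])
      with x(2) that show ?thesis by simp
    qed
    have "(\<Sum>j<m. x j * v j z) = x m * (\<Sum>i<d. t i * u i z)" for z
      unfolding comb sum_distrib_left by (intro sum.cong) (auto simp: x2)
    then have x0: "x j = 0" if "j < m" for j using indep[OF _ that] t by simp
    then have "x m \<noteq> 0" using x(1) by (metis atMost_iff le_neq_implies_less)
    moreover have "x m * t i = 0" using x2[OF i] x0 by simp
    ultimately show ?thesis by simp
  qed
  show "inner1 (u i) (u l) = (if i = l then 1 else 0)" if il: "i < d" "l < d" for i l
  proof -
    \<comment> \<open>The expansion of \<open>u i\<close> in the family is compared with the trivial
      one; independence turns equal sums into equal coefficients.\<close>
    have "(\<Sum>l<d. (inner1 (u i) (u l) - (if i = l then 1 else 0)) * u l z) = 0" for z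
    proof -
      have "(\<Sum>l<d. (inner1 (u i) (u l) - (if i = l then 1 else 0)) * u l z)
          = (\<Sum>l<d. inner1 (u i) (u l) * u l z) - (\<Sum>l<d. (if i = l then 1 else 0) * u l z)"
        by (simp add: left_diff_distrib sum_subtractf)
      also have "(\<Sum>l<d. inner1 (u i) (u l) * u l z) = u i z"
        using exp[OF um[OF il(1)]] by metis
      also have "(\<Sum>l<d. (if i = l then 1 else 0) * u l z) = u i z"
        using il by (simp add: if_distrib[of "\<lambda>x. x * _"] cong: if_cong)
      finally show ?thesis by simp
    qed
    from uindep[OF this il(2)] show ?thesis by simp
  qed
  show "(\<lambda>z. \<Sum>i<d. x i * u i z) \<in> model1 B" for x
  proof -
    have "inner1 (\<lambda>z. \<Sum>i<d. x i * u i z) (Mult1 B g) = 0" if g: "g \<in> H2_1" for g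
      using um uH g Mult1_B_emb(2)[OF g] by (subst inner1_sum_left) (auto simp: model1_def)
    then show ?thesis using uH by (auto simp: model1_def intro: H2_1_sum)
  qed
qed

end

section \<open>Slices of the wandering subspaces\<close>

definition swap2 :: "bifun \<Rightarrow> bifun" where
  "swap2 f = (\<lambda>z1 z2. f z2 z1)"

lemma swap2_swap2 [simp]: "swap2 (swap2 f) = f"
  by (simp add: swap2_def)

lemma H2_2_coeffs_swap2:
  assumes "H2_2_coeffs a f"
  shows "H2_2_coeffs (a \<circ> prod.swap) (swap2 f)"
proof -
  have s: "inj (prod.swap :: nat \<times> nat \<Rightarrow> _)" by (auto simp: inj_def)
  have r: "j \<in> range (prod.swap :: nat \<times> nat \<Rightarrow> _)" for j by (metis rangeI swap_swap)
  have m: "mon2 z1 z2 (prod.swap i) = mon2 z2 z1 i" for z1 z2 i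
    by (cases i) (simp add: mon2_def mult.commute)
  have l: "l2 (a \<circ> prod.swap) \<longleftrightarrow> l2 a"
    by (rule l2_reindex[OF s, symmetric]) (use r in auto)
  have h: "((\<lambda>i. (a \<circ> prod.swap) i * mon2 z1 z2 i) has_sum S) UNIV \<longleftrightarrow>
      ((\<lambda>i. a i * mon2 z2 z1 i) has_sum S) UNIV" for z1 z2 S
  proof -
    have "((\<lambda>i. a i * mon2 z2 z1 i) has_sum S) UNIV \<longleftrightarrow>
        ((\<lambda>i. (a \<circ> prod.swap) i * mon2 z2 z1 (prod.swap i)) has_sum S) UNIV"
      by (rule has_sum_reindex_mult[OF s]) (use r in auto)
    then show ?thesis by (simp only: m)
  qed
  show ?thesis
    using assms unfolding H2_2_coeffs_alt l h swap2_def by blast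
qed

lemma swap2_H2_2_I: "f \<in> H2_2 \<Longrightarrow> swap2 f \<in> H2_2"
  unfolding H2_2_def using H2_2_coeffs_swap2 by blast

lemma swap2_H2_2 [simp]: "swap2 f \<in> H2_2 \<longleftrightarrow> f \<in> H2_2"
  using swap2_H2_2_I[of f] swap2_H2_2_I[of "swap2 f"] by auto

lemma inner2_swap2:
  assumes "f \<in> H2_2" "g \<in> H2_2"
  shows "inner2 (swap2 f) (swap2 g) = inner2 f g"
proof -
  have c: "h2coef2 (swap2 f) = h2coef2 f \<circ> prod.swap" if "f \<in> H2_2" for f
    by (intro h2coef2_eqI H2_2_coeffs_swap2 H2_2_h2coef2 that)
  have "inner2 f g = (\<Sum>\<^sub>\<infinity>i. h2coef2 f (prod.swap i) * cnj ((h2coef2 g \<circ> prod.swap) i))"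
    unfolding inner2_ip
  proof (rule ip_reindex_right)
    fix j :: "nat \<times> nat" assume "j \<notin> range prod.swap"
    moreover have "j \<in> range prod.swap" by (metis rangeI swap_swap)
    ultimately show "h2coef2 g j = 0" by blast
  qed (auto simp: inj_def)
  then show ?thesis using assms by (simp add: inner2_ip ip_def c)
qed

lemma pv_swap: "pv n m (\<lambda>j k. c k j) z1 z2 = pv m n c z2 z1"
  unfolding pv_def by (subst sum.swap) (simp add: mult.commute)

lemma rif_swap: "rif n m (\<lambda>j k. c k j) = swap2 (rif m n c)"
proof -
  have "rc n m (\<lambda>j k. c k j) = (\<lambda>j k. rc m n c k j)" by (simp add: rc_def)
  then show ?thesis by (simp only: rif_def swap2_def pv_swap[of n m c] pv_swap[of n m "rc m n c"])
qed

lemma Mult2_swap2: "Mult2 (swap2 \<Theta>) (swap2 f) = swap2 (Mult2 \<Theta> f)"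
  by (intro ext) (simp add: Mult2_def swap2_def)

lemma Mz_swap2: "Mz1 (swap2 f) = swap2 (Mz2 f)" "Mz2 (swap2 f) = swap2 (Mz1 f)"
  by (simp_all add: Mz1_def Mz2_def swap2_def)

lemma mem_swap2_image: "f \<in> swap2 ` S \<longleftrightarrow> swap2 f \<in> S"
  by (metis image_iff swap2_swap2)

lemma model2_swap2: "f \<in> model2 (swap2 \<Theta>) \<longleftrightarrow> swap2 f \<in> model2 \<Theta>"
  if \<Theta>: "\<And>g. g \<in> H2_2 \<Longrightarrow> Mult2 \<Theta> g \<in> H2_2"
proof -
  have "inner2 f (Mult2 (swap2 \<Theta>) (swap2 g)) = inner2 (swap2 f) (Mult2 \<Theta> g)" if "f \<in> H2_2" "g \<in> H2_2" for f g
    using inner2_swap2[of "swap2 f" "Mult2 \<Theta> g"] that \<Theta>[OF that(2)] by (simp add: Mult2_swap2)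
  then show ?thesis
    unfolding model2_def using swap2_H2_2 by (simp, metis swap2_swap2)
qed

context agler
begin

lemma W1_swap2: "f \<in> wander Mz2 (swap2 ` S1) \<longleftrightarrow> swap2 f \<in> W1"
proof -
  have "inner2 f (Mz2 (swap2 g)) = inner2 (swap2 f) (Mz1 g)" if "swap2 f \<in> S1" "g \<in> S1" for g
    using inner2_swap2[of "swap2 f" "Mz1 g"] S_H2(1)[OF that(1)] S_H2(1)[OF that(2)]
    by (simp add: Mz_swap2 H2_2_Mz1)
  then show ?thesis
    by (auto simp: wander_def mem_swap2_image)
qed

text \<open>The two subspaces trade places together with m and n, so every fact on \<open>W2\<close>
  has a counterpart on \<open>W1\<close>.\<close>

lemma agler_swap: "agler n m (\<lambda>j k. c k j) (swap2 ` S2) (swap2 ` S1)"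
proof
  show "pv n m (\<lambda>j k. c k j) z1 z2 \<noteq> 0" if "z1 \<in> disc" "z2 \<in> disc" for z1 z2
    unfolding pv_swap[of n m c] by (rule nz[OF that(2,1)])
  show "inner2 (Mult2 (rif n m (\<lambda>j k. c k j)) f) (Mult2 (rif n m (\<lambda>j k. c k j)) g) = inner2 f g"
    if "f \<in> H2_2" "g \<in> H2_2" for f g
  proof -
    have 1: "Mult2 (rif n m (\<lambda>j k. c k j)) h = swap2 (Mult2 \<Theta> (swap2 h))" for h
      using Mult2_swap2[of \<Theta> "swap2 h"] by (simp only: rif_swap[of n m c] swap2_swap2)
    have "swap2 f \<in> H2_2" "swap2 g \<in> H2_2" using that by simp_all
    then show ?thesis
      using that inner2_swap2[of "swap2 f" "swap2 g"]
      unfolding 1 by (simp add: inner2_swap2 Mult2_H2 isom)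
  qed
  show "swap2 ` S2 \<subseteq> H2_2" "swap2 ` S1 \<subseteq> H2_2" using S_H2 by auto
  show "(\<lambda>_ _. 0) \<in> swap2 ` S2" "(\<lambda>_ _. 0) \<in> swap2 ` S1"
    using S1(2) S2(2) by (simp_all add: mem_swap2_image swap2_def)
  show "Mz1 f \<in> swap2 ` S2" if "f \<in> swap2 ` S2" for f
    using that S2(3) by (auto simp: Mz_swap2)
  show "Mz2 f \<in> swap2 ` S1" if "f \<in> swap2 ` S1" for f
    using that S1(3) by (auto simp: Mz_swap2)
  show "(\<lambda>z1 z2. f z1 z2 + g z1 z2) \<in> swap2 ` S2" if "f \<in> swap2 ` S2" "g \<in> swap2 ` S2" for f g
    using that S2(4)[of "swap2 f" "swap2 g"] unfolding mem_swap2_image by (simp add: swap2_def)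
  show "(\<lambda>z1 z2. f z1 z2 + g z1 z2) \<in> swap2 ` S1" if "f \<in> swap2 ` S1" "g \<in> swap2 ` S1" for f g
    using that S1(4)[of "swap2 f" "swap2 g"] unfolding mem_swap2_image by (simp add: swap2_def)
  show "(\<lambda>z1 z2. a * f z1 z2) \<in> swap2 ` S2" if "f \<in> swap2 ` S2" for f a
    using that S2(5)[of "swap2 f" a] unfolding mem_swap2_image by (simp add: swap2_def)
  show "(\<lambda>z1 z2. a * f z1 z2) \<in> swap2 ` S1" if "f \<in> swap2 ` S1" for f a
    using that S1(5)[of "swap2 f" a] unfolding mem_swap2_image by (simp add: swap2_def)
  show "inner2 f g = 0" if "f \<in> swap2 ` S2" "g \<in> swap2 ` S1" for f g
  proof -
    have "inner2 g f = 0"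
      using that orth[of "swap2 g" "swap2 f"] inner2_swap2[of "swap2 g" "swap2 f"]
        S_H2(1)[of "swap2 g"] S_H2(2)[of "swap2 f"]
      unfolding mem_swap2_image by simp
    then show ?thesis by (metis inner2_commute complex_cnj_zero)
  qed
  have "f \<in> model2 (swap2 \<Theta>) \<longleftrightarrow> f \<in> {\<lambda>z1 z2. f z1 z2 + g z1 z2 |f g. f \<in> swap2 ` S2 \<and> g \<in> swap2 ` S1}" for f
  proof -
    have "f \<in> model2 (swap2 \<Theta>) \<longleftrightarrow> (\<exists>g h. swap2 f = (\<lambda>z1 z2. g z1 z2 + h z1 z2) \<and> g \<in> S1 \<and> h \<in> S2)"
      using model2_swap2[OF Mult2_H2] decomp by simp
    also have "\<dots> \<longleftrightarrow> (\<exists>g h. f = (\<lambda>z1 z2. swap2 h z1 z2 + swap2 g z1 z2) \<and> g \<in> S1 \<and> h \<in> S2)"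
      unfolding swap2_def by (auto simp: fun_eq_iff add.commute)
    also have "\<dots> \<longleftrightarrow> f \<in> {\<lambda>z1 z2. f z1 z2 + g z1 z2 |f g. f \<in> swap2 ` S2 \<and> g \<in> swap2 ` S1}"
      by blast
    finally show ?thesis .
  qed
  then show "model2 (rif n m (\<lambda>j k. c k j)) = {\<lambda>z1 z2. f z1 z2 + g z1 z2 |f g. f \<in> swap2 ` S2 \<and> g \<in> swap2 ` S1}"
    unfolding rif_swap[of n m c] by blast
qed

text \<open>Inside the bidisk f is a polynomial over p, and this quotient is continuous at every
  boundary point where p does not vanish.\<close>

lemma W2_tendsto:
  assumes f: "f \<in> W2" and lim: "(a \<longlongrightarrow> \<zeta>1) F" "(b \<longlongrightarrow> \<zeta>2) F"
    and ev: "\<forall>\<^sub>F r in F. a r \<in> disc \<and> b r \<in> disc" and nz': "pv m n c \<zeta>1 \<zeta>2 \<noteq> 0"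
  shows "((\<lambda>r. f (a r) (b r)) \<longlongrightarrow>
    (\<Sum>j<m. \<Sum>k\<le>n. h2coef2 (pm f) (j,k) * (\<zeta>1 ^ j * \<zeta>2 ^ k)) / pv m n c \<zeta>1 \<zeta>2) F"
proof (rule Lim_transform_eventually)
  show "((\<lambda>r. (\<Sum>j<m. \<Sum>k\<le>n. h2coef2 (pm f) (j,k) * (a r ^ j * b r ^ k)) / pv m n c (a r) (b r)) \<longlongrightarrow>
    (\<Sum>j<m. \<Sum>k\<le>n. h2coef2 (pm f) (j,k) * (\<zeta>1 ^ j * \<zeta>2 ^ k)) / pv m n c \<zeta>1 \<zeta>2) F"
    using nz' unfolding pv_def by (intro tendsto_intros lim)
  show "\<forall>\<^sub>F r in F. (\<Sum>j<m. \<Sum>k\<le>n. h2coef2 (pm f) (j,k) * (a r ^ j * b r ^ k)) / pv m n c (a r) (b r) = f (a r) (b r)"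
    using ev
  proof eventually_elim
    case (elim r)
    then show ?case using W2_polynomial[OF f, of "a r" "b r"] nz[of "a r" "b r"] by (simp add: field_simps)
  qed
qed

lemma W1_basis:
  obtains d :: nat and v where "\<forall>i<d. v i \<in> W1"
    "\<forall>f\<in>W1. f = (\<lambda>z1 z2. \<Sum>i<d. inner2 f (v i) * v i z1 z2)"
proof -
  interpret sw: agler n m "\<lambda>j k. c k j" "swap2 ` S2" "swap2 ` S1" by (rule agler_swap)
  obtain d u where u: "sw.onb d u" "\<And>f. f \<in> sw.W2 \<Longrightarrow> f = (\<lambda>z1 z2. \<Sum>i<d. inner2 f (u i) * u i z1 z2)"
    by (rule sw.W2_basis) blast
  show thesis
  proof (rule that[of d "\<lambda>i. swap2 (u i)"])
    show uW: "\<forall>i<d. swap2 (u i) \<in> W1"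
      using u(1) unfolding sw.onb_def W1_swap2 by simp
    show "\<forall>f\<in>W1. f = (\<lambda>z1 z2. \<Sum>i<d. inner2 f (swap2 (u i)) * swap2 (u i) z1 z2)"
    proof
      fix f assume f: "f \<in> W1"
      have "inner2 (swap2 f) (u i) = inner2 f (swap2 (u i))" if "i < d" for i
        using inner2_swap2[of f "swap2 (u i)"] W1_D(2)[OF f] W1_D(2)[OF uW[rule_format, OF that]] by simp
      moreover have "swap2 f = (\<lambda>z1 z2. \<Sum>i<d. inner2 (swap2 f) (u i) * u i z1 z2)"
        by (rule u(2)) (use f in \<open>simp add: W1_swap2\<close>)
      ultimately have "swap2 f z2 z1 = (\<Sum>i<d. inner2 f (swap2 (u i)) * u i z2 z1)" for z1 z2
        by (metis (mono_tags, lifting) lessThan_iff sum.cong)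
      then have "f z1 z2 = (\<Sum>i<d. inner2 f (swap2 (u i)) * swap2 (u i) z1 z2)" for z1 z2
        by (simp add: swap2_def)
      then show "f = (\<lambda>z1 z2. \<Sum>i<d. inner2 f (swap2 (u i)) * swap2 (u i) z1 z2)"
        by (intro ext)
    qed
  qed
qed

lemma W1_convergent:
  assumes f: "f \<in> W1" and lim: "(a \<longlongrightarrow> \<zeta>1) F" "(b \<longlongrightarrow> \<zeta>2) F"
    and ev: "\<forall>\<^sub>F r in F. a r \<in> disc \<and> b r \<in> disc" and nz': "pv m n c \<zeta>1 \<zeta>2 \<noteq> 0"
  shows "\<exists>L. ((\<lambda>r. f (a r) (b r)) \<longlongrightarrow> L) F"
proof -
  interpret sw: agler n m "\<lambda>j k. c k j" "swap2 ` S2" "swap2 ` S1" by (rule agler_swap)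
  have "swap2 f \<in> sw.W2" using f by (simp add: W1_swap2)
  moreover have "\<forall>\<^sub>F r in F. b r \<in> disc \<and> a r \<in> disc" using ev by eventually_elim blast
  moreover have "pv n m (\<lambda>j k. c k j) \<zeta>2 \<zeta>1 \<noteq> 0" unfolding pv_swap[of n m c] by (rule nz')
  ultimately have "((\<lambda>r. swap2 f (b r) (a r)) \<longlongrightarrow>
      (\<Sum>j<n. \<Sum>k\<le>m. h2coef2 (sw.pm (swap2 f)) (j,k) * (\<zeta>2 ^ j * \<zeta>1 ^ k)) / pv n m (\<lambda>j k. c k j) \<zeta>2 \<zeta>1) F"
    by (rule sw.W2_tendsto[OF _ lim(2,1)])
  then show ?thesis unfolding swap2_def by blast
qed

text \<open>Hurwitz: the slice \<open>p(\<sqdot>,\<tau>)\<close> is a locally uniform limit of the zero-free slices \<open>p(\<sqdot>,r\<tau>)\<close>.\<close>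
lemma pv_slice_nonzero:
  assumes \<tau>: "\<tau> \<in> circle" and E: "\<And>\<tau>1. \<tau>1 \<in> circle \<Longrightarrow> pv m n c \<tau>1 \<tau> \<noteq> 0" and z: "cmod z \<le> 1"
  shows "pv m n c z \<tau> \<noteq> 0"
proof (cases "cmod z = 1")
  case True
  then show ?thesis using E by simp
next
  case False
  then have zd: "z \<in> disc" using z by simp
  define r where "r k = (1 - 1 / real (k + 2))" for k
  have r: "0 < r k" "r k < 1" for k by (auto simp: r_def field_simps)
  have rlim: "r \<longlonglongrightarrow> 1"
  proof -
    have "(\<lambda>k. 1 - 1 / real (k + 2)) \<longlonglongrightarrow> 1 - 0"
      by (intro tendsto_diff tendsto_const LIMSEQ_ignore_initial_segment[OF lim_1_over_n])
    then show ?thesis by (simp add: r_def[abs_def])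
  qed
  have r\<tau>: "of_real (r k) * \<tau> \<in> disc" for k
    using r[of k] \<tau> by (simp add: norm_mult)
  show ?thesis
  \<comment> \<open>Hurwitz's theorem needs a nonconstant limit. A constant slice equals its value
    at the boundary point 1, which \<open>E\<close> makes nonzero.\<close>
  proof (cases "(\<lambda>z. pv m n c z \<tau>) constant_on disc")
    case True
    then obtain x where x: "\<And>z. z \<in> disc \<Longrightarrow> pv m n c z \<tau> = x" by (auto simp: constant_on_def)
    have "pv m n c 1 \<tau> = x"
    proof (rule LIMSEQ_unique)
      have "(\<lambda>k. of_real (r k)) \<longlonglongrightarrow> (1::complex)" using tendsto_of_real[OF rlim] by simp
      then show "(\<lambda>k. pv m n c (of_real (r k)) \<tau>) \<longlonglongrightarrow> pv m n c 1 \<tau>"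
        unfolding pv_def by (intro tendsto_intros)
      have "pv m n c (of_real (r k)) \<tau> = x" for k by (rule x) (use r[of k] in simp)
      then show "(\<lambda>k. pv m n c (of_real (r k)) \<tau>) \<longlonglongrightarrow> x" by simp
    qed
    then show ?thesis using E[of 1] x[OF zd] by simp
  next
    case False
    show ?thesis
    proof (rule Hurwitz_no_zeros[of disc "\<lambda>k z. pv m n c z (of_real (r k) * \<tau>)" "\<lambda>z. pv m n c z \<tau>"])
      show "uniform_limit K (\<lambda>k z. pv m n c z (of_real (r k) * \<tau>)) (\<lambda>z. pv m n c z \<tau>) sequentially"
        if K: "compact K" "K \<subseteq> disc" for K
      proof (rule uniform_limitI)
        fix e :: real assume e: "e > 0"
        \<comment> \<open>Bounds the difference of the two slices on the whole closed disc at once,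
          because z^j tau^l has modulus at most 1 there.\<close>
        define \<delta> where "\<delta> k = (\<Sum>j\<le>m. \<Sum>l\<le>n. cmod (c j l) * \<bar>r k ^ l - 1\<bar>)" for k
        have "\<delta> \<longlonglongrightarrow> (\<Sum>j\<le>m. \<Sum>l\<le>n. cmod (c j l) * \<bar>1 ^ l - 1\<bar>)"
          unfolding \<delta>_def by (intro tendsto_intros rlim)
        then have "\<delta> \<longlonglongrightarrow> 0" by simp
        then have "\<forall>\<^sub>F k in sequentially. \<delta> k < e" using e by (rule order_tendstoD)
        then show "\<forall>\<^sub>F k in sequentially. \<forall>z\<in>K. dist (pv m n c z (of_real (r k) * \<tau>)) (pv m n c z \<tau>) < e"
        proof eventually_elim
          case (elim k)
          show ?case
          proof
            fix z assume "z \<in> K"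
            then have z: "cmod z \<le> 1" using K by auto
            have "pv m n c z (of_real (r k) * \<tau>) - pv m n c z \<tau>
                = (\<Sum>j\<le>m. \<Sum>l\<le>n. c j l * (z ^ j * \<tau> ^ l) * (of_real (r k) ^ l - 1))"
              unfolding pv_def by (simp add: sum_subtractf[symmetric] power_mult_distrib algebra_simps)
            also have "cmod \<dots> \<le> \<delta> k"
              unfolding \<delta>_def
            proof (intro sum_norm_le)
              fix j l
              have "cmod (of_real (r k) ^ l - 1) = \<bar>r k ^ l - 1\<bar>"
                by (metis norm_of_real of_real_1 of_real_diff of_real_power)
              moreover have "cmod (z ^ j * \<tau> ^ l) \<le> 1"
                using z \<tau> by (simp add: norm_mult norm_power power_le_one)
              ultimately show "cmod (c j l * (z ^ j * \<tau> ^ l) * (of_real (r k) ^ l - 1)) \<le> cmod (c j l) * \<bar>r k ^ l - 1\<bar>"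
                by (simp add: norm_mult mult_left_le mult_right_mono)
            qed
            finally show "dist (pv m n c z (of_real (r k) * \<tau>)) (pv m n c z \<tau>) < e"
              using elim by (simp add: dist_norm)
          qed
        qed
      qed
    qed (use False nz r\<tau> zd in \<open>auto intro: pv_holomorphic\<close>)
  qed
qed

theorem slice_theorem:
  assumes \<tau>: "\<tau> \<in> circle" and E: "\<And>\<tau>1. \<tau>1 \<in> circle \<Longrightarrow> pv m n c \<tau>1 \<tau> \<noteq> 0"
  shows "blaschke_deg (\<lambda>z. \<Theta> z \<tau>) m"
    "\<And>f z. f \<in> W2 \<Longrightarrow> z \<in> disc \<Longrightarrow> \<exists>L. ((\<lambda>r::real. f z (of_real r * \<tau>)) \<longlongrightarrow> L) (at_left 1)"
    "unitary_onto W2 (model1 (\<lambda>z. \<Theta> z \<tau>)) (\<lambda>f. slice_second f \<tau>)"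
    "has_dim2 W2 m"
proof -
  define b where "b j = (\<Sum>k\<le>n. c j k * \<tau> ^ k)" for j
  have pvb: "pv m n c z \<tau> = (\<Sum>j\<le>m. b j * z ^ j)" for z
    unfolding pv_def b_def by (auto intro!: sum.cong simp: sum_distrib_left sum_distrib_right mult_ac)
  interpret dp: disc_polynomial m b "\<tau> ^ n"
  proof
    show "(\<Sum>j\<le>m. b j * z ^ j) \<noteq> 0" if "cmod z \<le> 1" for z
      using pv_slice_nonzero[OF \<tau> E that] by (simp add: pvb)
    show "cmod (\<tau> ^ n) = 1" using \<tau> by (simp add: norm_power)
  qed
  have P: "dp.P z = pv m n c z \<tau>" for z by (simp add: dp.P_def pvb)
  have \<tau>1: "cnj \<tau> * \<tau> = 1"
    using \<tau> complex_norm_square[of \<tau>] by (simp add: mult.commute)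
  have B: "dp.B = (\<lambda>z. \<Theta> z \<tau>)"
  proof
    fix z
    \<comment> \<open>As tau is unimodular, tau^n conj(tau)^(n-k) = tau^k. Thus tau^n times the
      one-variable reflection of the slice is the slice of the two-variable reflection.\<close>
    have "\<tau> ^ n * dp.R z = (\<Sum>j\<le>m. \<Sum>k\<le>n. \<tau> ^ n * (cnj (c (m - j) k) * cnj \<tau> ^ k) * z ^ j)"
      by (simp add: dp.R_def b_def sum_distrib_left sum_distrib_right mult_ac)
    also have "\<dots> = (\<Sum>j\<le>m. \<Sum>k\<le>n. \<tau> ^ n * (cnj (c (m - j) (n - k)) * cnj \<tau> ^ (n - k)) * z ^ j)"
      by (intro sum.cong refl sum.reindex_bij_witness[of _ "\<lambda>j. n - j" "\<lambda>j. n - j"]) auto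
    also have "\<dots> = pv m n (rc m n c) z \<tau>"
      unfolding pv_def rc_def
    proof (intro sum.cong refl)
      fix j k assume "k \<in> {..n}"
      then have "\<tau> ^ n = \<tau> ^ k * \<tau> ^ (n - k)" by (simp add: power_add[symmetric])
      then have "\<tau> ^ n * cnj \<tau> ^ (n - k) = \<tau> ^ k * (cnj \<tau> * \<tau>) ^ (n - k)"
        by (simp add: power_mult_distrib mult_ac)
      then have "\<tau> ^ n * cnj \<tau> ^ (n - k) = \<tau> ^ k" by (simp add: \<tau>1)
      then show "\<tau> ^ n * (cnj (c (m - j) (n - k)) * cnj \<tau> ^ (n - k)) * z ^ j = cnj (c (m - j) (n - k)) * (z ^ j * \<tau> ^ k)"
        by (simp add: mult_ac)
    qed
    finally show "dp.B z = \<Theta> z \<tau>" by (simp add: dp.B_def rif_def P)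
  qed
  show "blaschke_deg (\<lambda>z. \<Theta> z \<tau>) m" using dp.blaschke_B by (simp add: B)
  have \<tau>lim: "((\<lambda>r::real. of_real r * \<tau>) \<longlongrightarrow> \<tau>) (at_left 1)"
    by (rule tendsto_eq_intros refl)+ simp
  have ev01: "\<forall>\<^sub>F r::real in at_left 1. r \<in> {0<..<1}"
    by (rule eventually_at_leftI[of 0]) auto
  have ev: "\<forall>\<^sub>F r::real in at_left 1. z \<in> disc \<and> of_real r * \<tau> \<in> disc" if "z \<in> disc" for z
    using ev01 by eventually_elim (use that \<tau> in \<open>auto simp: norm_mult\<close>)
  define x where "x f j = (\<Sum>k\<le>n. h2coef2 (pm f) (j,k) * \<tau> ^ k)" for f j
  have lim: "((\<lambda>r::real. f z (of_real r * \<tau>)) \<longlongrightarrow> dp.q (x f) z / dp.P z) (at_left 1)"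
    if f: "f \<in> W2" and z: "z \<in> disc" for f z
  proof -
    have "dp.q (x f) z = (\<Sum>j<m. \<Sum>k\<le>n. h2coef2 (pm f) (j,k) * (z ^ j * \<tau> ^ k))"
      using z by (simp add: dp.q_def x_def sum_distrib_left sum_distrib_right mult_ac)
    moreover have "pv m n c z \<tau> \<noteq> 0" using pv_slice_nonzero[OF \<tau> E] z by simp
    ultimately show ?thesis
      using W2_tendsto[OF f tendsto_const \<tau>lim ev[OF z]] by (simp add: P)
  qed
  then show "\<exists>L. ((\<lambda>r::real. f z (of_real r * \<tau>)) \<longlongrightarrow> L) (at_left 1)" if "f \<in> W2" "z \<in> disc" for f z
    using that by blast
  define J where "J f = slice_second f \<tau>" for f
  have J: "J f = (\<lambda>z. dp.q (x f) z / dp.P z)" if f: "f \<in> W2" for f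
  proof
    fix z
    show "J f z = dp.q (x f) z / dp.P z"
      unfolding J_def slice_second_def using tendsto_Lim[OF _ lim[OF f]] by (auto simp: dp.q_def)
  qed
  have Jlim: "((\<lambda>r::real. f z (of_real r * \<tau>)) \<longlongrightarrow> J f z) (at_left 1)" if "f \<in> W2" "z \<in> disc" for f z
    using lim[OF that] J[OF that(1)] by simp
  have Jout: "J f z = 0" if "z \<notin> disc" for f z using that by (simp add: J_def slice_second_def)
  obtain d u where u: "onb d u" and ue: "\<And>f. f \<in> W2 \<Longrightarrow> f = (\<lambda>z1 z2. \<Sum>i<d. inner2 f (u i) * u i z1 z2)"
    by (rule W2_basis) blast
  have uW: "u i \<in> W2" if "i < d" for i using u that by (simp add: onb_def)
  have uH: "u i \<in> H2_2" if "i < d" for i using uW[OF that] by (rule W2_D)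
  obtain d' :: nat and v where vW': "\<forall>i<d'. v i \<in> W1"
    and ve': "\<forall>f\<in>W1. f = (\<lambda>z1 z2. \<Sum>i<d'. inner2 f (v i) * v i z1 z2)"
    by (rule W1_basis) blast
  note vW = vW'[rule_format] and ve = bspec[OF ve']
  have decomposition: "1 - \<Theta> z1 z2 * cnj (\<Theta> w1 w2) =
      (1 - z2 * cnj w2) * (\<Sum>i<d'. cnj (v i w1 w2) * v i z1 z2)
      + (1 - z1 * cnj w1) * (\<Sum>i<d. cnj (u i w1 w2) * u i z1 z2)"
    if zw: "z1 \<in> disc" "z2 \<in> disc" "w1 \<in> disc" "w2 \<in> disc" for z1 z2 w1 w2
  proof -
    obtain K1 K2 where K: "K1 \<in> W1" "K2 \<in> W2"
      "\<And>f. f \<in> W1 \<Longrightarrow> inner2 f K1 = f w1 w2" "\<And>f. f \<in> W2 \<Longrightarrow> inner2 f K2 = f w1 w2"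
      "\<And>z1 z2. z1 \<in> disc \<Longrightarrow> z2 \<in> disc \<Longrightarrow> 1 - \<Theta> z1 z2 * cnj (\<Theta> w1 w2)
       = (1 - z2 * cnj w2) * K1 z1 z2 + (1 - z1 * cnj w1) * K2 z1 z2"
      by (rule agler_kernels[OF zw(3,4)]) blast
    have "K1 z1 z2 = (\<Sum>i<d'. inner2 K1 (v i) * v i z1 z2)"
      using ve[OF K(1)] by metis
    also have "\<dots> = (\<Sum>i<d'. cnj (v i w1 w2) * v i z1 z2)"
      using K(3)[OF vW] by (intro sum.cong refl arg_cong2[where f="(*)"]) (simp add: inner2_commute[of K1])
    finally have 1: "K1 z1 z2 = \<dots>" .
    have "K2 z1 z2 = (\<Sum>i<d. inner2 K2 (u i) * u i z1 z2)"
      using ue[OF K(2)] by metis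
    also have "\<dots> = (\<Sum>i<d. cnj (u i w1 w2) * u i z1 z2)"
      using K(4)[OF uW] by (intro sum.cong refl arg_cong2[where f="(*)"]) (simp add: inner2_commute[of K2])
    finally have 2: "K2 z1 z2 = \<dots>" .
    show ?thesis using K(5)[OF zw(1,2)] unfolding 1 2 .
  qed
  \<comment> \<open>At z2 = w2 = r tau the factor in front of the \<open>W1\<close> kernel is 1 -
    r^2. That kernel is a finite sum of terms which converge by \<open>W1_convergent\<close>, so the
    product tends to 0.\<close>
  have ker: "(1 - z * cnj w) * (\<Sum>i<d. cnj (J (u i) w) * J (u i) z) = 1 - dp.B z * cnj (dp.B w)"
    if zw: "z \<in> disc" "w \<in> disc" for z w
  proof -
    have Vex: "\<exists>L. ((\<lambda>r::real. v i z (of_real r * \<tau>)) \<longlongrightarrow> L) (at_left 1)" if "i < d'" "z \<in> disc" for i z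
      by (rule W1_convergent[OF vW[OF that(1)] tendsto_const \<tau>lim ev[OF that(2)]])
        (use pv_slice_nonzero[OF \<tau> E, of z] that in simp)
    define V where "V i z = Lim (at_left 1) (\<lambda>r::real. v i z (of_real r * \<tau>))" for i z
    have V: "((\<lambda>r::real. v i z (of_real r * \<tau>)) \<longlongrightarrow> V i z) (at_left 1)" if "i < d'" "z \<in> disc" for i z
      using Vex[OF that] tendsto_Lim[of "at_left (1::real)"] unfolding V_def by (metis trivial_limit_at_left_real)
    have \<Theta>lim: "((\<lambda>r::real. \<Theta> z (of_real r * \<tau>)) \<longlongrightarrow> \<Theta> z \<tau>) (at_left 1)" if "z \<in> disc" for z
      unfolding rif_def pv_def
      by (intro tendsto_intros \<tau>lim) (use pv_slice_nonzero[OF \<tau> E, of z] that in \<open>simp add: pv_def\<close>)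
    let ?\<tau> = "\<lambda>r::real. of_real r * \<tau>"
    let ?l = "\<lambda>r. 1 - \<Theta> z (?\<tau> r) * cnj (\<Theta> w (?\<tau> r))"
    let ?r = "\<lambda>r. (1 - ?\<tau> r * cnj (?\<tau> r)) * (\<Sum>i<d'. cnj (v i w (?\<tau> r)) * v i z (?\<tau> r))
        + (1 - z * cnj w) * (\<Sum>i<d. cnj (u i w (?\<tau> r)) * u i z (?\<tau> r))"
    let ?lim = "(1 - \<tau> * cnj \<tau>) * (\<Sum>i<d'. cnj (V i w) * V i z)
        + (1 - z * cnj w) * (\<Sum>i<d. cnj (J (u i) w) * J (u i) z)"
    have L: "(?l \<longlongrightarrow> 1 - \<Theta> z \<tau> * cnj (\<Theta> w \<tau>)) (at_left 1)"
      by (intro tendsto_intros \<Theta>lim zw)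
    have R: "(?r \<longlongrightarrow> ?lim) (at_left 1)"
      by (intro tendsto_intros \<tau>lim V Jlim uW zw) auto
    have "1 - \<Theta> z \<tau> * cnj (\<Theta> w \<tau>) = ?lim"
    proof (rule tendsto_unique[OF _ L])
      have "\<forall>\<^sub>F r in at_left 1. ?r r = ?l r"
        using ev[OF zw(1)] by eventually_elim (use decomposition zw in simp)
      with R show "(?l \<longlongrightarrow> ?lim) (at_left 1)" by (rule Lim_transform_eventually)
    qed simp
    then show ?thesis using \<tau>1 by (simp add: B mult.commute[of \<tau>])
  qed
  have d: "d \<le> m" using u by (rule onb_le)
  note kb = dp.kernel_basis[where d=d and u="\<lambda>i. J (u i)", OF d]
  have kb1: "d = m" by (rule kb(1), use J uW in blast, rule ker)
  have kb2: "h = (\<lambda>z. \<Sum>i<d. inner1 h (J (u i)) * J (u i) z)" if "h \<in> model1 dp.B" for h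
    by (rule kb(2)[OF _ _ that], use J uW in blast, rule ker)
  have kb3: "inner1 (J (u i)) (J (u l)) = (if i = l then 1 else 0)" if "i < d" "l < d" for i l
    by (rule kb(3)[OF _ _ that], use J uW in blast, rule ker)
  have kb4: "(\<lambda>z. \<Sum>i<d. x i * J (u i) z) \<in> model1 dp.B" for x
    by (rule kb(4), use J uW in blast, rule ker)
  have JH: "J (u i) \<in> H2_1" if "i < d" for i
    using J[OF uW[OF that]] dp.q_divide_P by simp
  have comb: "(\<lambda>z1 z2. \<Sum>i<d. y i * u i z1 z2) \<in> W2" for y
    by (intro W2_sum W2_scale uW) auto
  have inner_comb: "inner2 (\<lambda>z1 z2. \<Sum>i<d. y i * u i z1 z2) (u l) = y l" if l: "l < d" for y l
  proof -
    have "inner2 (\<lambda>z1 z2. \<Sum>i<d. y i * u i z1 z2) (u l) = (\<Sum>i<d. y i * inner2 (u i) (u l))"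
      by (subst inner2_sum_left) (auto intro!: H2_2_scale uH l sum.cong simp: inner2_scale_left uH)
    also have "\<dots> = (\<Sum>i<d. y i * (if i = l then 1 else 0))"
      using u l by (intro sum.cong refl) (auto simp: onb_def)
    also have "\<dots> = y l" using l by (simp add: if_distrib[where f="\<lambda>y. _ * y"] cong: if_cong)
    finally show ?thesis .
  qed
  have Jcomb: "J (\<lambda>z1 z2. \<Sum>i<d. y i * u i z1 z2) = (\<lambda>z. \<Sum>i<d. y i * J (u i) z)" for y
  proof
    fix z
    show "J (\<lambda>z1 z2. \<Sum>i<d. y i * u i z1 z2) z = (\<Sum>i<d. y i * J (u i) z)"
    proof (cases "z \<in> disc")
      case True
      have "((\<lambda>r::real. \<Sum>i<d. y i * u i z (of_real r * \<tau>)) \<longlongrightarrow> (\<Sum>i<d. y i * J (u i) z)) (at_left 1)"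
        by (intro tendsto_intros Jlim uW True) auto
      from tendsto_unique[OF _ Jlim[OF comb True] this] show ?thesis by simp
    qed (simp add: Jout)
  qed
  have Jexp: "J f = (\<lambda>z. \<Sum>i<d. inner2 f (u i) * J (u i) z)" if "f \<in> W2" for f
    by (subst ue[OF that]) (rule Jcomb)
  show "unitary_onto W2 (model1 (\<lambda>z. \<Theta> z \<tau>)) (\<lambda>f. slice_second f \<tau>)"
    unfolding unitary_onto_def B[symmetric] J_def[symmetric]
  proof (intro conjI ballI allI)
    show "J ` W2 = model1 dp.B"
    proof (intro equalityI subsetI)
      fix h assume "h \<in> J ` W2"
      then show "h \<in> model1 dp.B" using Jexp kb4 by fastforce
    next
      fix h assume h: "h \<in> model1 dp.B"
      have "h = J (\<lambda>z1 z2. \<Sum>i<d. inner1 h (J (u i)) * u i z1 z2)"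
        unfolding Jcomb by (rule kb2[OF h])
      then show "h \<in> J ` W2" using comb[of "\<lambda>i. inner1 h (J (u i))"] by (rule image_eqI)
    qed
    fix f g assume fg: "f \<in> W2" "g \<in> W2"
    show "J (\<lambda>z1 z2. a * f z1 z2 + b * g z1 z2) = (\<lambda>z. a * J f z + b * J g z)" for a b
    proof -
      have "(\<lambda>z1 z2. a * f z1 z2 + b * g z1 z2) \<in> W2" by (intro W2_add W2_scale fg)
      then have "J (\<lambda>z1 z2. a * f z1 z2 + b * g z1 z2)
          = (\<lambda>z. \<Sum>i<d. (a * inner2 f (u i) + b * inner2 g (u i)) * J (u i) z)"
        using fg uH by (subst Jexp) (auto intro!: ext sum.cong simp: inner2_add_left inner2_scale_left H2_2_scale W2_D)
      then show ?thesis
        using fg by (simp add: Jexp distrib_right sum.distrib sum_distrib_left mult.assoc)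
    qed
    have "inner1 (J f) (J g) = (\<Sum>i<d. inner2 f (u i) * inner1 (J (u i)) (J g))"
      using JH kb4[of "\<lambda>i. inner2 g (u i)"]
      by (subst Jexp[OF fg(1)], subst inner1_sum_left) (auto simp: Jexp[OF fg(2)] model1_def)
    also have "\<dots> = (\<Sum>i<d. inner2 f (u i) * cnj (inner2 g (u i)))"
    proof (intro sum.cong refl arg_cong2[where f="(*)"])
      fix i assume i: "i \<in> {..<d}"
      have "inner1 (J (u i)) (J g) = (\<Sum>l<d. cnj (inner2 g (u l)) * inner1 (J (u i)) (J (u l)))"
        using JH i by (subst Jexp[OF fg(2)], subst inner1_sum_right) auto
      also have "\<dots> = (\<Sum>l<d. cnj (inner2 g (u l)) * (if i = l then 1 else 0))"
        using i by (intro sum.cong refl) (simp add: kb3)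
      also have "\<dots> = cnj (inner2 g (u i))"
        using i by (simp add: if_distrib[where f="\<lambda>y. _ * y"] cong: if_cong)
      finally show "inner1 (J (u i)) (J g) = cnj (inner2 g (u i))" .
    qed
    also have "\<dots> = inner2 f g"
    proof -
      have "inner2 f g = (\<Sum>i<d. inner2 f (u i) * inner2 (u i) g)"
        by (subst ue[OF fg(1)], subst inner2_sum_left)
          (auto intro!: H2_2_scale uH W2_D(2)[OF fg(2)] sum.cong simp: inner2_scale_left uH)
      then show ?thesis by (simp add: inner2_commute[of _ g])
    qed
    finally show "inner1 (J f) (J g) = inner2 f g" .
  qed
  show "has_dim2 W2 m"
    unfolding has_dim2_def kb1[symmetric]
  proof (intro exI[of _ u] conjI allI impI ballI)
    fix y i assume 0: "(\<lambda>z1 z2. \<Sum>i<d. y i * u i z1 z2) = (\<lambda>_ _. 0)" and i: "i < d"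
    show "y i = 0" using inner_comb[OF i, of y] unfolding 0 by simp
  next
    fix f assume "f \<in> W2"
    then show "\<exists>y. f = (\<lambda>z1 z2. \<Sum>i<d. y i * u i z1 z2)"
      by (intro exI[of _ "\<lambda>i. inner2 f (u i)"] ue)
  qed (rule uW)
qed

end

section \<open>Bivariate polynomials\<close>

lemma poly_eq_sum_le:
  fixes q :: "'a::comm_semiring_1 poly"
  assumes "\<And>j. j > m \<Longrightarrow> coeff q j = 0"
  shows "poly q x = (\<Sum>j\<le>m. coeff q j * x ^ j)"
proof -
  have "degree q \<le> m" using assms by (intro degree_le) auto
  then show ?thesis
    unfolding poly_altdef by (intro sum.mono_neutral_left) (auto simp: coeff_eq_0)
qed

lemma eval2_alt: "eval2 p z1 z2 = poly (map_poly (\<lambda>q. poly q z1) p) z2"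
  "coeff (map_poly (\<lambda>q. poly q z1) p) k = poly (coeff p k) z1"
  by (simp_all add: eval2_def coeff_map_poly)

lemma eval2_eq_pv:
  assumes "\<And>k. k > n \<Longrightarrow> coeff p k = 0" "\<And>j k. j > m \<Longrightarrow> coef2 p j k = 0"
  shows "eval2 p z1 z2 = pv m n (coef2 p) z1 z2"
proof -
  have "eval2 p z1 z2 = (\<Sum>k\<le>n. poly (coeff p k) z1 * z2 ^ k)"
    unfolding eval2_alt(1) by (subst poly_eq_sum_le[of n]) (use assms(1) in \<open>auto simp: eval2_alt(2)\<close>)
  also have "\<dots> = (\<Sum>k\<le>n. (\<Sum>j\<le>m. coef2 p j k * z1 ^ j) * z2 ^ k)"
    using assms(2) by (simp add: poly_eq_sum_le[of m] coef2_def)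
  also have "\<dots> = (\<Sum>k\<le>n. \<Sum>j\<le>m. coef2 p j k * (z1 ^ j * z2 ^ k))"
    by (simp add: sum_distrib_right mult.assoc)
  also have "\<dots> = pv m n (coef2 p) z1 z2"
    unfolding pv_def by (rule sum.swap)
  finally show ?thesis .
qed

lemma coef2_refl2: "coef2 (refl2 m n p) j k = (if j \<le> m \<and> k \<le> n then rc m n (coef2 p) j k else 0)"
  by (auto simp: coef2_def refl2_def rc_def nth_default_def simp del: upt_Suc)

lemma eval2_refl2: "eval2 (refl2 m n p) z1 z2 = pv m n (rc m n (coef2 p)) z1 z2"
proof -
  have "eval2 (refl2 m n p) z1 z2 = pv m n (coef2 (refl2 m n p)) z1 z2"
  proof (rule eval2_eq_pv)
    show "coeff (refl2 m n p) k = 0" if "k > n" for k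
      using that by (simp add: refl2_def nth_default_def del: upt_Suc)
  qed (simp add: coef2_refl2)
  then show ?thesis by (simp add: pv_def coef2_refl2)
qed

lemma eval2_pv:
  assumes "deg1 p \<le> m" "deg2 p \<le> n"
  shows "eval2 p z1 z2 = pv m n (coef2 p) z1 z2"
proof (rule eval2_eq_pv)
  show 1: "coeff p k = 0" if "k > n" for k
    using that assms(2) by (simp add: deg2_def coeff_eq_0)
  show "coef2 p j k = 0" if j: "j > m" for j k
  proof (cases "k \<le> degree p")
    case True
    then have "degree (coeff p k) \<le> deg1 p"
      unfolding deg1_def by (intro Max_ge) auto
    then show ?thesis using j assms(1) by (simp add: coef2_def coeff_eq_0)
  qed (simp add: coef2_def coeff_eq_0)
qed

lemma RIF_eq_rif:
  assumes "deg1 p \<le> m" "deg2 p \<le> n"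
  shows "RIF m n p = rif m n (coef2 p)"
  by (intro ext) (simp add: RIF_def rif_def eval2_refl2 eval2_pv[OF assms])

text \<open>Serves to show that zeros of p on the torus are also zeros of its reflection.\<close>

lemma pv_refl_torus:
  assumes "z1 \<in> circle" "z2 \<in> circle"
  shows "pv m n (rc m n c) z1 z2 = z1 ^ m * z2 ^ n * cnj (pv m n c z1 z2)"
proof -
  have u: "z * cnj z = 1" if "z \<in> circle" for z
    using that complex_norm_square[of z] by simp
  have pw: "z ^ m * cnj z ^ (m - j) = z ^ j" if "z \<in> circle" "j \<le> m" for z j m
  proof -
    have "z ^ m = z ^ j * z ^ (m - j)" using that by (simp add: power_add[symmetric])
    then have "z ^ m * cnj z ^ (m - j) = z ^ j * (z * cnj z) ^ (m - j)"
      by (simp add: power_mult_distrib mult_ac)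
    then show ?thesis by (simp add: u[OF that(1)])
  qed
  have "z1 ^ m * z2 ^ n * cnj (pv m n c z1 z2)
      = (\<Sum>j\<le>m. \<Sum>k\<le>n. cnj (c j k) * ((z1 ^ m * cnj z1 ^ j) * (z2 ^ n * cnj z2 ^ k)))"
    by (simp add: pv_def sum_distrib_left mult_ac)
  also have "\<dots> = (\<Sum>j\<le>m. \<Sum>k\<le>n. cnj (c (m - j) k) * ((z1 ^ m * cnj z1 ^ (m - j)) * (z2 ^ n * cnj z2 ^ k)))"
    by (rule sum.reindex_bij_witness[of _ "\<lambda>j. m - j" "\<lambda>j. m - j"]) auto
  also have "\<dots> = (\<Sum>j\<le>m. \<Sum>k\<le>n. cnj (c (m - j) (n - k)) * ((z1 ^ m * cnj z1 ^ (m - j)) * (z2 ^ n * cnj z2 ^ (n - k))))"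
    by (intro sum.cong refl sum.reindex_bij_witness[of _ "\<lambda>j. n - j" "\<lambda>j. n - j"]) auto
  also have "\<dots> = pv m n (rc m n c) z1 z2"
    unfolding pv_def rc_def using assms by (intro sum.cong refl) (simp add: pw)
  finally show ?thesis ..
qed

section \<open>Existence of slices without zeros on the circle\<close>

lemma infinite_circle: "infinite circle"
proof
  assume fin: "finite circle"
  have "connected circle" by (rule connected_sphere) simp
  then have "circle = {} \<or> (\<exists>a. circle = {a})" using fin connected_finite_iff_sing by blast
  moreover have "1 \<in> circle" "-1 \<in> circle" by auto
  ultimately show False by (metis empty_iff one_neq_neg_one singletonD)
qed

text \<open>A common zero \<open>(z\<^sub>1, z\<^sub>2)\<close> of \<open>p\<close> and \<open>q\<close> has \<open>r(z\<^sub>1) = 0\<close>; were every \<open>z\<^sub>2\<close> on the circle hit, then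
  some \<open>z\<^sub>1 - \<tau>\<^sub>1\<close> would divide both.\<close>
lemma exists_good_slices:
  assumes bez: "a * p + b * q = [:r:]" "r \<noteq> 0" and cop: "coprime p q"
    and common: "\<And>z1 z2. z1 \<in> circle \<Longrightarrow> z2 \<in> circle \<Longrightarrow> eval2 p z1 z2 = 0 \<Longrightarrow> eval2 q z1 z2 = 0"
  shows "\<exists>\<tau>\<in>circle. \<forall>\<tau>2\<in>circle. eval2 p \<tau> \<tau>2 \<noteq> 0" "\<exists>\<tau>\<in>circle. \<forall>\<tau>1\<in>circle. eval2 p \<tau>1 \<tau> \<noteq> 0"
proof -
  have r0: "poly r z1 = 0" if "z1 \<in> circle" "z2 \<in> circle" "eval2 p z1 z2 = 0" for z1 z2
  proof -
    have "poly r z1 = eval2 (a * p + b * q) z1 z2" unfolding bez by (simp add: eval2_pCons eval2_0)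
    also have "\<dots> = 0" using that common by (simp add: eval2_add eval2_mult)
    finally show ?thesis .
  qed
  have fin: "finite {z. poly r z = 0}" by (rule poly_roots_finite[OF bez(2)])
  then obtain \<tau> where "\<tau> \<in> circle" "poly r \<tau> \<noteq> 0"
    using infinite_circle by (metis (mono_tags, lifting) finite_subset mem_Collect_eq subsetI)
  then show "\<exists>\<tau>\<in>circle. \<forall>\<tau>2\<in>circle. eval2 p \<tau> \<tau>2 \<noteq> 0" using r0 by blast
  show "\<exists>\<tau>\<in>circle. \<forall>\<tau>1\<in>circle. eval2 p \<tau>1 \<tau> \<noteq> 0"
  proof (rule ccontr)
    assume "\<not> ?thesis"
    then obtain f where f: "\<And>\<tau>. \<tau> \<in> circle \<Longrightarrow> f \<tau> \<in> circle \<and> eval2 p (f \<tau>) \<tau> = 0" by metis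
    have "f ` circle \<subseteq> {z. poly r z = 0}" using f r0 by blast
    then have "finite (f ` circle)" using fin finite_subset by blast
    \<comment> \<open>The partners under \<open>f\<close> are among the finitely many roots of r, so
      one of them serves infinitely many points of the circle.\<close>
    then obtain \<tau>0 where \<tau>0: "\<tau>0 \<in> circle" "infinite {\<tau>\<in>circle. f \<tau> = f \<tau>0}"
      using pigeonhole_infinite[OF infinite_circle] by blast
    define \<tau>1 where "\<tau>1 = f \<tau>0"
    have dvd: "[:[:-\<tau>1, 1:]:] dvd s" if s: "\<And>\<tau>. \<tau> \<in> circle \<Longrightarrow> f \<tau> = \<tau>1 \<Longrightarrow> eval2 s \<tau>1 \<tau> = 0" for s
    proof -
      \<comment> \<open>A polynomial in z2 with infinitely many zeros is 0, so
        \<open>\<tau>1\<close> is a root of every coefficient of s, and z1 - \<open>\<tau>1\<close>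
        divides s.\<close>
      have "map_poly (\<lambda>q. poly q \<tau>1) s = 0"
      proof (rule ccontr)
        assume "map_poly (\<lambda>q. poly q \<tau>1) s \<noteq> 0"
        then have "finite {\<tau>. poly (map_poly (\<lambda>q. poly q \<tau>1) s) \<tau> = 0}" by (rule poly_roots_finite)
        moreover have "{\<tau>\<in>circle. f \<tau> = f \<tau>0} \<subseteq> {\<tau>. poly (map_poly (\<lambda>q. poly q \<tau>1) s) \<tau> = 0}"
          using s by (auto simp: \<tau>1_def eval2_alt(1))
        ultimately show False using \<tau>0(2) finite_subset by blast
      qed
      then have "poly (coeff s k) \<tau>1 = 0" for k by (metis coeff_0 eval2_alt(2))
      then show ?thesis by (simp add: const_poly_dvd_iff poly_eq_0_iff_dvd)
    qed
    have "[:[:-\<tau>1, 1:]:] dvd p" "[:[:-\<tau>1, 1:]:] dvd q"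
      using f common by (auto intro!: dvd)
    then have "[:[:-\<tau>1, 1:]:] dvd 1" using cop coprime_common_divisor by blast
    then show False by (auto simp: is_unit_const_poly_iff is_unit_poly_iff)
  qed
qed

section \<open>Transport back along the exchange of variables, and conclusion\<close>

lemma unitary_onto_swap2:
  assumes "unitary_onto (swap2 ` S) K J" "S \<subseteq> H2_2"
  shows "unitary_onto S K (\<lambda>f. J (swap2 f))"
proof -
  have "J (swap2 (\<lambda>z1 z2. a * f z1 z2 + b * g z1 z2)) = (\<lambda>z. a * J (swap2 f) z + b * J (swap2 g) z)"
    if "f \<in> S" "g \<in> S" for f g a b
  proof -
    have "swap2 (\<lambda>z1 z2. a * f z1 z2 + b * g z1 z2) = (\<lambda>z1 z2. a * swap2 f z1 z2 + b * swap2 g z1 z2)"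
      by (simp add: swap2_def)
    then show ?thesis using assms(1) that unfolding unitary_onto_def by simp
  qed
  moreover have "inner1 (J (swap2 f)) (J (swap2 g)) = inner2 f g" if "f \<in> S" "g \<in> S" for f g
    using assms that inner2_swap2[of f g] unfolding unitary_onto_def by auto
  moreover have "(\<lambda>f. J (swap2 f)) ` S = K"
    using assms(1) unfolding unitary_onto_def by (simp add: image_image)
  ultimately show ?thesis unfolding unitary_onto_def by simp
qed

lemma has_dim2_swap2:
  assumes "has_dim2 (swap2 ` S) d"
  shows "has_dim2 S d"
proof -
  obtain b where b': "(\<forall>i<d. b i \<in> swap2 ` S) \<and>
      (\<forall>c. (\<lambda>z1 z2. \<Sum>i<d. c i * b i z1 z2) = (\<lambda>_ _. 0) \<longrightarrow> (\<forall>i<d. c i = 0)) \<and>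
      (\<forall>f\<in>swap2 ` S. \<exists>c. f = (\<lambda>z1 z2. \<Sum>i<d. c i * b i z1 z2))"
    using assms unfolding has_dim2_def by (rule exE)
  note b = b'[THEN conjunct1, rule_format] b'[THEN conjunct2, THEN conjunct1, rule_format]
    b'[THEN conjunct2, THEN conjunct2, rule_format]
  show ?thesis
    unfolding has_dim2_def
  proof (intro exI[of _ "\<lambda>i. swap2 (b i)"] conjI allI impI ballI)
    show "swap2 (b i) \<in> S" if "i < d" for i using b(1)[OF that] by (simp add: mem_swap2_image)
    show "c i = 0" if "(\<lambda>z1 z2. \<Sum>i<d. c i * swap2 (b i) z1 z2) = (\<lambda>_ _. 0)" "i < d" for c i
    proof (rule b(2)[OF _ that(2)])
      show "(\<lambda>z1 z2. \<Sum>i<d. c i * b i z1 z2) = (\<lambda>_ _. 0)"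
        using arg_cong[OF that(1), of swap2] by (simp add: swap2_def)
    qed
    show "\<exists>c. f = (\<lambda>z1 z2. \<Sum>i<d. c i * swap2 (b i) z1 z2)" if "f \<in> S" for f
    proof -
      have "swap2 f \<in> swap2 ` S" using that by (rule imageI)
      from b(3)[OF this] obtain c where "swap2 f = (\<lambda>z1 z2. \<Sum>i<d. c i * b i z1 z2)" ..
      from arg_cong[OF this, of swap2] show ?thesis by (auto simp: swap2_def)
    qed
  qed
qed

lemma closed_subspace2_D:
  assumes "closed_subspace2 S"
  shows "S \<subseteq> H2_2" "(\<lambda>_ _. 0) \<in> S"
    "f \<in> S \<Longrightarrow> g \<in> S \<Longrightarrow> (\<lambda>z1 z2. f z1 z2 + g z1 z2) \<in> S" "f \<in> S \<Longrightarrow> (\<lambda>z1 z2. a * f z1 z2) \<in> S"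
  using assms unfolding closed_subspace2_def by blast+

theorem theorem2p2:
  fixes p :: "complex poly poly" and m n :: nat
    and S1 S2 :: "(complex \<Rightarrow> complex \<Rightarrow> complex) set"
  assumes nozero: "\<forall>z1\<in>disc. \<forall>z2\<in>disc. eval2 p z1 z2 \<noteq> 0"
    and degp: "deg1 p \<le> m" "deg2 p \<le> n"
    and degTheta: "max (deg1 p) (deg1 (refl2 m n p)) = m"
                  "max (deg2 p) (deg2 (refl2 m n p)) = n"
    and copr: "coprime p (refl2 m n p)"
    and S1: "closed_subspace2 S1" "\<forall>f\<in>S1. Mz1 f \<in> S1"
    and S2: "closed_subspace2 S2" "\<forall>f\<in>S2. Mz2 f \<in> S2"
    and orth: "\<forall>f\<in>S1. \<forall>g\<in>S2. inner2 f g = 0"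
    and decomp: "model2 (RIF m n p) = {(\<lambda>z1 z2. f z1 z2 + g z1 z2) | f g. f \<in> S1 \<and> g \<in> S2}"
  shows
    "(\<forall>\<tau>\<in>circle - {\<tau>\<in>circle. \<exists>\<tau>1\<in>circle. eval2 p \<tau>1 \<tau> = 0}.
        blaschke_deg (\<lambda>z. RIF m n p z \<tau>) m \<and>
        (\<forall>f\<in>wander Mz2 S2. \<forall>z\<in>disc. \<exists>L. ((\<lambda>r::real. f z (of_real r * \<tau>)) \<longlongrightarrow> L) (at_left 1)) \<and>
        unitary_onto (wander Mz2 S2) (model1 (\<lambda>z. RIF m n p z \<tau>)) (\<lambda>f. slice_second f \<tau>))
     \<and> has_dim2 (wander Mz2 S2) m
     \<and> (\<forall>\<tau>\<in>circle - {\<tau>\<in>circle. \<exists>\<tau>2\<in>circle. eval2 p \<tau> \<tau>2 = 0}.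
        blaschke_deg (\<lambda>w. RIF m n p \<tau> w) n \<and>
        (\<forall>g\<in>wander Mz1 S1. \<forall>w\<in>disc. \<exists>L. ((\<lambda>r::real. g (of_real r * \<tau>) w) \<longlongrightarrow> L) (at_left 1)) \<and>
        unitary_onto (wander Mz1 S1) (model1 (\<lambda>w. RIF m n p \<tau> w)) (\<lambda>g. slice_first g \<tau>))
     \<and> has_dim2 (wander Mz1 S1) n"
proof -
  define c where "c = coef2 p"
  have p: "eval2 p z1 z2 = pv m n c z1 z2" for z1 z2
    unfolding c_def by (rule eval2_pv[OF degp])
  have q: "eval2 (refl2 m n p) z1 z2 = pv m n (rc m n c) z1 z2" for z1 z2
    unfolding c_def by (rule eval2_refl2)
  have \<Theta>: "RIF m n p = rif m n c"
    unfolding c_def by (rule RIF_eq_rif[OF degp])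
  have nz: "pv m n c z1 z2 \<noteq> 0" if "z1 \<in> disc" "z2 \<in> disc" for z1 z2
    using nozero that p by metis
  have "p \<noteq> 0"
    using nozero[rule_format, of 0 0] by (auto simp: eval2_0)
  then obtain a b r where bez: "a * p + b * refl2 m n p = [:r:]" "r \<noteq> 0"
    using coprime_bivariate_bezout[OF copr] by metis
  interpret A: agler m n c S1 S2
  proof
    show "inner2 (Mult2 (rif m n c) f) (Mult2 (rif m n c) g) = inner2 f g" if "f \<in> H2_2" "g \<in> H2_2" for f g
      unfolding rif_def by (rule refl_quotient_isometry[OF nz p q bez that])
    show "pv m n c z1 z2 \<noteq> 0" if "z1 \<in> disc" "z2 \<in> disc" for z1 z2
      using that by (rule nz)
    show "model2 (rif m n c) = {(\<lambda>z1 z2. f z1 z2 + g z1 z2) | f g. f \<in> S1 \<and> g \<in> S2}"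
      using decomp unfolding \<Theta> .
    show "Mz1 f \<in> S1" if "f \<in> S1" for f using S1(2) that by blast
    show "Mz2 f \<in> S2" if "f \<in> S2" for f using S2(2) that by blast
    show "inner2 f g = 0" if "f \<in> S1" "g \<in> S2" for f g using orth that by blast
  qed (fact closed_subspace2_D[OF S1(1)] closed_subspace2_D[OF S2(1)])+
  interpret sw: agler n m "\<lambda>j k. c k j" "swap2 ` S2" "swap2 ` S1" by (rule A.agler_swap)
  have swW: "sw.W2 = swap2 ` A.W1"
    by (rule set_eqI) (simp only: A.W1_swap2 mem_swap2_image)
  have W1H: "A.W1 \<subseteq> H2_2" using A.W1_D(2) by (rule subsetI)
  have rif_sw: "rif n m (\<lambda>j k. c k j) w \<tau> = RIF m n p \<tau> w" for w \<tau>
    unfolding rif_swap[of n m c] \<Theta> by (simp add: swap2_def)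
  have slice_sw: "slice_first g \<tau> = slice_second (swap2 g) \<tau>" for g \<tau>
    by (simp add: slice_first_def slice_second_def swap2_def)
  have first: "blaschke_deg (\<lambda>z. RIF m n p z \<tau>) m"
      "\<forall>f\<in>wander Mz2 S2. \<forall>z\<in>disc. \<exists>L. ((\<lambda>r::real. f z (of_real r * \<tau>)) \<longlongrightarrow> L) (at_left 1)"
      "unitary_onto (wander Mz2 S2) (model1 (\<lambda>z. RIF m n p z \<tau>)) (\<lambda>f. slice_second f \<tau>)"
      "has_dim2 (wander Mz2 S2) m"
    if "\<tau> \<in> circle" "\<forall>\<tau>1\<in>circle. eval2 p \<tau>1 \<tau> \<noteq> 0" for \<tau>
  proof -
    have E: "\<And>\<tau>1. \<tau>1 \<in> circle \<Longrightarrow> pv m n c \<tau>1 \<tau> \<noteq> 0" using that(2) p by metis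
    note st = A.slice_theorem[OF that(1) E]
    show "blaschke_deg (\<lambda>z. RIF m n p z \<tau>) m"
      "unitary_onto (wander Mz2 S2) (model1 (\<lambda>z. RIF m n p z \<tau>)) (\<lambda>f. slice_second f \<tau>)"
      "has_dim2 (wander Mz2 S2) m"
      unfolding \<Theta> by (rule st; assumption)+
    show "\<forall>f\<in>wander Mz2 S2. \<forall>z\<in>disc. \<exists>L. ((\<lambda>r::real. f z (of_real r * \<tau>)) \<longlongrightarrow> L) (at_left 1)"
      using st(2) by blast
  qed
  have second: "blaschke_deg (\<lambda>w. RIF m n p \<tau> w) n"
      "\<forall>g\<in>wander Mz1 S1. \<forall>w\<in>disc. \<exists>L. ((\<lambda>r::real. g (of_real r * \<tau>) w) \<longlongrightarrow> L) (at_left 1)"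
      "unitary_onto (wander Mz1 S1) (model1 (\<lambda>w. RIF m n p \<tau> w)) (\<lambda>g. slice_first g \<tau>)"
      "has_dim2 (wander Mz1 S1) n"
    if "\<tau> \<in> circle" "\<forall>\<tau>2\<in>circle. eval2 p \<tau> \<tau>2 \<noteq> 0" for \<tau>
  proof -
    have E: "\<And>\<tau>2. \<tau>2 \<in> circle \<Longrightarrow> pv n m (\<lambda>j k. c k j) \<tau>2 \<tau> \<noteq> 0"
      unfolding pv_swap[of n m c] using that(2) p by metis
    note st = sw.slice_theorem[OF that(1) E, unfolded rif_sw swW]
    show "blaschke_deg (\<lambda>w. RIF m n p \<tau> w) n" by (rule st(1); assumption)
    show "unitary_onto (wander Mz1 S1) (model1 (\<lambda>w. RIF m n p \<tau> w)) (\<lambda>g. slice_first g \<tau>)"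
      unfolding slice_sw by (rule unitary_onto_swap2[OF _ W1H]) (rule st(3); assumption)
    show "has_dim2 (wander Mz1 S1) n"
      by (rule has_dim2_swap2) (rule st(4); assumption)
    show "\<forall>g\<in>wander Mz1 S1. \<forall>w\<in>disc. \<exists>L. ((\<lambda>r::real. g (of_real r * \<tau>) w) \<longlongrightarrow> L) (at_left 1)"
    proof (intro ballI)
      fix g w assume g: "g \<in> wander Mz1 S1" "w \<in> disc"
      then have "\<exists>L. ((\<lambda>r::real. swap2 g w (of_real r * \<tau>)) \<longlongrightarrow> L) (at_left 1)"
        by (intro st(2)) auto
      then show "\<exists>L. ((\<lambda>r::real. g (of_real r * \<tau>) w) \<longlongrightarrow> L) (at_left 1)"
        by (simp add: swap2_def)
    qed
  qed
  have common: "eval2 (refl2 m n p) z1 z2 = 0" if "z1 \<in> circle" "z2 \<in> circle" "eval2 p z1 z2 = 0" for z1 z2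
    using that(3) unfolding p q pv_refl_torus[OF that(1,2)] by simp
  \<comment> \<open>The dimension claims name no tau, whereas \<open>first\<close> and
    \<open>second\<close> obtain them from a slice without zeros; one such slice is needed in each
    direction.\<close>
  have good: "\<exists>\<tau>\<in>circle. \<forall>\<tau>2\<in>circle. eval2 p \<tau> \<tau>2 \<noteq> 0" "\<exists>\<tau>\<in>circle. \<forall>\<tau>1\<in>circle. eval2 p \<tau>1 \<tau> \<noteq> 0"
    by (rule exists_good_slices[OF bez copr], rule common, assumption+)+
  obtain \<tau> \<tau>' where \<tau>: "\<tau> \<in> circle" "\<forall>\<tau>2\<in>circle. eval2 p \<tau> \<tau>2 \<noteq> 0"
    "\<tau>' \<in> circle" "\<forall>\<tau>1\<in>circle. eval2 p \<tau>1 \<tau>' \<noteq> 0" using good(1,2) by blast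
  show ?thesis
  proof (intro conjI ballI allI)
    show "has_dim2 (wander Mz2 S2) m" by (rule first(4)[OF \<tau>(3,4)])
    show "has_dim2 (wander Mz1 S1) n" by (rule second(4)[OF \<tau>(1,2)])
  next
    fix \<tau> assume "\<tau> \<in> circle - {\<tau>\<in>circle. \<exists>\<tau>1\<in>circle. eval2 p \<tau>1 \<tau> = 0}"
    then have \<tau>: "\<tau> \<in> circle" "\<forall>\<tau>1\<in>circle. eval2 p \<tau>1 \<tau> \<noteq> 0" by auto
    show "blaschke_deg (\<lambda>z. RIF m n p z \<tau>) m" by (rule first(1)[OF \<tau>])
    show "unitary_onto (wander Mz2 S2) (model1 (\<lambda>z. RIF m n p z \<tau>)) (\<lambda>f. slice_second f \<tau>)"
      by (rule first(3)[OF \<tau>])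
    show "\<exists>L. ((\<lambda>r::real. f z (of_real r * \<tau>)) \<longlongrightarrow> L) (at_left 1)"
      if "f \<in> wander Mz2 S2" "z \<in> disc" for f z
      by (rule first(2)[OF \<tau>, THEN bspec, THEN bspec]) (rule that)+
  next
    fix \<tau> assume "\<tau> \<in> circle - {\<tau>\<in>circle. \<exists>\<tau>2\<in>circle. eval2 p \<tau> \<tau>2 = 0}"
    then have \<tau>: "\<tau> \<in> circle" "\<forall>\<tau>2\<in>circle. eval2 p \<tau> \<tau>2 \<noteq> 0" by auto
    show "blaschke_deg (\<lambda>w. RIF m n p \<tau> w) n" by (rule second(1)[OF \<tau>])
    show "unitary_onto (wander Mz1 S1) (model1 (\<lambda>w. RIF m n p \<tau> w)) (\<lambda>g. slice_first g \<tau>)"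
      by (rule second(3)[OF \<tau>])
    show "\<exists>L. ((\<lambda>r::real. g (of_real r * \<tau>) w) \<longlongrightarrow> L) (at_left 1)"
      if "g \<in> wander Mz1 S1" "w \<in> disc" for g w
      by (rule second(2)[OF \<tau>, THEN bspec, THEN bspec]) (rule that)+
  qed
qed

end
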